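(* Let $F(x,v)=\partial_rV(|x|,v)\frac{x}{|x|}\mathcal{H}(x,v)$ and $G(x,v)=g(x)-v$ for $x,v\in\mathbb{R}^2$, where $\mathcal{H}$ is the smooth compactly supported cut-off function described in the context, and assume that $\partial_rV,\ \nabla_v\partial_rV\in L^\infty$ (as functions of $(x,v)\in\mathbb{R}^2\times\mathbb{R}^2$, evaluated at $r=|x|$) and $g\in L^\infty$. Let $f_0(x,v)$ be a nonnegative function in $L^1(\mathbb{R}^2\times\mathbb{R}^2)\cap L^\infty(\mathbb{R}^2\times\mathbb{R}^2)$ with $|x|^2f_0(x,v)\in L^1(\mathbb{R}^2\times\mathbb{R}^2)$ and $$\iint_{\mathbb{R}^2\times\mathbb{R}^2}\frac12|v|^2f_0(x,v)\,dx\,dv=:\mathcal{E}_0<\infty.$$ Then there exists a weak solution $f\in L^\infty(\mathbb{R}_+;L^1(\mathbb{R}^2\times\mathbb{R}^2))$ to the mean field equation $$\partial_tf+v\cdot\nabla_xf+\nabla_v\cdot[(F*f)f]+\nabla_v\cdot(Gf)=0$$ with initial data $f_0$ (in the sense defined in the context). Moreover, there is a constant $C$ independent of $t$ such that this solution satisfies $$0\le f(t,x,v)\le\|f_0\|_{L^\infty(\mathbb{R}^2\times\mathbb{R}^2)}e^{Ct}\quad\text{for a.e. }(x,v)\in\mathbb{R}^2\times\mathbb{R}^2,\ t\ge0,$$ the mass conservation $$\iint_{\mathbb{R}^2\times\mathbb{R}^2}f(t,x,v)\,dx\,dv=\iint_{\mathbb{R}^2\times\mathbb{R}^2}f_0(x,v)\,dx\,dv=:\mathcal{M}_0,$$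 and the kinetic energy bound $$\mathcal{E}(t):=\iint_{\mathbb{R}^2\times\mathbb{R}^2}\frac12|v|^2f(t,x,v)\,dx\,dv\le C\quad\text{for all }t\ge0.$$
   Context: The unknown is $f=f(t,x,v)$ with $t\ge 0$, position $x\in\mathbb{R}^2$ and velocity $v\in\mathbb{R}^2$. Force: $V=V(r,v)$ is a real-valued potential, $r\ge0$, $v\in\mathbb{R}^2$, so that $\nabla_x[V(|x|,v)]=\partial_rV(|x|,v)\frac{x}{|x|}$. The total force is considered on a bounded domain: for fixed $R,\widetilde R>0$, $\mathcal{H}(x,v):=\mathcal{H}_{2R}(|x|)\,\widetilde{\mathcal{H}}_{2\widetilde R}(|v|)$, where $\mathcal{H}_{2R}$ and $\widetilde{\mathcal{H}}_{2\widetilde R}$ are smooth compactly supported functions with $\mathcal{H}_{2R}(|x|)=0$ for $|x|>2R$, $\mathcal{H}_{2R}(|x|)=1$ for $|x|<R$, $\widetilde{\mathcal{H}}_{2\widetilde R}(|v|)=0$ for $|v|>2\widetilde R$, $\widetilde{\mathcal{H}}_{2\widetilde R}(|v|)=1$ for $|v|<\widetilde R$. Acceleration: $g:\mathbb{R}^2\to\mathbb{R}^2$ is a function of $x$ only. Convolution is in both variables: $(F*f)(t,x,v)=\iint_{\mathbb{R}^2\times\mathbb{R}^2}F(x-y,v-w)f(t,y,w)\,dy\,dw$. Weak solution: for $f_0\in L^1(\mathbb{R}^2\times\mathbb{R}^2)\cap L^\infty(\mathbb{R}^2\times\mathbb{R}^2)$, a function $f=f(t,x,v)$ is a weak solution with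 initial data $f_0$ if for all $\varphi\in C_0^\infty(\mathbb{R}^2\times\mathbb{R}^2)$ and all $t\in\mathbb{R}_+$, $$\iint f(t,x,v)\varphi(x,v)\,dx\,dv=\iint f_0(x,v)\varphi(x,v)\,dx\,dv+\int_0^t\iint v f(s,x,v)\cdot\nabla_x\varphi(x,v)\,dx\,dv\,ds$$ $$+\int_0^t\iint(F*f)(s,x,v)f(s,x,v)\cdot\nabla_v\varphi(x,v)\,dx\,dv\,ds+\int_0^t\iint G(x,v)f(s,x,v)\cdot\nabla_v\varphi(x,v)\,dx\,dv\,ds,$$ where all double integrals are over $\mathbb{R}^2\times\mathbb{R}^2$. *)

theory Defs
  imports "HOL-Analysis.Analysis" "HOL-Probability.Essential_Supremum"
begin

section \<open>Smooth functions, test functions, weak derivatives\<close>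

text \<open>\<open>C_k k f\<close> is $f \in C^k$: all directional derivatives are again of class $C^{k-1}$.\<close>

primrec C_k :: "nat \<Rightarrow> ('a::euclidean_space \<Rightarrow> real) \<Rightarrow> bool" where
  "C_k 0 f \<longleftrightarrow> continuous_on UNIV f"
| "C_k (Suc k) f \<longleftrightarrow>
     (\<forall>x. f differentiable (at x)) \<and> (\<forall>h. C_k k (\<lambda>x. frechet_derivative f (at x) h))"

definition smooth_fun :: "('a::euclidean_space \<Rightarrow> real) \<Rightarrow> bool" where
  "smooth_fun f \<longleftrightarrow> (\<forall>k. C_k k f)"

text \<open>The class $C_0^\infty(S)$ for open \<open>S\<close>, its members extended by zero to the whole space.\<close>

definition test_fun :: "'a::euclidean_space set \<Rightarrow> ('a \<Rightarrow> real) \<Rightarrow> bool" where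
  "test_fun S \<phi> \<longleftrightarrow>
     smooth_fun \<phi> \<and> compact (closure {z. \<phi> z \<noteq> 0}) \<and> closure {z. \<phi> z \<noteq> 0} \<subseteq> S"

definition locally_integrable :: "'a::euclidean_space set \<Rightarrow> ('a \<Rightarrow> real) \<Rightarrow> bool" where
  "locally_integrable S u \<longleftrightarrow> (\<forall>K. compact K \<longrightarrow> K \<subseteq> S \<longrightarrow> u absolutely_integrable_on K)"

text \<open>\<open>w\<close> is the weak (distributional) derivative of \<open>u\<close> in direction \<open>e\<close> on the open set \<open>S\<close>.\<close>

definition has_weak_deriv ::
  "'a::euclidean_space set \<Rightarrow> 'a \<Rightarrow> ('a \<Rightarrow> real) \<Rightarrow> ('a \<Rightarrow> real) \<Rightarrow> bool" where
  "has_weak_deriv S e u w \<longleftrightarrow>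
     locally_integrable S u \<and> locally_integrable S w \<and>
     (\<forall>\<phi>. test_fun S \<phi> \<longrightarrow>
        (LINT z|lebesgue. u z * frechet_derivative \<phi> (at z) e) = - (LINT z|lebesgue. w z * \<phi> z))"

text \<open>\<open>W\<close> is $\partial_r V$, where \<open>V\<close> is regarded as a function of $(r,v) \in (0,\infty) \times \mathbb{R}^2$;
  values at $r \le 0$ are irrelevant.\<close>

definition is_dr :: "(real \<Rightarrow> real^2 \<Rightarrow> real) \<Rightarrow> (real \<Rightarrow> real^2 \<Rightarrow> real) \<Rightarrow> bool" where
  "is_dr V W \<longleftrightarrow> has_weak_deriv ({0<..} \<times> UNIV) (1, 0) (\<lambda>(r, v). V r v) (\<lambda>(r, v). W r v)"

text \<open>\<open>D\<close> is $\nabla_v W$, for \<open>W\<close> regarded in the same way.\<close>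

definition is_grad_v :: "(real \<Rightarrow> real^2 \<Rightarrow> real) \<Rightarrow> (real \<Rightarrow> real^2 \<Rightarrow> real^2) \<Rightarrow> bool" where
  "is_grad_v W D \<longleftrightarrow>
     (\<forall>i. has_weak_deriv ({0<..} \<times> UNIV) (0, axis i 1) (\<lambda>(r, v). W r v) (\<lambda>(r, v). D r v $ i))"

section \<open>Lebesgue spaces\<close>

text \<open>\<^const>\<open>esssup\<close> is infinite for non-measurable functions, so finiteness includes measurability
  of the norm only; measurability of the function itself is required separately.\<close>

definition in_Linf :: "'a measure \<Rightarrow> ('a \<Rightarrow> 'b::real_normed_vector) \<Rightarrow> bool" where
  "in_Linf M f \<longleftrightarrow> f \<in> borel_measurable M \<and> esssup M (\<lambda>x. ereal (norm (f x))) < \<infinity>"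

definition Linf_norm :: "'a measure \<Rightarrow> ('a \<Rightarrow> 'b::real_normed_vector) \<Rightarrow> real" where
  "Linf_norm M f = real_of_ereal (esssup M (\<lambda>x. ereal (norm (f x))))"

text \<open>$f \in L^\infty(\mathbb{R}_+; L^1)$. Strong measurability of $t \mapsto f(t)$ into the
  separable space $L^1$ is expressed by joint measurability.\<close>

definition in_Linf_L1 :: "(real \<Rightarrow> 'a::euclidean_space \<Rightarrow> real) \<Rightarrow> bool" where
  "in_Linf_L1 f \<longleftrightarrow>
     (\<lambda>(t, z). f t z) \<in> borel_measurable (lebesgue_on ({0..} \<times> UNIV)) \<and>
     (AE t in lebesgue_on {0..}. integrable lebesgue (f t)) \<and>
     in_Linf (lebesgue_on {0..}) (\<lambda>t. LINT z|lebesgue. \<bar>f t z\<bar>)"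

section \<open>The mean field equation\<close>

text \<open>Phase space points are pairs $(x,v)$.\<close>

type_synonym phase = "(real^2) \<times> (real^2)"

definition grad :: "(real^2 \<Rightarrow> real) \<Rightarrow> real^2 \<Rightarrow> real^2" where
  "grad h x = (\<chi> i. frechet_derivative h (at x) (axis i 1))"

definition grad_x :: "(phase \<Rightarrow> real) \<Rightarrow> phase \<Rightarrow> real^2" where
  "grad_x \<phi> z = grad (\<lambda>x. \<phi> (x, snd z)) (fst z)"

definition grad_v :: "(phase \<Rightarrow> real) \<Rightarrow> phase \<Rightarrow> real^2" where
  "grad_v \<phi> z = grad (\<lambda>v. \<phi> (fst z, v)) (snd z)"

text \<open>A cut-off profile \<open>h\<close> is a function of the modulus; smoothness is that of $x \mapsto h(|x|)$ on
  $\mathbb{R}^2$, and the compact support is a consequence of the second condition.\<close>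

definition cutoff :: "real \<Rightarrow> (real \<Rightarrow> real) \<Rightarrow> bool" where
  "cutoff R h \<longleftrightarrow>
     smooth_fun (\<lambda>x::real^2. h (norm x)) \<and>
     (\<forall>x::real^2. norm x > 2 * R \<longrightarrow> h (norm x) = 0) \<and>
     (\<forall>x::real^2. norm x < R \<longrightarrow> h (norm x) = 1)"

text \<open>The total force; \<open>Vr\<close> plays the role of $\partial_r V$ and \<open>H1\<close>, \<open>H2\<close> are the cut-off profiles
  in position and velocity. On the null set $x = 0$ the force is \<open>0\<close>.\<close>

definition force ::
  "(real \<Rightarrow> real^2 \<Rightarrow> real) \<Rightarrow> (real \<Rightarrow> real) \<Rightarrow> (real \<Rightarrow> real) \<Rightarrow> phase \<Rightarrow> real^2" where
  "force Vr H1 H2 = (\<lambda>(x, v). (Vr (norm x) v * (H1 (norm x) * H2 (norm v))) *\<^sub>R (x /\<^sub>R norm x))"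

definition acceleration :: "(real^2 \<Rightarrow> real^2) \<Rightarrow> phase \<Rightarrow> real^2" where
  "acceleration g = (\<lambda>(x, v). g x - v)"

definition conv :: "(phase \<Rightarrow> real^2) \<Rightarrow> (phase \<Rightarrow> real) \<Rightarrow> phase \<Rightarrow> real^2" where
  "conv F h = (\<lambda>(x, v). LINT (y, w)|lebesgue. h (y, w) *\<^sub>R F (x - y, v - w))"

text \<open>An integral of a non-integrable function is \<open>0\<close> in Isabelle/HOL, hence a weak solution is
  additionally required to make every integral in the weak formulation absolutely convergent.
  The argument \<open>Q\<close> below is an integrand depending on time and phase space.\<close>

definition time_integrable :: "real \<Rightarrow> (real \<Rightarrow> phase \<Rightarrow> real) \<Rightarrow> bool" where
  "time_integrable t Q \<longleftrightarrow>
     (AE s in lebesgue_on {0..t}. integrable lebesgue (Q s)) \<and>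
     set_integrable lebesgue {0..t} (\<lambda>s. LINT z|lebesgue. Q s z)"

definition weak_solution ::
  "(phase \<Rightarrow> real^2) \<Rightarrow> (phase \<Rightarrow> real^2) \<Rightarrow> (phase \<Rightarrow> real) \<Rightarrow> (real \<Rightarrow> phase \<Rightarrow> real) \<Rightarrow> bool" where
  "weak_solution F G f0 f \<longleftrightarrow>
     (AE s in lebesgue_on {0..}. AE (x, v) in lebesgue.
        integrable lebesgue (\<lambda>(y, w). f s (y, w) *\<^sub>R F (x - y, v - w))) \<and>
     (\<forall>\<phi> t. test_fun UNIV \<phi> \<longrightarrow> 0 \<le> t \<longrightarrow>
        integrable lebesgue (\<lambda>z. f t z * \<phi> z) \<and>
        integrable lebesgue (\<lambda>z. f0 z * \<phi> z) \<and>
        time_integrable t (\<lambda>s z. (f s z *\<^sub>R snd z) \<bullet> grad_x \<phi> z) \<and>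
        time_integrable t (\<lambda>s z. (f s z *\<^sub>R conv F (f s) z) \<bullet> grad_v \<phi> z) \<and>
        time_integrable t (\<lambda>s z. (f s z *\<^sub>R G z) \<bullet> grad_v \<phi> z) \<and>
        (LINT z|lebesgue. f t z * \<phi> z) =
          (LINT z|lebesgue. f0 z * \<phi> z)
          + (LINT s:{0..t}|lebesgue. (LINT z|lebesgue. (f s z *\<^sub>R snd z) \<bullet> grad_x \<phi> z))
          + (LINT s:{0..t}|lebesgue. (LINT z|lebesgue. (f s z *\<^sub>R conv F (f s) z) \<bullet> grad_v \<phi> z))
          + (LINT s:{0..t}|lebesgue. (LINT z|lebesgue. (f s z *\<^sub>R G z) \<bullet> grad_v \<phi> z)))"

definition mass :: "(phase \<Rightarrow> real) \<Rightarrow> real" where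
  "mass h = (LINT z|lebesgue. h z)"

definition kinetic_energy :: "(phase \<Rightarrow> real) \<Rightarrow> real" where
  "kinetic_energy h = (LINT (x, v)|lebesgue. 1/2 * (norm v)\<^sup>2 * h (x, v))"

end

theory Submission
  imports Defs "HOL-Library.Diagonal_Subsequence"
begin

text \<open>
  Time is discretised: in a step of length \<open>h\<close> the velocity \<open>v\<close> becomes
  \<open>(1 - h) v + h (g x + (F * \<mu>) (x, v))\<close>, then \<open>x\<close> moves by \<open>h\<close> times the new velocity, and the measure \<open>\<mu>\<close>
  is pushed forward. The bound on the velocity gradient of \<open>F\<close> makes the convolution Lipschitz in \<open>v\<close>, so the
  kick shrinks distances at most by a factor \<open>1 - O(h)\<close> and the density grows at most like \<open>exp (C t)\<close>. The new velocity
  is a convex combination of the old one and a bounded vector, which bounds the kinetic energy uniformly in time.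

  Density and second moment bounds dominate the discrete measures, up to small errors, by one finite measure.
  A subsequence therefore converges on every Borel set, and so do the products with themselves.
  This strong mode of convergence carries the quadratic
  interaction term to the limit although \<open>F\<close> is merely bounded and measurable in \<open>x\<close>.
\<close>

text \<open>Splitting a step into two motions is what makes regularity in \<open>v\<close> alone
  sufficient: during the kick \<open>x\<close> is frozen, so only slices in \<open>v\<close> are
  distorted, and the motion afterwards translates slices in \<open>x\<close> and preserves volume.
  The velocity field is Lipschitz but not known to be differentiable in \<open>v\<close>, hence a
  Vitali covering argument takes the place of a Jacobian. The bound on the velocity gradient of
  \<open>Vr\<close> is weak in \<open>(r, v)\<close> but essential in \<open>(x, v)\<close>. Testing
  with smoothed cubes and differentiating integrals over cubes turns it into a difference estimate,
  almost everywhere for each fixed shift; polar coordinates carry null sets between the two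
  settings. The smooth functions for this are built from the given cut-off. A diagonal argument
  reaches only countably many times and sets. The remaining times come from equicontinuity in time
  of integrals of Lipschitz functions, and closed sets are recovered from such integrals because
  thin shells around them carry uniformly little mass.\<close>

section \<open>Iterated differentiability\<close>

lemma C_k_Suc_imp: "C_k (Suc k) f \<Longrightarrow> C_k k f"
proof (induction k arbitrary: f)
  case 0
  then show ?case
    by (auto intro!: continuous_at_imp_continuous_on differentiable_imp_continuous_within)
next
  case (Suc k)
  then show ?case by (metis C_k.simps(2))
qed

lemma C_k_const [simp]: "C_k k (\<lambda>x. c)"
  by (induction k arbitrary: c) (auto simp: frechet_derivative_const)

lemma C_k_add:
  assumes "C_k k f" "C_k k g" shows "C_k k (\<lambda>x. f x + g x)"
  using assms
proof (induction k arbitrary: f g)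
  case 0 then show ?case by (auto intro: continuous_intros)
next
  case (Suc k)
  then have d: "\<And>x. f differentiable at x" "\<And>x. g differentiable at x" by auto
  have "frechet_derivative (\<lambda>x. f x + g x) (at x) h
      = frechet_derivative f (at x) h + frechet_derivative g (at x) h" for x h
    using frechet_derivative_at[OF has_derivative_add[OF
        frechet_derivative_works[THEN iffD1, OF d(1)] frechet_derivative_works[THEN iffD1, OF d(2)]]] by metis
  then show ?case using Suc d by (auto intro: differentiable_add)
qed

lemma C_k_mult:
  assumes "C_k k f" "C_k k g" shows "C_k k (\<lambda>x. f x * g x)"
  using assms
proof (induction k arbitrary: f g)
  case 0 then show ?case by (auto intro: continuous_intros)
next
  case (Suc k)
  then have d: "\<And>x. f differentiable at x" "\<And>x. g differentiable at x" by auto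
  have *: "frechet_derivative (\<lambda>x. f x * g x) (at x) h
      = f x * frechet_derivative g (at x) h + frechet_derivative f (at x) h * g x" for x h
    using frechet_derivative_at[OF has_derivative_mult[OF
        frechet_derivative_works[THEN iffD1, OF d(1)] frechet_derivative_works[THEN iffD1, OF d(2)]]] by metis
  have "C_k k (\<lambda>x. f x * frechet_derivative g (at x) h + frechet_derivative f (at x) h * g x)" for h
    using Suc.prems C_k_Suc_imp[of k] by (intro C_k_add Suc.IH) auto
  then show ?case using d * by (auto intro: differentiable_mult)
qed

lemma C_k_diff:
  assumes "C_k k f" "C_k k g" shows "C_k k (\<lambda>x. f x - g x)"
  using C_k_add[OF assms(1) C_k_mult[OF C_k_const[of k "-1"] assms(2)]] by simp

lemma C_k_affine:
  fixes A :: "'b::euclidean_space \<Rightarrow> 'a::euclidean_space"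
  assumes "C_k k f" and A: "bounded_linear A" shows "C_k k (\<lambda>x. f (A x + c))"
  using assms(1)
proof (induction k arbitrary: f)
  case 0
  have "continuous_on UNIV (\<lambda>x. A x + c)"
    using A by (intro continuous_intros linear_continuous_on)
  with 0 show ?case by (auto intro: continuous_on_compose2[of UNIV f UNIV])
next
  case (Suc k)
  then have d: "f differentiable at x" for x by auto
  have hd: "((\<lambda>x. f (A x + c)) has_derivative (\<lambda>h. frechet_derivative f (at (A x + c)) (A h))) (at x)" for x
    by (rule has_derivative_compose[of "\<lambda>x. A x + c" A, OF _ frechet_derivative_works[THEN iffD1, OF d]])
       (auto intro!: derivative_eq_intros bounded_linear_imp_has_derivative A)
  have "frechet_derivative (\<lambda>x. f (A x + c)) (at x) h = frechet_derivative f (at (A x + c)) (A h)" for x h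
    using frechet_derivative_at[OF hd] by metis
  moreover have "C_k k (\<lambda>x. frechet_derivative f (at (A x + c)) (A h))" for h
    using Suc by (intro Suc.IH) auto
  moreover have "(\<lambda>x. f (A x + c)) differentiable (at x)" for x
    using hd by (rule differentiableI)
  ultimately show ?case by simp
qed

section \<open>Smooth transitions from 0 to 1 on the line\<close>

lemma C_k_antiderivative:
  fixes Q :: "real \<Rightarrow> real"
  assumes Q: "\<And>x. (Q has_real_derivative q x) (at x)" and q: "\<And>k. C_k k q"
  shows "C_k k Q"
proof -
  have "frechet_derivative Q (at x) h = q x * h" for x h
    using frechet_derivative_at[OF Q[unfolded has_field_derivative_def]] by metis
  then have "C_k (Suc k) Q"
    using Q q by (auto intro!: C_k_mult simp: differentiable_def has_field_derivative_def; blast)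
  then show ?thesis by (rule C_k_Suc_imp)
qed

text \<open>Starting the integral one unit to the left of \<open>a\<close>, in the region where
  \<open>q\<close> vanishes, gives a primitive on the whole line: for \<open>x < a\<close> it is
  zero near \<open>x\<close>, and otherwise \<open>x\<close> is an interior point of
  \<open>{a-1..x+1}\<close>, so the derivative within the interval is a full derivative.\<close>

lemma integral_antiderivative:
  fixes q :: "real \<Rightarrow> real"
  assumes q: "continuous_on UNIV q" "\<And>x. x \<le> a \<Longrightarrow> q x = 0"
  shows "((\<lambda>x. integral {a-1..x} q) has_real_derivative q x) (at x)"
proof (cases "x < a")
  case True
  have "((\<lambda>x. 0::real) has_real_derivative q x) (at x)" using True q by simp
  then show ?thesis
  proof (rule DERIV_cong_ev[OF refl _ refl, THEN iffD1, rotated])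
    have "\<forall>\<^sub>F y in nhds x. y < a" using True eventually_nhds_in_open[of "{..<a}" x] by auto
    then show "\<forall>\<^sub>F y in nhds x. 0 = integral {a - 1..y} q"
    proof eventually_elim
      case (elim y)
      have "integral {a-1..y} q = integral {a-1..y} (\<lambda>_. 0)"
        by (rule integral_cong) (use elim q in auto)
      then show ?case by simp
    qed
  qed
next
  case False
  have "((\<lambda>x. integral {a-1..x} q) has_real_derivative q x) (at x within {a-1..x+1})"
    by (rule integral_has_real_derivative) (use q False in \<open>auto intro: continuous_on_subset\<close>)
  then show ?thesis using False by (subst (asm) at_within_interior) auto
qed

definition smooth_step :: "(real \<Rightarrow> real) \<Rightarrow> bool" where
  "smooth_step S \<longleftrightarrow> smooth_fun S \<and> (\<forall>x\<le>0. S x = 0) \<and> (\<forall>x\<ge>1. S x = 1) \<and> (\<forall>x. 0 \<le> S x \<and> S x \<le> 1)"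

text \<open>The cut-off supplies the nontrivial smooth function: restricted to a line through the
  origin, squared and integrated, it becomes nondecreasing and constant outside
  \<open>[0, 1]\<close>. Division by the final value normalises it.\<close>

lemma smooth_step_exists:
  assumes "cutoff R H" "R > 0"
  obtains S where "smooth_step S"
proof -
  \<comment> \<open>The affine map sends \<open>[0, 1]\<close> onto \<open>[-3R, 3R]\<close>: the
    end points land beyond the support radius \<open>2R\<close>, and \<open>1/2\<close> lands at the
    origin, where the profile is 1. The square enforces nonnegativity, since a cut-off may change
    sign.\<close>
  define \<eta> where "\<eta> x = (H (norm (x *\<^sub>R axis 1 (6*R) + axis 1 (- (3*R)) :: real^2)))^2" for x :: real
  have nrm: "norm (x *\<^sub>R axis 1 (6*R) + axis 1 (- (3*R)) :: real^2) = \<bar>6 * R * x - 3 * R\<bar>" for x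
  proof -
    have "x *\<^sub>R axis 1 (6*R) + axis 1 (- (3*R)) = ((6 * R * x - 3 * R) *\<^sub>R axis 1 1 :: real^2)"
      by (simp add: vec_eq_iff axis_def algebra_simps)
    then show ?thesis by (simp add: norm_axis_1)
  qed
  have sm: "C_k k \<eta>" for k
  proof -
    have "C_k k (\<lambda>x::real^2. H (norm x))" for k using assms(1) by (auto simp: cutoff_def smooth_fun_def)
    from C_k_affine[OF this, of "\<lambda>x. x *\<^sub>R axis 1 (6*R)" k "axis 1 (- (3*R))"]
    have "C_k k (\<lambda>x. H (norm (x *\<^sub>R axis 1 (6*R) + axis 1 (- (3*R)) :: real^2)))"
      by (simp add: bounded_linear_scaleR_left)
    from C_k_mult[OF this this] show ?thesis unfolding \<eta>_def power2_eq_square .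
  qed
  have cont: "continuous_on UNIV \<eta>" using sm[of 0] by simp
  have H0: "H (norm y) = 0" if "norm y > 2 * R" for y :: "real^2"
    using assms(1) that unfolding cutoff_def by blast
  have H1: "H (norm y) = 1" if "norm y < R" for y :: "real^2"
    using assms(1) that unfolding cutoff_def by blast
  have e0: "\<eta> x = 0" if "x \<le> 0 \<or> x \<ge> 1" for x
  proof -
    have "\<bar>6 * R * x - 3 * R\<bar> > 2 * R"
    proof (cases "x \<le> 0")
      case True
      then have "R * x \<le> 0" using \<open>R > 0\<close> by (simp add: mult_le_0_iff)
      then show ?thesis using \<open>R > 0\<close> by linarith
    next
      case False
      then have "R * x \<ge> R" using that \<open>R > 0\<close> by simp
      then show ?thesis using \<open>R > 0\<close> by linarith
    qed
    then show ?thesis unfolding \<eta>_def by (subst H0) (simp_all add: nrm)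
  qed
  have e1: "\<eta> (1/2) = 1" unfolding \<eta>_def by (subst H1) (use \<open>R > 0\<close> in \<open>simp_all add: nrm\<close>)
  have pos: "0 \<le> \<eta> x" for x unfolding \<eta>_def by simp
  define S0 where "S0 x = integral {0-1..x} \<eta>" for x
  have der: "(S0 has_real_derivative \<eta> x) (at x)" for x
    unfolding S0_def by (rule integral_antiderivative) (use cont e0 in auto)
  have mono: "S0 x \<le> S0 y" if "x \<le> y" for x y
    by (rule DERIV_nonneg_imp_nondecreasing[OF that]) (use der pos in blast)
  have S00: "S0 x = 0" if "x \<le> 0" for x
  proof -
    have "integral {0-1..x} \<eta> = integral {0-1..x} (\<lambda>_. 0)"
      by (rule integral_cong) (use that e0 in auto)
    then show ?thesis by (simp add: S0_def)
  qed
  have int: "\<eta> integrable_on {a..b}" for a b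
    by (rule integrable_continuous_real) (use cont continuous_on_subset in blast)
  have S01: "S0 x = S0 1" if "x \<ge> 1" for x
  proof -
    have "integral {0-1..1} \<eta> + integral {1..x} \<eta> = integral {0-1..x} \<eta>"
      by (rule Henstock_Kurzweil_Integration.integral_combine) (use that int in auto)
    moreover have "integral {1..x} \<eta> = integral {1..x} (\<lambda>_. 0)"
      by (rule integral_cong) (use that e0 in auto)
    ultimately show ?thesis by (simp add: S0_def)
  qed
  have "S0 1 \<noteq> 0"
  proof
    assume "S0 1 = 0"
    then have "\<forall>x\<in>{0-1..1}. \<eta> x = 0" unfolding S0_def
      by (subst (asm) integral_eq_0_iff) (use cont continuous_on_subset pos in auto)
    then have "\<eta> (1/2) = 0" by simp
    then show False using e1 by simp
  qed
  moreover have "S0 1 \<ge> 0" using mono[of 0 1] S00[of 0] by simp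
  ultimately have c: "S0 1 > 0" by simp
  have bnd: "0 \<le> S0 x \<and> S0 x \<le> S0 1" for x
  proof (rule conjI)
    show "0 \<le> S0 x" using mono[of 0 x] S00[of x] S00[of 0] by (cases "x \<le> 0") simp_all
    show "S0 x \<le> S0 1" using mono[of x 1] S01[of x] by (cases "x \<le> 1") simp_all
  qed
  show ?thesis
  proof (rule that[of "\<lambda>x. S0 x * (1 / S0 1)"], unfold smooth_step_def, intro conjI allI impI)
    show "smooth_fun (\<lambda>x. S0 x * (1 / S0 1))"
      unfolding smooth_fun_def by (intro allI C_k_mult C_k_antiderivative[OF der] sm C_k_const)
    show "S0 x * (1 / S0 1) = 0" if "x \<le> 0" for x using S00[OF that] by simp
    show "S0 x * (1 / S0 1) = 1" if "1 \<le> x" for x using S01[OF that] c by simp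
    show "0 \<le> S0 x * (1 / S0 1)" "S0 x * (1 / S0 1) \<le> 1" for x using bnd[of x] c by simp_all
  qed
qed

section \<open>Test functions approximating boxes\<close>

lemma integrable_lborel_translate:
  fixes f :: "'a::euclidean_space \<Rightarrow> 'b::{banach, second_countable_topology}"
  assumes "f \<in> borel_measurable borel"
  shows "integrable lborel (\<lambda>z. f (z + c)) \<longleftrightarrow> integrable lborel f"
    and "(LINT z|lborel. f (z + c)) = (LINT z|lborel. f z)"
proof -
  have "integrable (distr lborel borel ((+) c)) f \<longleftrightarrow> integrable lborel (\<lambda>z. f (c + z))"
    using assms by (intro integrable_distr_eq) auto
  then show "integrable lborel (\<lambda>z. f (z + c)) \<longleftrightarrow> integrable lborel f"
    unfolding lborel_distr_plus by (simp add: add.commute)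
  have "integral\<^sup>L (distr lborel borel ((+) c)) f = (LINT z|lborel. f (c + z))"
    using assms by (intro integral_distr) auto
  then show "(LINT z|lborel. f (z + c)) = (LINT z|lborel. f z)"
    unfolding lborel_distr_plus by (simp add: add.commute)
qed

lemma AE_lborel_translate:
  fixes P :: "'a::euclidean_space \<Rightarrow> bool"
  assumes "AE z in lborel. P z" shows "AE z in lborel. P (z + c)"
proof -
  obtain N where N: "N \<in> null_sets lborel" "{z. \<not> P z} \<subseteq> N"
    using assms by (auto simp: eventually_ae_filter)
  have eq: "(\<lambda>z. z + c) -` N = (+) c -` N" by (auto simp: add.commute)
  have "emeasure lborel ((\<lambda>z. z + c) -` N) = emeasure (distr lborel borel ((+) c)) N"
    using N by (subst emeasure_distr) (auto simp: eq null_sets_def)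
  then have "(\<lambda>z. z + c) -` N \<in> null_sets lborel"
    using N unfolding lborel_distr_plus
    by (auto simp: null_sets_def intro!: measurable_sets_borel[of _ borel])
  then show ?thesis using N(2) by (auto simp: eventually_ae_filter intro!: bexI[of _ "(\<lambda>z. z + c) -` N"])
qed

lemma One_pair: "(One :: real \<times> (real^2)) = (1, \<chi> k. 1)"
proof (rule euclidean_eqI)
  fix b :: "real \<times> (real^2)" assume b: "b \<in> Basis"
  have "One \<bullet> b = (\<Sum>i\<in>Basis. if i = b then 1 else 0)"
    unfolding inner_sum_left by (rule sum.cong) (auto simp: inner_Basis b)
  then show "One \<bullet> b = (1, \<chi> k. 1) \<bullet> b"
    using b by (auto simp: Basis_prod_def Basis_vec_def inner_axis)
qed

lemma mem_box_pair:
  fixes c z :: "real \<times> (real^2)"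
  shows "z \<in> box c (c + h *\<^sub>R One) \<longleftrightarrow>
    fst c < fst z \<and> fst z < fst c + h \<and> (\<forall>k. snd c $ k < snd z $ k \<and> snd z $ k < snd c $ k + h)"
  unfolding One_pair
  by (cases z; cases c) (simp add: mem_box Basis_prod_def Basis_vec_def inner_axis ball_Un; blast)

section \<open>Smoothed indicators of cubes in the coordinates \<open>(r, v)\<close>\<close>

locale step_fun =
  fixes S :: "real \<Rightarrow> real"
  assumes S: "smooth_step S"
begin

text \<open>The first factor rises within distance \<open>1 / m\<close> to the right of
  \<open>a\<close>, the second falls within \<open>1 / m\<close> to the left of
  \<open>a + h\<close>. For every \<open>m\<close> the product vanishes outside the interval, so the
  supports stay in one fixed compact set.\<close>

definition bump :: "nat \<Rightarrow> real \<Rightarrow> real \<Rightarrow> real \<Rightarrow> real" where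
  "bump m h a x = S (real m * (x - a)) * S (real m * (a + h - x))"

lemma C_k_S: "C_k k S" and S_bounds: "0 \<le> S x" "S x \<le> 1" and S_0: "x \<le> 0 \<Longrightarrow> S x = 0"
  and S_1: "1 \<le> x \<Longrightarrow> S x = 1"
  using S by (auto simp: smooth_step_def smooth_fun_def)

lemma C_k_bump: "C_k k (bump m h a)"
proof -
  have "C_k k (\<lambda>x. S (real m * x + (- real m * a)))" "C_k k (\<lambda>x. S (- real m * x + real m * (a + h)))"
    by (intro C_k_affine[OF C_k_S] bounded_linear_mult_right)+
  from C_k_mult[OF this] show ?thesis unfolding bump_def by (simp add: algebra_simps)
qed

lemma bump_bounds: "0 \<le> bump m h a x" "bump m h a x \<le> 1"
  unfolding bump_def using S_bounds by (auto intro: mult_le_one)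

lemma bump_0: "x \<le> a \<or> a + h \<le> x \<Longrightarrow> bump m h a x = 0"
  unfolding bump_def using S_0 by (auto simp: mult_le_0_iff)

lemma bump_tendsto: "(\<lambda>m. bump m h a x) \<longlonglongrightarrow> indicat_real {a<..<a+h} x"
proof (cases "a < x \<and> x < a + h")
  case True
  define d where "d = min (x - a) (a + h - x)"
  have "d > 0" using True by (simp add: d_def)
  obtain M :: nat where M: "real M > 1 / d" using reals_Archimedean2 by blast
  have "bump m h a x = 1" if "m \<ge> M" for m
  proof -
    have "real m \<ge> 1 / d" using M that by linarith
    then have md: "real m * d \<ge> 1" using \<open>d > 0\<close> by (simp add: divide_le_eq)
    have "real m * d \<le> real m * (x - a)" "real m * d \<le> real m * (a + h - x)"
      by (intro mult_left_mono; simp add: d_def)+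
    with md show ?thesis unfolding bump_def by (simp add: S_1)
  qed
  then have "\<forall>\<^sub>F m in sequentially. bump m h a x = 1" by (auto simp: eventually_sequentially)
  then show ?thesis using True by (simp add: tendsto_eventually)
next
  case False
  then have "bump m h a x = 0" for m by (intro bump_0) linarith
  moreover have "indicat_real {a<..<a+h} x = 0" using False by auto
  ultimately show ?thesis by simp
qed

definition bump_primitive :: "nat \<Rightarrow> real \<Rightarrow> real \<Rightarrow> real \<Rightarrow> real" where
  "bump_primitive m h a y = integral {a-1..y} (bump m h a)"

lemma bump_primitive_deriv: "(bump_primitive m h a has_real_derivative bump m h a x) (at x)"
  unfolding bump_primitive_def
  by (rule integral_antiderivative) (use C_k_bump[of 0] bump_0 in auto)

lemma C_k_bump_primitive: "C_k k (bump_primitive m h a)"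
  by (rule C_k_antiderivative[OF bump_primitive_deriv C_k_bump])

lemma bump_primitive_mono: "x \<le> y \<Longrightarrow> bump_primitive m h a x \<le> bump_primitive m h a y"
  by (rule DERIV_nonneg_imp_nondecreasing) (use bump_primitive_deriv bump_bounds in blast)+

lemma bump_primitive_0: "y \<le> a \<Longrightarrow> bump_primitive m h a y = 0"
proof -
  assume "y \<le> a"
  then have "integral {a-1..y} (bump m h a) = integral {a-1..y} (\<lambda>_. 0)"
    by (intro integral_cong) (simp add: bump_0)
  then show ?thesis by (simp add: bump_primitive_def)
qed

lemma bump_primitive_const:
  assumes "a + h \<le> x" shows "bump_primitive m h a x = bump_primitive m h a (a + h)"
proof (rule antisym)
  show "bump_primitive m h a x \<le> bump_primitive m h a (a + h)"
  proof (rule DERIV_nonpos_imp_nonincreasing[OF assms])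
    fix y assume "a + h \<le> y"
    then have "(bump_primitive m h a has_real_derivative 0) (at y)"
      using bump_primitive_deriv[of m h a y] bump_0[of y a h m] by simp
    then show "\<exists>z. (bump_primitive m h a has_real_derivative z) (at y) \<and> z \<le> 0" by blast
  qed
qed (rule bump_primitive_mono[OF assms])

text \<open>Since \<open>bump\<close> is at most 1, \<open>y - bump_primitive m h a y\<close> is
  nondecreasing. Comparing its values at \<open>a\<close> and \<open>a + h\<close> bounds the
  primitive there, and beyond \<open>a + h\<close> the primitive is constant.\<close>

lemma bump_primitive_le: assumes "0 \<le> h" shows "bump_primitive m h a x \<le> h"
proof -
  have *: "bump_primitive m h a (a + h) \<le> h"
  proof -
    have "a - bump_primitive m h a a \<le> a + h - bump_primitive m h a (a + h)"
    proof (rule DERIV_nonneg_imp_nondecreasing[where f="\<lambda>y. y - bump_primitive m h a y"])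
      show "a \<le> a + h" using assms by simp
      fix x
      have "((\<lambda>y. y - bump_primitive m h a y) has_real_derivative (1 - bump m h a x)) (at x)"
        by (auto intro!: derivative_eq_intros bump_primitive_deriv)
      then show "\<exists>y. ((\<lambda>y. y - bump_primitive m h a y) has_real_derivative y) (at x) \<and> 0 \<le> y"
        using bump_bounds(2)[of m h a x] by (intro exI[of _ "1 - bump m h a x"] conjI) simp_all
    qed
    then show ?thesis by (simp add: bump_primitive_0)
  qed
  show ?thesis using * bump_primitive_mono[of x "a+h" m h a] bump_primitive_const[of a h x m] by linarith
qed

text \<open>The derivative in the \<open>i\<close>-th velocity component is \<open>box_bump\<close> minus its translate
  by \<open>s\<close>, so testing against it turns the weak gradient into a difference of integrals over boxes.\<close>
definition box_test :: "nat \<Rightarrow> real \<Rightarrow> real \<times> (real^2) \<Rightarrow> 2 \<Rightarrow> 2 \<Rightarrow> real \<Rightarrow> real \<times> (real^2) \<Rightarrow> real" where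
  "box_test m h c i j s z = bump m h (fst c) (fst z) *
     (bump_primitive m h (snd c $ i) (snd z $ i) - bump_primitive m h (snd c $ i) (snd z $ i - s)) *
     bump m h (snd c $ j) (snd z $ j)"

definition box_bump :: "nat \<Rightarrow> real \<Rightarrow> real \<times> (real^2) \<Rightarrow> 2 \<Rightarrow> 2 \<Rightarrow> real \<times> (real^2) \<Rightarrow> real" where
  "box_bump m h c i j z = bump m h (fst c) (fst z) * bump m h (snd c $ i) (snd z $ i) * bump m h (snd c $ j) (snd z $ j)"

text \<open>The region covered by the cube of side \<open>h\<close> at \<open>c\<close> while it
  moves by \<open>s\<close> along the \<open>i\<close>-th velocity axis. It contains the supports of
  \<open>box_test\<close> and of both terms of its derivative.\<close>

definition swept_box :: "real \<Rightarrow> real \<times> (real^2) \<Rightarrow> 2 \<Rightarrow> real \<Rightarrow> (real \<times> (real^2)) set" where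
  "swept_box h c i s = cbox c (fst c + h, \<chi> k. snd c $ k + h + (if k = i then s else 0))"

lemma mem_swept_box: "z \<in> swept_box h c i s \<longleftrightarrow> fst c \<le> fst z \<and> fst z \<le> fst c + h \<and>
    (\<forall>k. snd c $ k \<le> snd z $ k \<and> snd z $ k \<le> snd c $ k + h + (if k = i then s else 0))"
  unfolding swept_box_def by (cases z; cases c) (auto simp: cbox_Pair_eq mem_box_cart)

lemma C_k_fst: "C_k k f \<Longrightarrow> C_k k (\<lambda>z::real \<times> (real^2). f (fst z))"
  using C_k_affine[of k f fst 0] bounded_linear_fst by simp

lemma C_k_snd: "C_k k f \<Longrightarrow> C_k k (\<lambda>z::real \<times> (real^2). f (snd z $ i + b))"
  using C_k_affine[of k f "\<lambda>z. snd z $ i" b] bounded_linear_compose[OF bounded_linear_vec_nth[of i] bounded_linear_snd]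
  by simp

lemma C_k_box_test: "C_k k (box_test m h c i j s)"
proof -
  have "C_k k (\<lambda>z. box_test m h c i j s z)" unfolding box_test_def
    using C_k_snd[OF C_k_bump_primitive, of k m h "snd c $ i" i 0] C_k_snd[OF C_k_bump_primitive, of k m h "snd c $ i" i "-s"]
      C_k_snd[OF C_k_bump, of k m h "snd c $ j" j 0]
    by (intro C_k_mult C_k_diff C_k_fst C_k_bump) simp_all
  then show ?thesis by simp
qed

text \<open>Beyond \<open>snd c $ i + h + s\<close> the primitive and its translate have reached the
  same constant and cancel. A single primitive would not have compact support; this is why a
  difference is taken.\<close>

lemma box_test_support:
  assumes "i \<noteq> j" "0 < s" "z \<notin> swept_box h c i s"
  shows "box_test m h c i j s z = 0"
proof -
  have UN: "(\<forall>k::2. P k) \<longleftrightarrow> P i \<and> P j" for P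
    using assms(1) exhaust_2 by metis
  from assms(3) have "fst z < fst c \<or> fst z > fst c + h \<or> snd z $ i < snd c $ i \<or> snd z $ i > snd c $ i + h + s
     \<or> snd z $ j < snd c $ j \<or> snd z $ j > snd c $ j + h"
    using assms(1) unfolding mem_swept_box by (auto simp: UN not_le)
  then show ?thesis unfolding box_test_def using \<open>0 < s\<close>
    using bump_primitive_const[of "snd c $ i" h "snd z $ i" m] bump_primitive_const[of "snd c $ i" h "snd z $ i - s" m]
    by (auto simp: bump_0 bump_primitive_0)
qed

text \<open>The bound \<open>h\<close> involves neither \<open>s\<close> nor \<open>m\<close>.
  Together with the volume of the swept box it yields an L1 bound for the test function that
  survives the limit in \<open>m\<close>.\<close>

lemma box_test_bounds:
  assumes "0 \<le> h" "0 < s" shows "0 \<le> box_test m h c i j s z" "box_test m h c i j s z \<le> h"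
proof -
  let ?d = "bump_primitive m h (snd c $ i) (snd z $ i) - bump_primitive m h (snd c $ i) (snd z $ i - s)"
  have B0: "0 \<le> bump_primitive m h a x" for a x
    using bump_primitive_mono[of "min x a" x m h a] bump_primitive_0[of "min x a" a m h] by simp
  have d: "0 \<le> ?d" "?d \<le> h"
    using bump_primitive_mono[of "snd z $ i - s" "snd z $ i" m h "snd c $ i"] assms bump_primitive_le[OF assms(1), of m "snd c $ i" "snd z $ i"]
      B0[of "snd c $ i" "snd z $ i - s"] by auto
  show "0 \<le> box_test m h c i j s z" unfolding box_test_def using d bump_bounds by simp
  have "bump m h (fst c) (fst z) * ?d \<le> 1 * h" using d bump_bounds assms by (intro mult_mono) auto
  then have "bump m h (fst c) (fst z) * ?d * bump m h (snd c $ j) (snd z $ j) \<le> (1 * h) * 1"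
    using bump_bounds assms d by (intro mult_mono) auto
  then show "box_test m h c i j s z \<le> h" unfolding box_test_def by simp
qed

lemma box_test_test_fun:
  assumes "i \<noteq> j" "0 < s" "0 < fst c"
  shows "test_fun ({0<..} \<times> UNIV) (box_test m h c i j s)"
proof -
  have sub: "closure {z. box_test m h c i j s z \<noteq> 0} \<subseteq> swept_box h c i s"
  proof (rule closure_minimal)
    show "{z. box_test m h c i j s z \<noteq> 0} \<subseteq> swept_box h c i s" using box_test_support[OF assms(1,2)] by blast
    show "closed (swept_box h c i s)" unfolding swept_box_def by (rule closed_cbox)
  qed
  moreover have "swept_box h c i s \<subseteq> {0<..} \<times> UNIV"
  proof
    fix z assume "z \<in> swept_box h c i s"
    then have "0 < fst z" using assms(3) by (simp only: mem_swept_box) linarith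
    then show "z \<in> {0<..} \<times> UNIV" by (simp add: mem_Times_iff)
  qed
  moreover have "compact (closure {z. box_test m h c i j s z \<noteq> 0})"
    unfolding compact_closure
  proof (rule bounded_subset)
    show "bounded (swept_box h c i s)" unfolding swept_box_def by (rule bounded_cbox)
    show "{z. box_test m h c i j s z \<noteq> 0} \<subseteq> swept_box h c i s" using sub closure_subset by (rule order_trans[rotated])
  qed
  ultimately show ?thesis unfolding test_fun_def smooth_fun_def using C_k_box_test by blast
qed

text \<open>On the line through \<open>z\<close> in the \<open>i\<close>-th velocity direction the
  factors in \<open>r\<close> and in the \<open>j\<close>-th component are constant, so only the
  difference of primitives is differentiated.\<close>

lemma box_test_derivative:
  assumes "i \<noteq> j"
  shows "frechet_derivative (box_test m h c i j s) (at z) (0, axis i 1) =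
    box_bump m h c i j z - box_bump m h c i j (z + (- s) *\<^sub>R (0, axis i 1))"
proof -
  let ?a = "(0, axis i 1) :: real \<times> (real^2)"
  have "box_test m h c i j s differentiable (at z)" using C_k_box_test[of "Suc 0" m h c i j s] unfolding C_k.simps by blast
  then have D: "(box_test m h c i j s has_derivative frechet_derivative (box_test m h c i j s) (at z)) (at (z + 0 *\<^sub>R ?a))"
    by (simp add: frechet_derivative_works zero_prod_def[symmetric])
  then have "((\<lambda>t. box_test m h c i j s (z + t *\<^sub>R ?a)) has_derivative
      (\<lambda>t. frechet_derivative (box_test m h c i j s) (at z) (t *\<^sub>R ?a))) (at 0)"
    by (rule has_derivative_compose[rotated]) (auto intro!: derivative_eq_intros)
  moreover have "frechet_derivative (box_test m h c i j s) (at z) (t *\<^sub>R ?a) = t * frechet_derivative (box_test m h c i j s) (at z) ?a" for t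
    by (subst linear_scale[OF has_derivative_linear[OF D]]) simp
  ultimately have 1: "((\<lambda>t. box_test m h c i j s (z + t *\<^sub>R ?a)) has_real_derivative
      frechet_derivative (box_test m h c i j s) (at z) ?a) (at 0)"
    by (simp add: has_field_derivative_def mult.commute[of _ "frechet_derivative _ _ _"])
  have Bd: "((\<lambda>t. bump_primitive m h a (x + t)) has_real_derivative bump m h a x) (at 0)" for a x
    using DERIV_shift[THEN iffD1, OF bump_primitive_deriv[of m h a "0 + x"]] by (simp add: add.commute)
  have "((\<lambda>t. bump m h (fst c) (fst z) * (bump_primitive m h (snd c $ i) (snd z $ i + t) - bump_primitive m h (snd c $ i) ((snd z $ i - s) + t))
     * bump m h (snd c $ j) (snd z $ j)) has_real_derivative
     bump m h (fst c) (fst z) * (bump m h (snd c $ i) (snd z $ i) - bump m h (snd c $ i) (snd z $ i - s)) * bump m h (snd c $ j) (snd z $ j)) (at 0)"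
    by (intro DERIV_cmult_right DERIV_cmult DERIV_diff Bd)
  moreover have "box_test m h c i j s (z + t *\<^sub>R ?a) = bump m h (fst c) (fst z) * (bump_primitive m h (snd c $ i) (snd z $ i + t) - bump_primitive m h (snd c $ i) ((snd z $ i - s) + t))
     * bump m h (snd c $ j) (snd z $ j)" for t
    using assms by (simp add: box_test_def axis_def algebra_simps)
  ultimately have "frechet_derivative (box_test m h c i j s) (at z) ?a
    = bump m h (fst c) (fst z) * (bump m h (snd c $ i) (snd z $ i) - bump m h (snd c $ i) (snd z $ i - s)) * bump m h (snd c $ j) (snd z $ j)"
    using DERIV_unique[OF 1] by simp
  also have "\<dots> = box_bump m h c i j z - box_bump m h c i j (z + (- s) *\<^sub>R ?a)"
    using assms by (simp add: box_bump_def axis_def algebra_simps)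
  finally show ?thesis .
qed

lemma box_bump_tendsto:
  assumes "i \<noteq> j"
  shows "(\<lambda>m. box_bump m h c i j z) \<longlonglongrightarrow> indicat_real (box c (c + h *\<^sub>R One)) z"
proof -
  have UN: "(\<forall>k::2. P k) \<longleftrightarrow> P i \<and> P j" for P
    using assms(1) exhaust_2 by metis
  have "(\<lambda>m. box_bump m h c i j z) \<longlonglongrightarrow> indicat_real {fst c<..<fst c+h} (fst z)
     * indicat_real {snd c $ i<..<snd c $ i+h} (snd z $ i) * indicat_real {snd c $ j<..<snd c $ j+h} (snd z $ j)"
    unfolding box_bump_def by (intro tendsto_mult bump_tendsto)
  also have "indicat_real {fst c<..<fst c+h} (fst z)
     * indicat_real {snd c $ i<..<snd c $ i+h} (snd z $ i) * indicat_real {snd c $ j<..<snd c $ j+h} (snd z $ j)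
     = indicat_real (box c (c + h *\<^sub>R One)) z"
    unfolding indicator_def mem_box_pair UN by auto
  finally show ?thesis .
qed

lemma box_bump_diff_bound:
  assumes "i \<noteq> j" "0 < s" "0 < h"
  shows "\<bar>box_bump m h c i j z - box_bump m h c i j (z + (- s) *\<^sub>R (0, axis i 1))\<bar> \<le> indicat_real (swept_box h c i s) z"
proof (cases "z \<in> swept_box h c i s")
  case True
  have *: "0 \<le> box_bump m h c i j z \<and> box_bump m h c i j z \<le> 1" for z
    unfolding box_bump_def using bump_bounds by (auto intro!: mult_nonneg_nonneg mult_le_one)
  show ?thesis using *[of z] *[of "z + (- s) *\<^sub>R (0, axis i 1)"] True
    by (simp only: indicator_simps) linarith
next
  case False
  have UN: "(\<forall>k::2. P k) \<longleftrightarrow> P i \<and> P j" for P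
    using assms(1) exhaust_2 by metis
  from False have "fst z < fst c \<or> fst z > fst c + h \<or> snd z $ i < snd c $ i \<or> snd z $ i > snd c $ i + h + s
     \<or> snd z $ j < snd c $ j \<or> snd z $ j > snd c $ j + h"
    using assms(1) unfolding mem_swept_box by (auto simp: UN not_le)
  moreover have "axis i (1::real) $ j = 0" "axis i (1::real) $ i = 1" using assms(1) by (auto simp: axis_def)
  ultimately have "box_bump m h c i j z = 0 \<and> box_bump m h c i j (z + (- s) *\<^sub>R (0, axis i 1)) = 0"
    using assms(2,3) unfolding box_bump_def by (auto simp: bump_0)
  then show ?thesis by simp
qed

lemma measure_swept_box:
  assumes "0 < h" "0 < s" "i \<noteq> j" shows "measure lborel (swept_box h c i s) = h * (h * (h + s))"
proof -
  have UN: "UNIV = {i, j}" using assms(3) exhaust_2[of i] exhaust_2[of j] UNIV_2 by auto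
  have "cbox (snd c) (\<chi> k. snd c $ k + h + (if k = i then s else 0)) \<noteq> {}"
    using assms by (auto simp: set_eq_iff mem_box_cart intro!: exI[of _ "snd c"])
  then show ?thesis using assms unfolding swept_box_def
    by (cases c) (simp add: content_Pair content_cbox_cart UN algebra_simps)
qed

end

section \<open>Functions with bounded weak gradient\<close>

context step_fun begin

lemma ex_other_index: obtains j :: 2 where "i \<noteq> j"
proof (cases "i = 1")
  case True then show ?thesis using that[of 2] by simp
next
  case False then show ?thesis using that[of 1] by simp
qed

text \<open>As \<open>m\<close> grows, the derivative of \<open>box_test\<close> tends to the
  indicator of the cube minus that of the translated cube, and the L1 norm of
  \<open>box_test\<close> stays below \<open>h\<close> times the volume
  \<open>h * h * (h + s)\<close>. Divided by the volume \<open>h^3\<close> of the cube, the bound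
  becomes \<open>L * (h + s)\<close>.\<close>

lemma box_difference_bound:
  fixes u :: "real \<times> (real^2) \<Rightarrow> real" and i :: 2
  assumes u[measurable]: "u \<in> borel_measurable borel"
   and int: "\<And>K. compact K \<Longrightarrow> K \<subseteq> {0<..} \<times> UNIV \<Longrightarrow> set_integrable lborel K u"
   and weak: "\<And>\<Theta>. test_fun ({0<..} \<times> UNIV) \<Theta> \<Longrightarrow>
     \<bar>LINT z|lborel. u z * frechet_derivative \<Theta> (at z) (0, axis i 1)\<bar> \<le> L * (LINT z|lborel. \<bar>\<Theta> z\<bar>)"
   and "0 \<le> L" "0 < s" "0 < h" "0 < fst c"
  shows "\<bar>LINT z:box c (c + h *\<^sub>R One)|lborel. u (z + s *\<^sub>R (0, axis i 1)) - u z\<bar> \<le> L * (h^3 * (h + s))"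
proof -
  obtain j where ij: "i \<noteq> j" by (rule ex_other_index)
  let ?a = "(0, axis i 1) :: real \<times> (real^2)"
  let ?B = "box c (c + h *\<^sub>R One)"
  let ?K = "swept_box h c i s"
  have K: "compact ?K" "?K \<subseteq> {0<..} \<times> UNIV"
  proof -
    show "compact ?K" by (simp add: swept_box_def compact_cbox)
    show "?K \<subseteq> {0<..} \<times> UNIV"
    proof
      fix z assume "z \<in> ?K"
      then have "0 < fst z" using \<open>0 < fst c\<close> by (simp only: mem_swept_box) linarith
      then show "z \<in> {0<..} \<times> UNIV" by (simp add: mem_Times_iff)
    qed
  qed
  have Km[measurable]: "?K \<in> sets borel" unfolding swept_box_def by simp
  have "set_integrable lborel ?K (\<lambda>z. \<bar>u z\<bar>)" using int[OF K] by (rule set_integrable_abs)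
  then have dom: "integrable lborel (\<lambda>z. indicat_real ?K z * \<bar>u z\<bar>)" by (simp add: set_integrable_def)
  define F where "F m z = u z * (box_bump m h c i j z - box_bump m h c i j (z + (- s) *\<^sub>R ?a))" for m z
  define G where "G z = u z * (indicat_real ?B z - indicat_real ?B (z + (- s) *\<^sub>R ?a))" for z
  have phm[measurable]: "box_bump m h c i j \<in> borel_measurable borel" for m
  proof -
    have "C_k 0 (\<lambda>z. box_bump m h c i j z)" unfolding box_bump_def
      using C_k_snd[OF C_k_bump, of 0 m h "snd c $ i" i 0] C_k_snd[OF C_k_bump, of 0 m h "snd c $ j" j 0]
      by (intro C_k_mult C_k_fst C_k_bump) (simp_all del: C_k.simps)
    then have "continuous_on UNIV (box_bump m h c i j)" by simp
    then show ?thesis by (rule borel_measurable_continuous_onI)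
  qed
  have Fb: "norm (F m z) \<le> indicat_real ?K z * \<bar>u z\<bar>" for m z
    using mult_right_mono[OF box_bump_diff_bound[OF ij \<open>0 < s\<close> \<open>0 < h\<close>, of m c z], of "\<bar>u z\<bar>"]
    unfolding F_def by (simp add: abs_mult mult.commute)
  have lim: "(\<lambda>m. F m z) \<longlonglongrightarrow> G z" for z
    unfolding F_def G_def by (intro tendsto_intros box_bump_tendsto ij)
  have L1: "(\<lambda>m. LINT z|lborel. F m z) \<longlonglongrightarrow> (LINT z|lborel. G z)" and intG: "integrable lborel G"
  proof -
    have m1: "G \<in> borel_measurable lborel" "\<And>m. F m \<in> borel_measurable lborel"
      unfolding F_def G_def by measurable
    show "(\<lambda>m. LINT z|lborel. F m z) \<longlonglongrightarrow> (LINT z|lborel. G z)"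
      by (rule integral_dominated_convergence[where s=F, OF m1 dom AE_I2[OF lim] AE_I2[OF Fb]])
    show "integrable lborel G"
      by (rule integrable_dominated_convergence[where s=F, OF m1 dom AE_I2[OF lim] AE_I2[OF Fb]])
  qed
  have bnd: "\<bar>LINT z|lborel. F m z\<bar> \<le> L * (h^3 * (h + s))" for m
  proof -
    have "\<bar>LINT z|lborel. F m z\<bar> \<le> L * (LINT z|lborel. \<bar>box_test m h c i j s z\<bar>)"
      using weak[OF box_test_test_fun[OF ij \<open>0 < s\<close> \<open>0 < fst c\<close>, of m h]] unfolding box_test_derivative[OF ij] F_def .
    also have "(LINT z|lborel. \<bar>box_test m h c i j s z\<bar>) \<le> (LINT z|lborel. h * indicat_real ?K z)"
    proof (rule integral_mono')
      show "integrable lborel (\<lambda>z. h * indicat_real ?K z)"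
        unfolding swept_box_def
          by (intro integrable_mult_right integrable_real_indicator emeasure_lborel_cbox_finite) simp
      show "\<bar>box_test m h c i j s z\<bar> \<le> h * indicat_real ?K z" for z
        using box_test_bounds[of h s m c i j z] box_test_support[OF ij \<open>0 < s\<close>, of z h c m] \<open>0 < h\<close> \<open>0 < s\<close>
        by (cases "z \<in> ?K") auto
    qed (use \<open>0 < h\<close> in simp)
    also have "\<dots> = h * (h * (h * (h + s)))" using measure_swept_box[OF \<open>0 < h\<close> \<open>0 < s\<close> ij, of c] by simp
    also have "\<dots> = h^3 * (h + s)" by (simp add: power3_eq_cube)
    finally show ?thesis using \<open>0 \<le> L\<close> by (simp add: mult_left_mono)
  qed
  have "\<bar>LINT z|lborel. G z\<bar> \<le> L * (h^3 * (h + s))"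
    by (rule LIMSEQ_le_const2[OF tendsto_rabs[OF L1]]) (use bnd in auto)
  \<comment> \<open>Translation invariance moves the shift from the indicator to \<open>u\<close>;
    this needs the two halves of \<open>G\<close> to be integrable separately, which holds because
    the cube lies in the swept box.\<close>
  moreover have "(LINT z|lborel. G z) = - (LINT z:?B|lborel. u (z + s *\<^sub>R ?a) - u z)"
  proof -
    define g1 where "g1 z = u z * indicat_real ?B z" for z
    define g2 where "g2 z = u z * indicat_real ?B (z + (- s) *\<^sub>R ?a)" for z
    have gm[measurable]: "g1 \<in> borel_measurable borel" "g2 \<in> borel_measurable borel"
      unfolding g1_def g2_def by measurable
    have B_sub: "indicat_real ?B z \<le> indicat_real ?K z" for z
    proof -
      have "z \<in> ?K" if "z \<in> ?B" using that \<open>0 < s\<close> unfolding mem_box_pair mem_swept_box by (simp add: less_imp_le add_increasing2)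
      then show ?thesis by (simp add: indicator_def)
    qed
    have GG: "G z = g1 z - g2 z" for z unfolding G_def g1_def g2_def by (simp only: right_diff_distrib)
    have i1: "integrable lborel g1"
    proof (rule Bochner_Integration.integrable_bound[OF dom _ AE_I2])
      show "norm (g1 z) \<le> norm (indicat_real ?K z * \<bar>u z\<bar>)" for z
        using mult_right_mono[OF B_sub[of z], of "\<bar>u z\<bar>"] unfolding g1_def by (simp add: abs_mult mult.commute)
    qed simp
    then have i2: "integrable lborel g2"
      using Bochner_Integration.integrable_diff[OF i1 intG] unfolding GG by simp
    have i3: "integrable lborel (\<lambda>z. g2 (z + s *\<^sub>R ?a))"
      using i2 integrable_lborel_translate(1)[OF gm(2)] by simp
    have "(LINT z|lborel. G z) = (LINT z|lborel. g1 z) - (LINT z|lborel. g2 z)"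
      unfolding GG using i1 i2 by (rule Bochner_Integration.integral_diff)
    also have "(LINT z|lborel. g2 z) = (LINT z|lborel. g2 (z + s *\<^sub>R ?a))"
      using integrable_lborel_translate(2)[OF gm(2)] by simp
    also have "(LINT z|lborel. g1 z) - (LINT z|lborel. g2 (z + s *\<^sub>R ?a)) = (LINT z|lborel. g1 z - g2 (z + s *\<^sub>R ?a))"
      using i1 i3 by simp
    also have "\<dots> = (LINT z|lborel. - (indicat_real ?B z *\<^sub>R (u (z + s *\<^sub>R ?a) - u z)))"
      by (rule Bochner_Integration.integral_cong) (auto simp: g1_def g2_def algebra_simps zero_prod_def[symmetric])
    finally show ?thesis by (simp add: set_lebesgue_integral_def)
  qed
  ultimately show ?thesis by simp
qed

text \<open>Means of \<open>u (z + s e) - u z\<close> over cubes with corner \<open>z\<close> are at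
  most \<open>L * (h + s)\<close> by \<open>box_difference_bound\<close>, and they converge to the
  value at almost every \<open>z\<close> as \<open>h\<close> tends to 0. The exceptional null set
  may depend on \<open>s\<close>.\<close>

lemma weak_difference_AE:
  fixes u :: "real \<times> (real^2) \<Rightarrow> real" and i :: 2
  assumes u[measurable]: "u \<in> borel_measurable borel"
   and int: "\<And>K. compact K \<Longrightarrow> K \<subseteq> {0<..} \<times> UNIV \<Longrightarrow> set_integrable lborel K u"
   and weak: "\<And>\<Theta>. test_fun ({0<..} \<times> UNIV) \<Theta> \<Longrightarrow>
     \<bar>LINT z|lborel. u z * frechet_derivative \<Theta> (at z) (0, axis i 1)\<bar> \<le> L * (LINT z|lborel. \<bar>\<Theta> z\<bar>)"
   and "0 \<le> L" "0 < s"
  shows "AE z in lborel. 0 < fst z \<longrightarrow> \<bar>u (z + s *\<^sub>R (0, axis i 1)) - u z\<bar> \<le> L * s"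
proof -
  let ?a = "(0, axis i 1) :: real \<times> (real^2)"
  have main: "AE z in lborel. \<delta> \<le> fst z \<longrightarrow> \<bar>u (z + s *\<^sub>R ?a) - u z\<bar> \<le> L * s" if "0 < \<delta>" for \<delta>
  proof -
    define d where "d z = u (z + s *\<^sub>R ?a) - u z" for z
    \<comment> \<open>\<open>u\<close> is integrable only on compact sets that stay away from
      \<open>r = 0\<close>. Cutting off below \<open>\<delta>\<close> gives a function integrable on
      every box; afterwards \<open>\<delta>\<close> runs through a sequence tending to 0.\<close>
    define y where "y z = indicat_real {z. \<delta> \<le> fst z} z *\<^sub>R d z" for z
    have clo: "closed {z::real \<times> (real^2). \<delta> \<le> fst z}" by (intro closed_Collect_le continuous_intros)
    have yint: "set_integrable lborel (cbox p q) y" for p q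
    proof -
      define K where "K = cbox p q \<inter> {z. \<delta> \<le> fst z}"
      have K: "compact K" "K \<subseteq> {0<..} \<times> UNIV"
        unfolding K_def using clo that by (auto intro!: compact_Int_closed)
      define K' where "K' = (\<lambda>z. z + s *\<^sub>R ?a) ` K"
      have K': "compact K'" unfolding K'_def using K by (intro compact_continuous_image continuous_intros) auto
      have "K' \<subseteq> {0<..} \<times> UNIV" using K(2) unfolding K'_def by fastforce
      then have "integrable lborel (\<lambda>z. indicat_real K' z *\<^sub>R u z)" using int[OF K'] by (simp add: set_integrable_def)
      moreover have "(\<lambda>z. indicat_real K' z *\<^sub>R u z) \<in> borel_measurable borel"
        using K' by (intro borel_measurable_scaleR borel_measurable_indicator borel_compact) auto
      ultimately have "integrable lborel (\<lambda>z. indicat_real K' (z + s *\<^sub>R ?a) *\<^sub>R u (z + s *\<^sub>R ?a))"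
        using integrable_lborel_translate(1)[of "\<lambda>z. indicat_real K' z *\<^sub>R u z" "s *\<^sub>R ?a"] by blast
      moreover have "indicat_real K' (z + s *\<^sub>R ?a) = indicat_real K z" for z
      proof -
        have "z + s *\<^sub>R ?a \<in> K' \<longleftrightarrow> z \<in> K" unfolding K'_def
          by (rule inj_image_mem_iff[of "\<lambda>z. z + s *\<^sub>R ?a"]) (rule injI, simp only: add_right_cancel)
        then show ?thesis by (simp only: indicator_def)
      qed
      ultimately have "integrable lborel (\<lambda>z. indicat_real K z *\<^sub>R u (z + s *\<^sub>R ?a))" by simp
      moreover have "integrable lborel (\<lambda>z. indicat_real K z *\<^sub>R u z)"
        using int[OF K] by (simp add: set_integrable_def)
      ultimately have "integrable lborel (\<lambda>z. indicat_real K z *\<^sub>R u (z + s *\<^sub>R ?a) - indicat_real K z *\<^sub>R u z)"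
        by (rule Bochner_Integration.integrable_diff)
      moreover have "indicat_real K z *\<^sub>R u (z + s *\<^sub>R ?a) - indicat_real K z *\<^sub>R u z = indicat_real (cbox p q) z *\<^sub>R y z" for z
        unfolding y_def d_def K_def indicator_def by auto
      ultimately show ?thesis by (simp add: set_integrable_def)
    qed
    have "y integrable_on cbox p q" for p q using set_borel_integral_eq_integral(1)[OF yint] .
    \<comment> \<open>Lebesgue differentiation in the form of cubes having the point as a
      corner.\<close>
    then obtain N where N: "negligible N" "\<And>x e. x \<notin> N \<Longrightarrow> 0 < e \<Longrightarrow>
        \<exists>d>0. \<forall>h. 0 < h \<and> h < d \<longrightarrow> norm (integral (cbox x (x + h *\<^sub>R One)) y /\<^sub>R h ^ DIM(real \<times> (real^2)) - y x) < e"
      using integrable_ccontinuous_explicit[of y] by metis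
    have "\<bar>d x\<bar> \<le> L * s" if x: "x \<notin> N" "\<delta> \<le> fst x" for x
    proof (rule field_le_epsilon)
      fix e :: real assume "0 < e"
      then obtain k where k: "0 < k" "\<And>h. 0 < h \<Longrightarrow> h < k \<Longrightarrow>
          norm (integral (cbox x (x + h *\<^sub>R One)) y /\<^sub>R h ^ DIM(real \<times> (real^2)) - y x) < e / 2"
        using N(2)[OF x(1), of "e/2"] by auto
      \<comment> \<open>Small enough for the differentiation theorem at accuracy
        \<open>e / 2\<close> and for \<open>L * h\<close> to be at most \<open>e / 2\<close>;
        \<open>L + 1\<close> avoids a division by zero.\<close>
      define h where "h = min (k / 2) (e / (2 * (L + 1)))"
      have "h \<le> k / 2" and h3: "h \<le> e / (2 * (L + 1))" unfolding h_def by (rule min.cobounded1, rule min.cobounded2)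
      then have h2: "h < k" using k(1) by linarith
      have h: "0 < h" "h < k" "h \<le> e / (2 * (L + 1))"
        using k(1) \<open>0 < e\<close> \<open>0 \<le> L\<close> h2 h3 by (auto simp: h_def)
      have "L * h \<le> (L + 1) * (e / (2 * (L + 1)))" using h \<open>0 \<le> L\<close> by (intro mult_mono) auto
      also have "\<dots> = e / 2" using \<open>0 \<le> L\<close> by (simp add: field_simps)
      finally have Lh: "L * h \<le> e / 2" .
      let ?B = "box x (x + h *\<^sub>R One)"
      have "integral (cbox x (x + h *\<^sub>R One)) y = integral ?B y" by (simp add: integral_open_interval)
      also have "\<dots> = (LINT z:?B|lborel. y z)"
        by (rule set_borel_integral_eq_integral(2)[symmetric], rule set_integrable_subset[OF yint, of _ x "x + h *\<^sub>R One"])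
           (simp_all add: box_subset_cbox)
      also have "\<dots> = (LINT z:?B|lborel. d z)"
      proof (rule set_lebesgue_integral_cong)
        show "\<forall>z. z \<in> ?B \<longrightarrow> y z = d z" using x(2) unfolding y_def mem_box_pair by auto
      qed simp
      finally have I: "\<bar>integral (cbox x (x + h *\<^sub>R One)) y\<bar> \<le> L * (h^3 * (h + s))"
        using box_difference_bound[OF u int weak \<open>0 \<le> L\<close> \<open>0 < s\<close> h(1), of x] x(2) \<open>0 < \<delta>\<close>
        unfolding d_def by simp
      have D: "DIM(real \<times> (real^2)) = 3" by simp
      have "\<bar>integral (cbox x (x + h *\<^sub>R One)) y /\<^sub>R h ^ 3\<bar> = \<bar>integral (cbox x (x + h *\<^sub>R One)) y\<bar> / h^3"
        using h(1) by (simp add: abs_mult divide_inverse mult.commute)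
      also have "\<dots> \<le> L * (h + s)" using I h(1) by (simp add: divide_le_eq mult.assoc mult.commute[of "h^3"])
      finally have "\<bar>integral (cbox x (x + h *\<^sub>R One)) y /\<^sub>R h ^ 3\<bar> \<le> L * h + L * s" by (simp add: algebra_simps)
      moreover have "\<bar>integral (cbox x (x + h *\<^sub>R One)) y /\<^sub>R h ^ 3 - y x\<bar> < e / 2"
        using k(2)[OF h(1,2)] unfolding D real_norm_def .
      moreover have "y x = d x" using x(2) by (simp add: y_def)
      ultimately show "\<bar>d x\<bar> \<le> L * s + e" using Lh by linarith
    qed
    moreover have "AE x in lborel. x \<notin> N"
      using AE_not_in[of N lebesgue] N(1) unfolding negligible_iff_null_sets AE_completion_iff .
    ultimately show ?thesis unfolding d_def by (auto elim!: eventually_mono)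
  qed
  have "AE z in lborel. \<forall>n::nat. 1 / (real n + 1) \<le> fst z \<longrightarrow> \<bar>u (z + s *\<^sub>R ?a) - u z\<bar> \<le> L * s"
    unfolding AE_all_countable by (intro allI main) simp
  then show ?thesis
  proof eventually_elim
    case (elim z)
    show ?case
    proof
      assume "0 < fst z"
      then obtain n where "inverse (real (Suc n)) < fst z" using reals_Archimedean by blast
      then show "\<bar>u (z + s *\<^sub>R ?a) - u z\<bar> \<le> L * s" using elim[rule_format, of n] by (simp add: inverse_eq_divide add.commute)
    qed
  qed
qed

end

section \<open>Compactly supported functions\<close>

lemma frechet_derivative_outside_support:
  assumes "z \<notin> closure {z. \<phi> z \<noteq> 0}"
  shows "frechet_derivative \<phi> (at z) h = 0"
proof -
  have "((\<lambda>x. 0) has_derivative (\<lambda>h. 0)) (at z)" by simp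
  then have "(\<phi> has_derivative (\<lambda>h. 0)) (at z)"
    by (rule has_derivative_transform_within_open[OF _ open_Compl[OF closed_closure[of "{z. \<phi> z \<noteq> 0}"]]])
       (use assms closure_subset[of "{z. \<phi> z \<noteq> 0}"] in auto)
  then show ?thesis using frechet_derivative_at by metis
qed

lemma compact_support_bounded:
  fixes f :: "'a::euclidean_space \<Rightarrow> real"
  assumes "continuous_on UNIV f" "compact K" "\<And>x. x \<notin> K \<Longrightarrow> f x = 0"
  obtains B where "0 \<le> B" "\<And>x. \<bar>f x\<bar> \<le> B"
proof -
  have "compact (f ` K)" using assms by (intro compact_continuous_image continuous_on_subset[OF assms(1)]) auto
  then obtain B where B: "\<And>y. y \<in> f ` K \<Longrightarrow> norm y \<le> B"
    using compact_imp_bounded bounded_iff by metis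
  show ?thesis
  proof (rule that[of "max 0 B"])
    show "\<bar>f x\<bar> \<le> max 0 B" for x using B[of "f x"] assms(3)[of x] by (cases "x \<in> K") auto
  qed simp
qed

lemma compact_support_deriv_bound:
  fixes f :: "'a::euclidean_space \<Rightarrow> real"
  assumes f: "C_k (Suc 0) f" "compact (closure {z. f z \<noteq> 0})"
  obtains L where "0 \<le> L" "\<And>x h. \<bar>frechet_derivative f (at x) h\<bar> \<le> L * norm h"
proof -
  have "\<exists>B\<ge>0. \<forall>x. \<bar>frechet_derivative f (at x) b\<bar> \<le> B" for b
  proof -
    have "continuous_on UNIV (\<lambda>x. frechet_derivative f (at x) b)" using f(1) by simp
    from compact_support_bounded[OF this f(2) frechet_derivative_outside_support] show ?thesis by metis
  qed
  then obtain B where B: "\<And>b. 0 \<le> B b" "\<And>b x. \<bar>frechet_derivative f (at x) b\<bar> \<le> B b" by metis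
  show ?thesis
  proof (rule that[of "\<Sum>b\<in>Basis. B b"])
    show "0 \<le> (\<Sum>b\<in>Basis. B b)" using B by (intro sum_nonneg) auto
    fix x h :: 'a
    have lin: "linear (frechet_derivative f (at x))"
      using f(1) by (intro linear_frechet_derivative) simp
    have "frechet_derivative f (at x) h = frechet_derivative f (at x) (\<Sum>b\<in>Basis. (h \<bullet> b) *\<^sub>R b)"
      by (simp add: euclidean_representation)
    also have "\<dots> = (\<Sum>b\<in>Basis. (h \<bullet> b) * frechet_derivative f (at x) b)"
      using lin by (simp add: linear_sum linear_scale)
    also have "\<bar>\<dots>\<bar> \<le> (\<Sum>b\<in>Basis. norm h * B b)"
      using B Basis_le_norm by (intro order_trans[OF sum_abs] sum_mono) (auto simp: abs_mult intro!: mult_mono)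
    also have "\<dots> = (\<Sum>b\<in>Basis. B b) * norm h" unfolding sum_distrib_right by (simp only: mult.commute)
    finally show "\<bar>frechet_derivative f (at x) h\<bar> \<le> (\<Sum>b\<in>Basis. B b) * norm h" .
  qed
qed

lemma line_mvt:
  fixes f :: "'a::euclidean_space \<Rightarrow> real"
  assumes "\<And>x. f differentiable (at x)"
  obtains s where "0 < s" "s < 1" "f (z + d) - f z = frechet_derivative f (at (z + s *\<^sub>R d)) d"
proof -
  have D: "((\<lambda>t. f (z + t *\<^sub>R d)) has_real_derivative frechet_derivative f (at (z + t *\<^sub>R d)) d) (at t)" for t
  proof -
    have 1: "(f has_derivative frechet_derivative f (at (z + t *\<^sub>R d))) (at (z + t *\<^sub>R d))"
      using assms frechet_derivative_works by blast
    have "((\<lambda>t. f (z + t *\<^sub>R d)) has_derivative (\<lambda>h. frechet_derivative f (at (z + t *\<^sub>R d)) (h *\<^sub>R d))) (at t)"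
      by (rule has_derivative_compose[of "\<lambda>t. z + t *\<^sub>R d" "\<lambda>h. h *\<^sub>R d" t UNIV f, OF _ 1]) (auto intro!: derivative_eq_intros)
    moreover have "frechet_derivative f (at (z + t *\<^sub>R d)) (h *\<^sub>R d) = frechet_derivative f (at (z + t *\<^sub>R d)) d * h" for h
      using linear_scale[OF has_derivative_linear[OF 1]] by simp
    ultimately show ?thesis by (simp add: has_field_derivative_def)
  qed
  obtain s :: real where "0 < s" "s < 1" "f (z + 1 *\<^sub>R d) - f (z + 0 *\<^sub>R d) = (1 - 0) * frechet_derivative f (at (z + s *\<^sub>R d)) d"
    using MVT2[of 0 1 "\<lambda>t. f (z + t *\<^sub>R d)", OF zero_less_one D] by blast
  then show ?thesis using that by simp
qed

lemma compact_support_lipschitz: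
  fixes f :: "'a::euclidean_space \<Rightarrow> real"
  assumes f: "C_k (Suc 0) f" "compact (closure {z. f z \<noteq> 0})"
  obtains L where "0 \<le> L" "\<And>x y. \<bar>f x - f y\<bar> \<le> L * norm (x - y)"
proof -
  obtain L where L: "0 \<le> L" "\<And>x h. \<bar>frechet_derivative f (at x) h\<bar> \<le> L * norm h"
    using compact_support_deriv_bound[OF f] by blast
  show ?thesis
  proof (rule that[OF L(1)])
    fix x y
    obtain s where "f (y + (x - y)) - f y = frechet_derivative f (at (y + s *\<^sub>R (x - y))) (x - y)"
      using line_mvt[of f y "x - y"] f(1) by (metis C_k.simps(2))
    then show "\<bar>f x - f y\<bar> \<le> L * norm (x - y)" using L(2) by simp
  qed
qed

text \<open>By the mean value theorem the remainder is the change of the derivative between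
  \<open>z\<close> and an intermediate point, applied to \<open>d\<close>. Each partial derivative
  is again continuously differentiable with compact support, hence Lipschitz, which gives the second
  factor \<open>norm d\<close>.\<close>

lemma compact_support_taylor:
  fixes f :: "'a::euclidean_space \<Rightarrow> real"
  assumes f: "C_k (Suc (Suc 0)) f" "compact (closure {z. f z \<noteq> 0})"
  obtains L where "0 \<le> L"
    "\<And>z d. \<bar>f (z + d) - f z - frechet_derivative f (at z) d\<bar> \<le> L * (norm d)\<^sup>2"
proof -
  have "\<exists>L\<ge>0. \<forall>x y. \<bar>frechet_derivative f (at x) b - frechet_derivative f (at y) b\<bar> \<le> L * norm (x - y)" for b
  proof -
    have 1: "C_k (Suc 0) (\<lambda>x. frechet_derivative f (at x) b)" using f(1) by simp
    have "closure {z. frechet_derivative f (at z) b \<noteq> 0} \<subseteq> closure {z. f z \<noteq> 0}"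
      using frechet_derivative_outside_support[of _ f b] by (intro closure_minimal) auto
    then have 2: "compact (closure {z. frechet_derivative f (at z) b \<noteq> 0})"
      using f(2) by (meson bounded_subset closed_closure compact_eq_bounded_closed)
    show ?thesis using compact_support_lipschitz[OF 1 2] by metis
  qed
  then obtain L where L: "\<And>b. 0 \<le> L b"
    "\<And>b x y. \<bar>frechet_derivative f (at x) b - frechet_derivative f (at y) b\<bar> \<le> L b * norm (x - y)" by metis
  show ?thesis
  proof (rule that[of "\<Sum>b\<in>Basis. L b"])
    show "0 \<le> (\<Sum>b\<in>Basis. L b)" using L by (intro sum_nonneg) auto
    fix z d :: 'a
    have lin: "linear (frechet_derivative f (at x))" for x
      using f(1) by (intro linear_frechet_derivative) simp
    have ex: "frechet_derivative f (at x) d = (\<Sum>b\<in>Basis. (d \<bullet> b) * frechet_derivative f (at x) b)" for x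
    proof -
      have "frechet_derivative f (at x) d = frechet_derivative f (at x) (\<Sum>b\<in>Basis. (d \<bullet> b) *\<^sub>R b)"
        by (simp add: euclidean_representation)
      also have "\<dots> = (\<Sum>b\<in>Basis. (d \<bullet> b) * frechet_derivative f (at x) b)"
        using lin by (simp add: linear_sum linear_scale)
      finally show ?thesis .
    qed
    obtain s where s: "0 < s" "s < 1" "f (z + d) - f z = frechet_derivative f (at (z + s *\<^sub>R d)) d"
      using line_mvt[of f z d] f(1) by (metis C_k.simps(2))
    have "f (z + d) - f z - frechet_derivative f (at z) d =
      (\<Sum>b\<in>Basis. (d \<bullet> b) * (frechet_derivative f (at (z + s *\<^sub>R d)) b - frechet_derivative f (at z) b))"
      unfolding s(3) ex[of "z + s *\<^sub>R d"] ex[of z] by (simp add: sum_subtractf right_diff_distrib)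
    also have "\<bar>\<dots>\<bar> \<le> (\<Sum>b\<in>Basis. norm d * (L b * norm d))"
    proof (intro order_trans[OF sum_abs] sum_mono)
      fix b :: 'a assume "b \<in> Basis"
      have "\<bar>frechet_derivative f (at (z + s *\<^sub>R d)) b - frechet_derivative f (at z) b\<bar> \<le> L b * norm (s *\<^sub>R d)"
        using L(2)[of "z + s *\<^sub>R d" b z] by simp
      also have "\<dots> \<le> L b * norm d" using s(1,2) L(1)[of b] mult_right_mono[of s 1 "norm d"] by (intro mult_left_mono) auto
      finally show "\<bar>(d \<bullet> b) * (frechet_derivative f (at (z + s *\<^sub>R d)) b - frechet_derivative f (at z) b)\<bar> \<le> norm d * (L b * norm d)"
        unfolding abs_mult using Basis_le_norm[OF \<open>b \<in> Basis\<close>] by (intro mult_mono) auto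
    qed
    also have "\<dots> = (\<Sum>b\<in>Basis. L b) * (norm d)\<^sup>2"
      unfolding sum_distrib_right power2_eq_square by (simp only: mult_ac)
    finally show "\<bar>f (z + d) - f z - frechet_derivative f (at z) d\<bar> \<le> (\<Sum>b\<in>Basis. L b) * (norm d)\<^sup>2" .
  qed
qed

lemma test_fun_integrable:
  fixes \<phi> :: "'a::euclidean_space \<Rightarrow> real"
  assumes "test_fun S \<phi>" shows "integrable lborel \<phi>"
proof -
  have c: "continuous_on UNIV \<phi>" using assms C_k.simps(1) unfolding test_fun_def smooth_fun_def by blast
  have "integrable lborel (\<lambda>x. indicator (closure {z. \<phi> z \<noteq> 0}) x *\<^sub>R \<phi> x)"
    using assms c by (intro borel_integrable_compact) (auto simp: test_fun_def intro: continuous_on_subset)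
  moreover have "(\<lambda>x. indicat_real (closure {z. \<phi> z \<noteq> 0}) x *\<^sub>R \<phi> x) = \<phi>"
  proof
    show "indicat_real (closure {z. \<phi> z \<noteq> 0}) x *\<^sub>R \<phi> x = \<phi> x" for x
      using closure_subset[of "{z. \<phi> z \<noteq> 0}"] by (cases "\<phi> x = 0") auto
  qed
  ultimately show ?thesis by simp
qed

section \<open>Null sets in polar coordinates\<close>

lemma distr_norm_plane:
  "distr lborel borel (norm :: real^2 \<Rightarrow> real) = density lborel (\<lambda>r. ennreal (2 * pi * r) * indicator {0..} r)"
proof (rule measure_eqI_generator_eq[where E="range atMost" and \<Omega>=UNIV and A="\<lambda>n. {..real n}"])
  have vol: "emeasure lborel (cball (0::real^2) a) = ennreal (pi * a^2)" if "0 \<le> a" for a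
    using emeasure_cball[OF that, of "0::real^2"] by (simp add: unit_ball_vol_2)
  have d: "emeasure (distr lborel borel (norm :: real^2 \<Rightarrow> real)) {..a} = (if 0 \<le> a then ennreal (pi * a^2) else 0)" for a
  proof (cases "0 \<le> a")
    case True
    have "emeasure (distr lborel borel (norm :: real^2 \<Rightarrow> real)) {..a} = emeasure lborel (cball (0::real^2) a)"
    proof -
      have "(norm -` {..a} :: (real^2) set) = cball 0 a" by (simp add: set_eq_iff)
      then show ?thesis by (simp add: emeasure_distr)
    qed
    then show ?thesis using vol[OF True] True by simp
  next
    case False
    have "(norm -` {..a} :: (real^2) set) = {}"
    proof -
      have "\<not> norm x \<le> a" for x :: "real^2" using False norm_ge_zero[of x] by linarith
      then show ?thesis by (simp add: set_eq_iff)
    qed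
    then show ?thesis using False by (simp add: emeasure_distr)
  qed
  have e: "emeasure (density lborel (\<lambda>r. ennreal (2 * pi * r) * indicator {0..} r)) {..a} = (if 0 \<le> a then ennreal (pi * a^2) else 0)" for a
  proof -
    have "emeasure (density lborel (\<lambda>r. ennreal (2 * pi * r) * indicator {0..} r)) {..a} =
       (\<integral>\<^sup>+r. ennreal (2 * pi * r) * indicator {0..a} r \<partial>lborel)"
      by (subst emeasure_density) (auto intro!: nn_integral_cong split: split_indicator)
    also have "\<dots> = (if 0 \<le> a then ennreal (pi * a^2) else 0)"
    proof (cases "0 \<le> a")
      case True
      have "(\<integral>\<^sup>+r. ennreal (2 * pi * r) * indicator {0..a} r \<partial>lborel) = ennreal (pi * a^2 - pi * 0^2)"
        by (rule nn_integral_FTC_Icc[where F="\<lambda>r. pi * r^2"])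
           (use True in \<open>auto intro!: derivative_eq_intros\<close>)
      then show ?thesis using True by simp
    qed simp
    finally show ?thesis .
  qed
  show "emeasure (distr lborel borel (norm :: real^2 \<Rightarrow> real)) X = emeasure (density lborel (\<lambda>r. ennreal (2 * pi * r) * indicator {0..} r)) X"
    if "X \<in> range atMost" for X using that d e by auto
  show "emeasure (distr lborel borel (norm :: real^2 \<Rightarrow> real)) {..real i} \<noteq> \<infinity>" for i using d by simp
  show "Int_stable (range (atMost :: real \<Rightarrow> _))" by (auto simp: Int_stable_def)
  show "sets (distr lborel borel (norm :: real^2 \<Rightarrow> real)) = sigma_sets UNIV (range atMost)"
    "sets (density lborel (\<lambda>r. ennreal (2 * pi * r) * indicator {0..} r)) = sigma_sets UNIV (range atMost)"
  proof -
    have "sets (borel :: real measure) = sigma_sets UNIV (range atMost)"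
      by (subst borel_eq_atMost) (rule sets_measure_of, simp)
    then show "sets (distr lborel borel (norm :: real^2 \<Rightarrow> real)) = sigma_sets UNIV (range atMost)"
      "sets (density lborel (\<lambda>r. ennreal (2 * pi * r) * indicator {0..} r)) = sigma_sets UNIV (range atMost)"
      by simp_all
  qed
  show "(\<Union>i. {..real i}) = UNIV" by (auto simp: real_arch_simple)
qed auto

text \<open>The modulus of a point of the plane is distributed with density
  \<open>2 * pi * r\<close>, and this is positive exactly for \<open>r > 0\<close>; hence both sides
  have the same null sets.\<close>

lemma AE_norm_plane:
  assumes A: "A \<in> sets borel"
  shows "(AE x in lborel. norm (x::real^2) \<notin> A) \<longleftrightarrow> (AE r in lborel. 0 < r \<longrightarrow> r \<notin> A)"
proof -
  have "(AE x in lborel. norm (x::real^2) \<notin> A) \<longleftrightarrow> (AE r in distr lborel borel (norm :: real^2 \<Rightarrow> real). r \<notin> A)"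
    by (subst AE_distr_iff) (use A in auto)
  also have "\<dots> \<longleftrightarrow> (AE r in lborel. 0 < r \<longrightarrow> r \<notin> A)"
    unfolding distr_norm_plane
    by (subst AE_density) (auto simp: indicator_def ennreal_zero_less_mult_iff zero_less_mult_iff intro!: AE_cong split: if_splits)
  finally show ?thesis .
qed

text \<open>Links the weak derivatives, stated in \<open>(r, v)\<close>, with the essential bounds,
  stated in \<open>(x, v)\<close> at \<open>r = |x|\<close>. Both directions are used: the bound on
  the gradient moves to \<open>(r, v)\<close>, and the resulting difference estimate moves
  back.\<close>

lemma AE_polar:
  fixes A :: "(real \<times> (real^2)) set"
  assumes A[measurable]: "A \<in> sets borel"
  shows "(AE z in lborel. (norm (fst z :: real^2), snd z) \<notin> A) \<longleftrightarrow> (AE w in lborel. 0 < fst w \<longrightarrow> w \<notin> A)"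
proof -
  have [measurable]: "A \<in> sets (borel \<Otimes>\<^sub>M borel)" unfolding borel_prod by (rule A)
  have m1: "Measurable.pred (lborel \<Otimes>\<^sub>M lborel) (\<lambda>z. (norm (fst z :: real^2), snd z) \<notin> A)" by measurable
  have m2: "Measurable.pred (lborel \<Otimes>\<^sub>M lborel) (\<lambda>w. 0 < fst w \<longrightarrow> (fst w, snd w) \<notin> A)" by measurable
  have m3: "Measurable.pred (lborel \<Otimes>\<^sub>M lborel) (\<lambda>w. 0 < snd w \<longrightarrow> (snd w, fst w) \<notin> A)" by measurable
  have "(AE z in lborel. (norm (fst z :: real^2), snd z) \<notin> A) \<longleftrightarrow>
     (AE z in lborel \<Otimes>\<^sub>M lborel. (norm (fst z :: real^2), snd z) \<notin> A)" unfolding lborel_prod ..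
  also have "\<dots> \<longleftrightarrow> (AE x in lborel. AE v in lborel. (norm (x :: real^2), v) \<notin> A)"
    using lborel_pair.AE_pair_iff[OF m1[unfolded pred_def], simplified] by simp
  also have "\<dots> \<longleftrightarrow> (AE v in lborel. AE x in lborel. (norm (x :: real^2), v) \<notin> A)"
    by (rule lborel_pair.AE_commute[OF m1[unfolded pred_def]])
  also have "\<dots> \<longleftrightarrow> (AE v in lborel. AE r in lborel. 0 < r \<longrightarrow> (r, v) \<notin> A)"
  proof (rule AE_cong)
    fix v
    have "{r. (r, v) \<in> A} \<in> sets borel" by measurable
    from AE_norm_plane[OF this] show "(AE x in lborel. (norm (x :: real^2), v) \<notin> A) = (AE r in lborel. 0 < r \<longrightarrow> (r, v) \<notin> A)"
      by simp
  qed
  also have "\<dots> \<longleftrightarrow> (AE r in lborel. AE v in lborel. 0 < r \<longrightarrow> (r, v) \<notin> A)"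
    by (rule lborel_pair.AE_commute[OF m3[unfolded pred_def]])
  also have "\<dots> \<longleftrightarrow> (AE w in lborel \<Otimes>\<^sub>M lborel. 0 < fst w \<longrightarrow> w \<notin> A)"
    using lborel_pair.AE_pair_iff[OF m2[unfolded pred_def], simplified] by simp
  finally show ?thesis unfolding lborel_prod .
qed

section \<open>Regularity of the force\<close>

lemma borel_imp_lebesgue: "f \<in> borel_measurable borel \<Longrightarrow> f \<in> borel_measurable lebesgue"
  by (rule measurable_completion) simp

text \<open>Local integrability says nothing about \<open>u0\<close> where \<open>r \<le> 0\<close>,
  so only its extension by zero is measurable, as a limit over compact sets exhausting the half
  space. The last clause transfers the integrals in the weak formulation, because test functions and
  their derivatives vanish for \<open>r \<le> 0\<close>.\<close>

lemma locally_integrable_borel_version: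
  fixes u0 :: "real \<times> (real^2) \<Rightarrow> real"
  assumes loc: "locally_integrable ({0<..} \<times> UNIV) u0"
  obtains u where "u \<in> borel_measurable borel" "AE w in lborel. 0 < fst w \<longrightarrow> u w = u0 w"
    "\<forall>K. compact K \<longrightarrow> K \<subseteq> {0<..} \<times> UNIV \<longrightarrow> set_integrable lborel K u"
    "\<forall>\<psi>. \<psi> \<in> borel_measurable borel \<longrightarrow> (\<forall>w. \<not> 0 < fst w \<longrightarrow> \<psi> w = 0) \<longrightarrow>
       (LINT w|lebesgue. u0 w * \<psi> w) = (LINT w|lborel. u w * \<psi> w)"
proof -
  define K where "K n = cball 0 (real n) \<inter> {w :: real \<times> (real^2). 1 / (real n + 1) \<le> fst w}" for n
  have "closed {w :: real \<times> (real^2). 1 / (real n + 1) \<le> fst w}" for n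
    by (intro closed_Collect_le continuous_intros)
  then have K: "compact (K n)" for n unfolding K_def by (intro compact_Int_closed) auto
  have Ksub: "K n \<subseteq> {0<..} \<times> UNIV" for n
  proof
    fix w assume "w \<in> K n"
    then have "1 / (real n + 1) \<le> fst w" by (simp add: K_def)
    moreover have "0 < 1 / (real n + 1)" by simp
    ultimately have "0 < fst w" by linarith
    then show "w \<in> {0<..} \<times> UNIV" by (simp add: mem_Times_iff)
  qed
  define U where "U w = (if 0 < fst w then u0 w else 0)" for w
  have Ul: "U \<in> borel_measurable lebesgue"
  proof (rule borel_measurable_LIMSEQ_real)
    show "(\<lambda>w. indicat_real (K n) w *\<^sub>R u0 w) \<in> borel_measurable lebesgue" for n
      using loc K Ksub unfolding locally_integrable_def set_integrable_def by blast
    fix w :: "real \<times> (real^2)"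
    show "(\<lambda>n. indicat_real (K n) w *\<^sub>R u0 w) \<longlonglongrightarrow> U w"
    proof (cases "0 < fst w")
      case True
      obtain n1 where n1: "norm w \<le> real n1" using real_arch_simple by blast
      obtain n2 where n2: "inverse (real (Suc n2)) < fst w" using reals_Archimedean True by blast
      have "w \<in> K n" if "n \<ge> max n1 n2" for n
      proof -
        have "1 / (real n + 1) \<le> inverse (real (Suc n2))" using that by (simp add: inverse_eq_divide frac_le)
        then show ?thesis using n1 n2 that by (simp add: K_def)
      qed
      then have "\<forall>\<^sub>F n in sequentially. indicat_real (K n) w *\<^sub>R u0 w = U w"
        using True by (auto simp: eventually_sequentially U_def intro!: exI[of _ "max n1 n2"])
      then show ?thesis by (rule tendsto_eventually)
    next
      case False
      then have "w \<notin> K n" for n using Ksub[of n] by (auto simp: mem_Times_iff)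
      then show ?thesis using False by (simp add: U_def)
    qed
  qed
  obtain u where u[measurable]: "u \<in> borel_measurable borel" and ae: "AE w in lborel. U w = u w"
    using completion_ex_borel_measurable_real[OF Ul] by auto
  have ael: "AE w in lebesgue. U w = u w" using ae by (simp add: AE_completion_iff)
  have ul: "u \<in> borel_measurable lebesgue" using u by (rule borel_imp_lebesgue)
  show ?thesis
  proof (rule that[OF u])
    show "AE w in lborel. 0 < fst w \<longrightarrow> u w = u0 w" using ae by eventually_elim (auto simp: U_def)
    show "\<forall>K. compact K \<longrightarrow> K \<subseteq> {0<..} \<times> UNIV \<longrightarrow> set_integrable lborel K u"
    proof (intro allI impI)
      fix C :: "(real \<times> (real^2)) set" assume C: "compact C" "C \<subseteq> {0<..} \<times> UNIV"
      have Cb: "C \<in> sets borel" using C by (simp add: borel_compact)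
      have "integrable lebesgue (\<lambda>w. indicat_real C w *\<^sub>R u0 w)"
        using loc C unfolding locally_integrable_def set_integrable_def by blast
      moreover have "indicat_real C w *\<^sub>R u0 w = indicat_real C w *\<^sub>R U w" for w
        using C(2) by (auto simp: U_def indicator_def mem_Times_iff)
      ultimately have I: "integrable lebesgue (\<lambda>w. indicat_real C w *\<^sub>R U w)" by (simp only:)
      have m: "(\<lambda>w. indicat_real C w *\<^sub>R u w) \<in> borel_measurable lborel" using Cb by simp
      have "AE w in lebesgue. indicat_real C w *\<^sub>R U w = indicat_real C w *\<^sub>R u w"
        using ael by eventually_elim simp
      then have "integrable lebesgue (\<lambda>w. indicat_real C w *\<^sub>R u w)"
        by (rule integrable_cong_AE_imp[OF I measurable_completion[OF m]])
      then show "set_integrable lborel C u" using m by (simp add: set_integrable_def integrable_completion)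
    qed
    show "\<forall>\<psi>. \<psi> \<in> borel_measurable borel \<longrightarrow> (\<forall>w. \<not> 0 < fst w \<longrightarrow> \<psi> w = 0) \<longrightarrow>
       (LINT w|lebesgue. u0 w * \<psi> w) = (LINT w|lborel. u w * \<psi> w)"
    proof (intro allI impI)
      fix \<psi> :: "real \<times> (real^2) \<Rightarrow> real"
      assume \<psi>[measurable]: "\<psi> \<in> borel_measurable borel" and "\<forall>w. \<not> 0 < fst w \<longrightarrow> \<psi> w = 0"
      then have z: "\<And>w. \<not> 0 < fst w \<Longrightarrow> \<psi> w = 0" by blast
      have \<psi>l: "\<psi> \<in> borel_measurable lebesgue" using \<psi> by (rule borel_imp_lebesgue)
      have "u0 w * \<psi> w = U w * \<psi> w" for w using z[of w] by (auto simp: U_def)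
      then have "(LINT w|lebesgue. u0 w * \<psi> w) = (LINT w|lebesgue. U w * \<psi> w)" by (simp only:)
      also have "\<dots> = (LINT w|lebesgue. u w * \<psi> w)"
        by (rule integral_cong_AE) (use ael Ul ul \<psi>l in \<open>auto elim!: eventually_mono\<close>)
      also have "\<dots> = (LINT w|lborel. u w * \<psi> w)" by (rule integral_completion) simp
      finally show "(LINT w|lebesgue. u0 w * \<psi> w) = (LINT w|lborel. u w * \<psi> w)" .
    qed
  qed
qed

text \<open>Integration by parts and the bound on \<open>Dv\<close> give exactly the hypothesis of
  \<open>weak_difference_AE\<close> in each velocity direction. A general shift \<open>e\<close> is
  made along the two axes in turn, and each component is at most \<open>norm e\<close>, whence the
  factor 2.\<close>

lemma is_grad_v_difference:
  fixes W :: "real \<Rightarrow> real^2 \<Rightarrow> real"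
  assumes S: "smooth_step S" and gr: "is_grad_v W Dv" and "0 \<le> L"
    and Dv: "AE z in lebesgue. norm (Dv (norm (fst z :: real^2)) (snd z)) \<le> L"
  obtains u where "u \<in> borel_measurable borel"
    "AE z in lborel. u (norm (fst z :: real^2), snd z) = W (norm (fst z)) (snd z)"
    "\<And>e. AE z in lborel. \<bar>u (norm (fst z :: real^2), snd z + e) - u (norm (fst z), snd z)\<bar> \<le> 2 * L * norm e"
proof -
  interpret step_fun S by unfold_locales (rule S)
  have Dvl: "AE z in lborel. norm (Dv (norm (fst z :: real^2)) (snd z)) \<le> L"
    using Dv by (simp add: AE_completion_iff)
  let ?u0 = "\<lambda>(r, v). W r v"
  have wd: "has_weak_deriv ({0<..} \<times> UNIV) (0, axis i 1) ?u0 (\<lambda>(r, v). Dv r v $ i)" for i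
    using gr unfolding is_grad_v_def by blast
  then have loc: "locally_integrable ({0<..} \<times> UNIV) ?u0" "locally_integrable ({0<..} \<times> UNIV) (\<lambda>(r, v). Dv r v $ i)" for i
    unfolding has_weak_deriv_def by blast+
  have polar_transfer: "AE z in lborel. P (norm (fst z :: real^2), snd z)"
    if "AE w in lborel. 0 < fst w \<longrightarrow> P w" for P :: "real \<times> (real^2) \<Rightarrow> bool"
  proof -
    obtain N where N: "N \<in> null_sets lborel" "{w. 0 < fst w \<and> \<not> P w} \<subseteq> N"
    proof -
      obtain N where "{w \<in> space lborel. \<not> (0 < fst w \<longrightarrow> P w)} \<subseteq> N" "emeasure lborel N = 0" "N \<in> sets lborel"
        using \<open>AE w in lborel. 0 < fst w \<longrightarrow> P w\<close> by (rule AE_E)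
      then show ?thesis by (intro that[of N] null_setsI) auto
    qed
    have "AE w in lborel. 0 < fst w \<longrightarrow> w \<notin> N" using AE_not_in[OF N(1)] by eventually_elim simp
    then have "AE z in lborel. (norm (fst z :: real^2), snd z) \<notin> N" using N(1) by (subst AE_polar) auto
    \<comment> \<open>The transferred property is known only for positive radius, so the null set
      \<open>x = 0\<close> has to be removed as well.\<close>
    moreover have "AE z in (lborel :: phase measure). norm (fst z) \<notin> {0}"
    proof -
      have "AE w in (lborel :: (real \<times> (real^2)) measure). 0 < fst w \<longrightarrow> w \<notin> {0} \<times> UNIV" by auto
      then have "AE z in lborel. (norm (fst z :: real^2), snd z) \<notin> {0} \<times> (UNIV :: (real^2) set)"
        by (subst AE_polar) (auto simp: closed_Times intro!: borel_closed)
      then show ?thesis by (auto elim!: eventually_mono)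
    qed
    ultimately show ?thesis
    proof eventually_elim
      case (elim z)
      have "(norm (fst z), snd z) \<notin> {w. 0 < fst w \<and> \<not> P w}" using elim(1) N(2) by blast
      then show ?case using elim(2) by simp
    qed
  qed
  obtain u where u[measurable]: "u \<in> borel_measurable borel" "AE w in lborel. 0 < fst w \<longrightarrow> u w = ?u0 w"
    "\<forall>K. compact K \<longrightarrow> K \<subseteq> {0<..} \<times> UNIV \<longrightarrow> set_integrable lborel K u"
    "\<forall>\<psi>. \<psi> \<in> borel_measurable borel \<longrightarrow> (\<forall>w. \<not> 0 < fst w \<longrightarrow> \<psi> w = 0) \<longrightarrow>
       (LINT w|lebesgue. ?u0 w * \<psi> w) = (LINT w|lborel. u w * \<psi> w)"
    by (rule locally_integrable_borel_version[OF loc(1)]) (rule that)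
  have pos: "AE w in lborel. 0 < fst w \<longrightarrow> \<bar>u (w + s *\<^sub>R (0, axis i 1)) - u w\<bar> \<le> L * s" if "0 < s" for s i
  proof (rule weak_difference_AE[OF u(1) u(3)[rule_format] _ \<open>0 \<le> L\<close> that])
    fix \<Theta> :: "real \<times> (real^2) \<Rightarrow> real" assume T: "test_fun ({0<..} \<times> UNIV) \<Theta>"
    obtain D where D[measurable]: "D \<in> borel_measurable borel" "AE w in lborel. 0 < fst w \<longrightarrow> D w = (\<lambda>(r, v). Dv r v $ i) w"
      "\<forall>K. compact K \<longrightarrow> K \<subseteq> {0<..} \<times> UNIV \<longrightarrow> set_integrable lborel K D"
      "\<forall>\<psi>. \<psi> \<in> borel_measurable borel \<longrightarrow> (\<forall>w. \<not> 0 < fst w \<longrightarrow> \<psi> w = 0) \<longrightarrow>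
         (LINT w|lebesgue. (\<lambda>(r, v). Dv r v $ i) w * \<psi> w) = (LINT w|lborel. D w * \<psi> w)"
      by (rule locally_integrable_borel_version[OF loc(2)[of i]]) (rule that)
    have Dbound: "AE w in lborel. 0 < fst w \<longrightarrow> \<bar>D w\<bar> \<le> L"
    proof -
      have Am: "{w. \<not> \<bar>D w\<bar> \<le> L} \<in> sets borel" by measurable
      have "AE z in lborel. (norm (fst z :: real^2), snd z) \<notin> {w. \<not> \<bar>D w\<bar> \<le> L}"
        using polar_transfer[OF D(2)] Dvl
      proof eventually_elim
        case (elim z)
        then show ?case using component_le_norm_cart[of "Dv (norm (fst z)) (snd z)" i] by simp
      qed
      then show ?thesis using AE_polar[OF Am] by simp
    qed
    have Tz: "\<Theta> w = 0" "frechet_derivative \<Theta> (at w) h = 0" if "\<not> 0 < fst w" for w h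
    proof -
      have "w \<notin> closure {z. \<Theta> z \<noteq> 0}" using T that unfolding test_fun_def by auto
      then show "frechet_derivative \<Theta> (at w) h = 0" "\<Theta> w = 0"
        using frechet_derivative_outside_support closure_subset by (blast, metis (mono_tags, lifting) mem_Collect_eq subsetD)
    qed
    have sm: "C_k k \<Theta>" for k using T by (simp add: test_fun_def smooth_fun_def)
    have Tm: "\<Theta> \<in> borel_measurable borel" "(\<lambda>w. frechet_derivative \<Theta> (at w) h) \<in> borel_measurable borel" for h
      using sm[of 0] sm[of "Suc 0", unfolded C_k.simps, THEN conjunct2, rule_format, of h]
      by (auto intro!: borel_measurable_continuous_onI simp del: split_paired_All)
    have "(LINT w|lborel. u w * frechet_derivative \<Theta> (at w) (0, axis i 1)) =
      (LINT w|lebesgue. ?u0 w * frechet_derivative \<Theta> (at w) (0, axis i 1))"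
      by (rule u(4)[rule_format, symmetric]) (use Tm Tz in auto)
    also have "\<dots> = - (LINT w|lebesgue. (\<lambda>(r, v). Dv r v $ i) w * \<Theta> w)"
      using wd[of i] T unfolding has_weak_deriv_def by blast
    also have "\<dots> = - (LINT w|lborel. D w * \<Theta> w)"
      by (subst D(4)[rule_format]) (use Tm Tz in auto)
    finally have "\<bar>LINT w|lborel. u w * frechet_derivative \<Theta> (at w) (0, axis i 1)\<bar> = \<bar>LINT w|lborel. D w * \<Theta> w\<bar>" by simp
    also have "\<dots> \<le> (LINT w|lborel. \<bar>D w * \<Theta> w\<bar>)" by (rule integral_abs_bound)
    also have "\<dots> \<le> (LINT w|lborel. L * \<bar>\<Theta> w\<bar>)"
    proof (rule integral_mono_AE')
      show "integrable lborel (\<lambda>w. L * \<bar>\<Theta> w\<bar>)" using test_fun_integrable[OF T] by simp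
      show "AE w in lborel. \<bar>D w * \<Theta> w\<bar> \<le> L * \<bar>\<Theta> w\<bar>" using Dbound
      proof eventually_elim
        case (elim w)
        then show ?case using Tz(1)[of w] by (cases "0 < fst w") (auto simp: abs_mult intro!: mult_right_mono)
      qed
    qed (use \<open>0 \<le> L\<close> in auto)
    finally show "\<bar>LINT w|lborel. u w * frechet_derivative \<Theta> (at w) (0, axis i 1)\<bar> \<le> L * (LINT w|lborel. \<bar>\<Theta> w\<bar>)" by simp
  qed
  have all: "AE w in lborel. 0 < fst w \<longrightarrow> \<bar>u (w + s *\<^sub>R (0, axis i 1)) - u w\<bar> \<le> L * \<bar>s\<bar>" for s i
  proof (cases "s > 0")
    case True then show ?thesis using pos[OF True, of i] by simp
  next
    case False
    show ?thesis
    proof (cases "s = 0")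
      case True
    then have "w + s *\<^sub>R (0, axis i 1) = w" for w :: "real \<times> (real^2)"
      by (simp only: scaleR_zero_left add_0_right)
    then show ?thesis using True by (simp only:) simp
    next
      case False
      with \<open>\<not> 0 < s\<close> have "0 < - s" by simp
      \<comment> \<open>For negative \<open>s\<close> the estimate for \<open>- s\<close> is read at
        the translated point. The translation changes only the velocity, so the condition
        \<open>0 < fst w\<close> is unaffected.\<close>
      from AE_lborel_translate[OF pos[OF this, of i], of "s *\<^sub>R (0, axis i 1)"] show ?thesis
      proof eventually_elim
        case (elim w)
        have eq: "w + s *\<^sub>R (0, axis i 1) + - s *\<^sub>R (0, axis i 1) = w"
          by (simp only: scaleR_minus_left add.assoc right_minus add_0_right)
        have fs: "fst (w + s *\<^sub>R (0, axis i 1)) = fst w" by simp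
        have as: "\<bar>s\<bar> = - s" using \<open>0 < - s\<close> by simp
        show ?case unfolding as using elim[unfolded eq fs]
          by (simp only: abs_minus_commute[of "u w"])
      qed
    qed
  qed
  have ev: "AE w in lborel. 0 < fst w \<longrightarrow> \<bar>u (w + (0, e)) - u w\<bar> \<le> 2 * L * norm e" for e
    using all[of "e $ 1" 1] AE_lborel_translate[OF all[of "e $ 2" 2], of "(e $ 1) *\<^sub>R (0, axis 1 1)"]
  proof eventually_elim
    case (elim w)
    have "(0, e) = (e $ 1) *\<^sub>R (0::real, axis 1 (1::real) :: real^2) + (e $ 2) *\<^sub>R (0, axis 2 1)"
      by (simp add: vec_eq_iff axis_def forall_2)
    then have eq: "w + (0, e) = w + (e $ 1) *\<^sub>R (0, axis 1 1) + (e $ 2) *\<^sub>R (0, axis 2 1)" by (simp only: add.assoc)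
    show ?case
    proof
      assume "0 < fst w"
      then have "\<bar>u (w + (0, e)) - u w\<bar> \<le> L * \<bar>e $ 1\<bar> + L * \<bar>e $ 2\<bar>"
        unfolding eq using elim by simp
      also have "\<dots> \<le> L * norm e + L * norm e"
        using \<open>0 \<le> L\<close> component_le_norm_cart by (intro add_mono mult_left_mono) auto
      finally show "\<bar>u (w + (0, e)) - u w\<bar> \<le> 2 * L * norm e" by simp
    qed
  qed
  show ?thesis
  proof (rule that[OF u(1)])
    show "AE z in lborel. u (norm (fst z :: real^2), snd z) = W (norm (fst z)) (snd z)"
      using polar_transfer[OF u(2)] by simp
    show "AE z in lborel. \<bar>u (norm (fst z :: real^2), snd z + e) - u (norm (fst z), snd z)\<bar> \<le> 2 * L * norm e" for e
      using polar_transfer[OF ev[of e]] by simp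
  qed
qed

lemma in_Linf_AE:
  assumes "in_Linf M f" shows "AE x in M. norm (f x) \<le> Linf_norm M f"
proof (cases "esssup M (\<lambda>x. ereal (norm (f x)))")
  case (real r)
  have "AE x in M. ereal (norm (f x)) \<le> esssup M (\<lambda>x. ereal (norm (f x)))" by (rule esssup_AE)
  then show ?thesis unfolding Linf_norm_def real by simp
next
  case PInf then show ?thesis using assms by (simp add: in_Linf_def)
next
  \<comment> \<open>An essential supremum of minus infinity forces the measure to be null, and then
    every property holds almost everywhere.\<close>
  case MInf
  have "AE x in M. ereal (norm (f x)) \<le> esssup M (\<lambda>x. ereal (norm (f x)))" by (rule esssup_AE)
  then have "AE x in M. False" unfolding MInf by simp
  then show ?thesis by (rule eventually_mono) simp
qed

lemma cutoff_facts:
  fixes H :: "real \<Rightarrow> real"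
  assumes "cutoff R H"
  obtains B L where "0 \<le> B" "0 \<le> L" "\<And>x::real^2. \<bar>H (norm x)\<bar> \<le> B"
    "\<And>x y::real^2. \<bar>H (norm x) - H (norm y)\<bar> \<le> L * norm (x - y)"
    "(\<lambda>x::real^2. H (norm x)) \<in> borel_measurable borel"
proof -
  let ?f = "\<lambda>x::real^2. H (norm x)"
  have C: "C_k k ?f" for k using assms by (simp add: cutoff_def smooth_fun_def)
  have cont: "continuous_on UNIV ?f" using C[of 0] by simp
  have z: "?f x = 0" if "x \<notin> cball 0 (2 * R)" for x
    using assms that unfolding cutoff_def by (auto simp: not_le)
  have "closure {x. ?f x \<noteq> 0} \<subseteq> cball 0 (2 * R)" by (rule closure_minimal) (use z in blast, simp)
  then have K: "compact (closure {x. ?f x \<noteq> 0})"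
    by (meson bounded_cball bounded_subset closed_closure compact_eq_bounded_closed)
  obtain B where "0 \<le> B" "\<And>x. \<bar>?f x\<bar> \<le> B" using compact_support_bounded[OF cont compact_cball z] by blast
  moreover obtain L where "0 \<le> L" "\<And>x y. \<bar>?f x - ?f y\<bar> \<le> L * norm (x - y)"
    using compact_support_lipschitz[OF C K] by blast
  ultimately show ?thesis using cont by (intro that[of B L] borel_measurable_continuous_onI) auto
qed

text \<open>A shift in \<open>v\<close> leaves the direction \<open>x / |x|\<close> and the factor
  \<open>H1\<close> alone, so the estimate is the product rule for the representative of
  \<open>Vr\<close> times \<open>H2\<close>: \<open>2 * L0\<close> and \<open>L2\<close> are the
  Lipschitz constants, \<open>B2\<close> and \<open>B\<close> the bounds of the other factors, and
  \<open>B1\<close> bounds the common factor \<open>H1\<close>.\<close>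

lemma force_regular:
  assumes R: "R > 0" and c1: "cutoff R H1" and c2: "cutoff R' H2"
    and gr: "is_grad_v Vr DvVr"
    and V: "in_Linf lebesgue (\<lambda>(x::real^2, v). Vr (norm x) v)"
    and D: "in_Linf lebesgue (\<lambda>(x::real^2, v). DvVr (norm x) v)"
  obtains F' BF L where "F' \<in> borel_measurable borel" "AE z in lborel. force Vr H1 H2 z = F' z"
    "\<And>z. norm (F' z) \<le> BF" "0 \<le> BF" "0 \<le> L"
    "\<And>e. AE z in lborel. norm (F' (fst z, snd z + e) - F' z) \<le> L * norm e"
proof -
  obtain S where S: "smooth_step S" using smooth_step_exists[OF c1 R] by blast
  define B where "B = max 0 (Linf_norm lebesgue (\<lambda>(x::real^2, v). Vr (norm x) v))"
  define L0 where "L0 = max 0 (Linf_norm lebesgue (\<lambda>(x::real^2, v). DvVr (norm x) v))"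
  have B: "0 \<le> B" "AE z in lborel. \<bar>Vr (norm (fst z :: real^2)) (snd z)\<bar> \<le> B"
    using in_Linf_AE[OF V] unfolding B_def AE_completion_iff by (auto elim!: eventually_mono simp: case_prod_beta)
  have L0: "0 \<le> L0" "AE z in lebesgue. norm (DvVr (norm (fst z :: real^2)) (snd z)) \<le> L0"
    using in_Linf_AE[OF D] unfolding L0_def by (auto elim!: eventually_mono simp: case_prod_beta)
  obtain u where u[measurable]: "u \<in> borel_measurable borel"
    and uV: "AE z in lborel. u (norm (fst z :: real^2), snd z) = Vr (norm (fst z)) (snd z)"
    and ud: "\<And>e. AE z in lborel. \<bar>u (norm (fst z :: real^2), snd z + e) - u (norm (fst z), snd z)\<bar> \<le> 2 * L0 * norm e"
    using is_grad_v_difference[OF S gr L0] by blast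
  obtain B1 L1 where h1: "0 \<le> B1" "\<And>x::real^2. \<bar>H1 (norm x)\<bar> \<le> B1"
    and h1m: "(\<lambda>x::real^2. H1 (norm x)) \<in> borel_measurable borel" using cutoff_facts[OF c1] by metis
  obtain B2 L2 where h2: "0 \<le> B2" "0 \<le> L2" "\<And>x::real^2. \<bar>H2 (norm x)\<bar> \<le> B2"
    "\<And>x y::real^2. \<bar>H2 (norm x) - H2 (norm y)\<bar> \<le> L2 * norm (x - y)"
    and h2m: "(\<lambda>x::real^2. H2 (norm x)) \<in> borel_measurable borel" using cutoff_facts[OF c2] by metis
  \<comment> \<open>Clamping makes the bound hold at every point instead of almost every point. It
    is 1-Lipschitz, so the difference estimate survives, and it changes the representative only on a
    null set.\<close>
  define cl where "cl t = max (- B) (min B t)" for t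
  have cl: "\<bar>cl t\<bar> \<le> B" "\<bar>cl t - cl s\<bar> \<le> \<bar>t - s\<bar>" "\<bar>t\<bar> \<le> B \<Longrightarrow> cl t = t" for t s
    unfolding cl_def using B(1) by (auto simp: max_def min_def abs_if split: if_splits)
  define a where "a z = cl (u (norm (fst z), snd z))" for z :: phase
  define F' where "F' z = (a z * (H1 (norm (fst z)) * H2 (norm (snd z)))) *\<^sub>R (fst z /\<^sub>R norm (fst z))" for z :: phase
  have dir: "norm (x /\<^sub>R norm x) \<le> 1" for x :: "real^2" by (cases "x = 0") auto
  have dirm: "(\<lambda>x::real^2. x /\<^sub>R norm x) \<in> borel_measurable borel" by measurable
  have am: "a \<in> borel_measurable borel"
  proof -
    have "(\<lambda>z::phase. (norm (fst z), snd z)) \<in> borel_measurable borel"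
      by (intro borel_measurable_continuous_onI continuous_intros)
    then show ?thesis unfolding a_def cl_def using u by (intro borel_measurable_max borel_measurable_min borel_measurable_const measurable_compose[OF _ u])
  qed
  have fm: "(fst :: phase \<Rightarrow> _) \<in> borel_measurable borel" "(snd :: phase \<Rightarrow> _) \<in> borel_measurable borel"
    by (intro borel_measurable_continuous_onI continuous_intros)+
  have F'm: "F' \<in> borel_measurable borel" unfolding F'_def
    by (rule borel_measurable_scaleR[OF borel_measurable_times[OF am borel_measurable_times[OF
          measurable_compose[OF fm(1) h1m] measurable_compose[OF fm(2) h2m]]] measurable_compose[OF fm(1) dirm]])
  show ?thesis
  proof (rule that[of F' "B * (B1 * B2)" "B1 * (2 * L0 * B2 + B * L2)"])
    show "F' \<in> borel_measurable borel" by (rule F'm)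
    show "0 \<le> B * (B1 * B2)" "0 \<le> B1 * (2 * L0 * B2 + B * L2)" using B h1 h2 L0 by auto
    show "norm (F' z) \<le> B * (B1 * B2)" for z
    proof -
      have "norm (F' z) \<le> \<bar>a z\<bar> * (\<bar>H1 (norm (fst z))\<bar> * \<bar>H2 (norm (snd z))\<bar>) * 1"
        unfolding F'_def norm_scaleR abs_mult using dir[of "fst z"] by (intro mult_left_mono) auto
      also have "\<dots> \<le> B * (B1 * B2) * 1"
        using cl(1) h1 h2 B(1) by (intro mult_mono) (auto simp: a_def intro!: mult_mono)
      finally show ?thesis by simp
    qed
    show "AE z in lborel. force Vr H1 H2 z = F' z" using uV B(2)
    proof eventually_elim
      case (elim z)
      then have "a z = Vr (norm (fst z)) (snd z)" unfolding a_def by (simp add: cl(3))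
      then show ?case unfolding force_def F'_def by (simp add: case_prod_beta)
    qed
    show "AE z in lborel. norm (F' (fst z, snd z + e) - F' z) \<le> B1 * (2 * L0 * B2 + B * L2) * norm e" for e
      using ud[of e]
    proof eventually_elim
      case (elim z)
      let ?h = "H1 (norm (fst z))" and ?p = "H2 (norm (snd z + e))" and ?q = "H2 (norm (snd z))"
      let ?a' = "a (fst z, snd z + e)"
      have da: "\<bar>?a' - a z\<bar> \<le> 2 * L0 * norm e"
        unfolding a_def using cl(2) elim by (auto intro: order_trans)
      have "F' (fst z, snd z + e) - F' z = (?h * (?a' * ?p - a z * ?q)) *\<^sub>R (fst z /\<^sub>R norm (fst z))"
        unfolding F'_def scaleR_left_diff_distrib[symmetric] by (simp add: algebra_simps)
      then have "norm (F' (fst z, snd z + e) - F' z) \<le> \<bar>?h * (?a' * ?p - a z * ?q)\<bar> * 1"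
        using dir[of "fst z"] by (simp only: norm_scaleR) (intro mult_left_mono; simp)
      also have "\<dots> = \<bar>?h\<bar> * \<bar>(?a' - a z) * ?p + a z * (?p - ?q)\<bar>"
      proof -
        have alg: "\<bar>h * (x * p - y * q)\<bar> * 1 = \<bar>h\<bar> * \<bar>(x - y) * p + y * (p - q)\<bar>" for h x y p q :: real
          by (simp add: abs_mult[symmetric] algebra_simps)
        show ?thesis by (rule alg)
      qed
      also have "\<dots> \<le> B1 * ((2 * L0 * norm e) * B2 + B * (L2 * norm e))"
      proof (intro mult_mono h1)
        have "\<bar>(?a' - a z) * ?p + a z * (?p - ?q)\<bar> \<le> \<bar>?a' - a z\<bar> * \<bar>?p\<bar> + \<bar>a z\<bar> * \<bar>?p - ?q\<bar>"
          unfolding abs_mult[symmetric] by (rule abs_triangle_ineq)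
        also have "\<dots> \<le> (2 * L0 * norm e) * B2 + B * (L2 * norm e)"
          using da h2 h2(4)[of "snd z + e" "snd z"] cl(1) B(1) L0(1) by (intro add_mono mult_mono) (auto simp: a_def)
        finally show "\<bar>(?a' - a z) * ?p + a z * (?p - ?q)\<bar> \<le> (2 * L0 * norm e) * B2 + B * (L2 * norm e)" .
      qed (use h1 in auto)
      also have "\<dots> = B1 * (2 * L0 * B2 + B * L2) * norm e" by (simp add: algebra_simps)
      finally show ?case .
    qed
  qed
qed

section \<open>Setwise convergence of uniformly dominated measures\<close>

lemma convergent_approx:
  fixes x :: "nat \<Rightarrow> real"
  assumes "\<And>e. 0 < e \<Longrightarrow> \<exists>y. convergent y \<and> (\<forall>\<^sub>F n in sequentially. \<bar>x n - y n\<bar> \<le> e)"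
  shows "convergent x"
proof -
  have "Cauchy x"
  proof (rule metric_CauchyI)
    fix e :: real assume "0 < e"
    then obtain y N1 where y: "convergent y" and N1: "\<And>n. n \<ge> N1 \<Longrightarrow> \<bar>x n - y n\<bar> \<le> e/4"
      using assms[of "e/4"] by (auto simp: eventually_sequentially)
    from y \<open>0 < e\<close> obtain N2 where N2: "\<And>m n. m \<ge> N2 \<Longrightarrow> n \<ge> N2 \<Longrightarrow> dist (y m) (y n) < e/4"
      using metric_CauchyD[OF convergent_Cauchy[OF y], of "e/4"] by auto
    show "\<exists>M. \<forall>m\<ge>M. \<forall>n\<ge>M. dist (x m) (x n) < e"
    proof (intro exI allI impI)
      fix m n assume "m \<ge> max N1 N2" "n \<ge> max N1 N2"
      then show "dist (x m) (x n) < e"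
        using N1[of m] N1[of n] N2[of m n] \<open>0 < e\<close> unfolding dist_real_def by linarith
    qed
  qed
  then show ?thesis by (simp add: Cauchy_convergent_iff)
qed

text \<open>\<open>P\<close> may depend on \<open>e\<close> but not on \<open>n\<close>. This makes
  the measures continuous at the empty set uniformly in \<open>n\<close>, the property that turns
  setwise limits into measures, as in the Vitali-Hahn-Saks theorem.\<close>

locale unif_dom_seq =
  fixes N :: "'a measure" and m :: "nat \<Rightarrow> 'a measure"
  assumes fin: "\<And>n. finite_measure (m n)" and sets_m [measurable_cong]: "\<And>n. sets (m n) = sets N"
    and dom: "\<And>e. 0 < e \<Longrightarrow> \<exists>P. finite_measure P \<and> sets P = sets N \<and>
                 (\<forall>n. \<forall>A\<in>sets N. measure (m n) A \<le> measure P A + e)"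
begin

lemma unif_tail:
  assumes A: "\<And>i. A i \<in> sets N" "decseq A" "(\<Inter>i. A i) = {}" and "0 < e"
  obtains j where "\<And>n i. j \<le> i \<Longrightarrow> measure (m n) (A i) \<le> e"
proof -
  obtain P where P: "finite_measure P" "sets P = sets N"
      "\<And>n A. A \<in> sets N \<Longrightarrow> measure (m n) A \<le> measure P A + e/2"
    using dom[of "e/2"] \<open>0 < e\<close> by auto
  interpret P: finite_measure P by fact
  have "(\<lambda>i. measure P (A i)) \<longlonglongrightarrow> measure P (\<Inter>i. A i)"
    by (rule P.finite_Lim_measure_decseq) (use A P in auto)
  then have "(\<lambda>i. measure P (A i)) \<longlonglongrightarrow> 0" using A by simp
  then obtain j where j: "\<And>i. j \<le> i \<Longrightarrow> measure P (A i) < e/2"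
    using \<open>0 < e\<close> order_tendstoD(2)[of _ 0 sequentially "e/2"] by (auto simp: eventually_sequentially)
  show ?thesis
    by (rule that[of j]) (use j P(3) A in \<open>smt (verit, best) field_sum_of_halves\<close>)
qed

text \<open>Dynkin induction. The critical case is a countable disjoint union: its tails decrease to
  the empty set, so by \<open>unif_tail\<close> finite partial sums approximate the measure of the
  union uniformly in \<open>n\<close>.\<close>

lemma convergent_sets:
  assumes E: "Int_stable E" "E \<subseteq> Pow (space N)" "sets N = sigma_sets (space N) E"
    and conv: "\<And>A. A \<in> E \<Longrightarrow> convergent (\<lambda>n. measure (m n) A)"
    and sp: "convergent (\<lambda>n. measure (m n) (space N))"
    and A: "A \<in> sets N"
  shows "convergent (\<lambda>n. measure (m n) A)"
  using E(1,2) A[unfolded E(3)]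
proof (induction rule: sigma_sets_induct_disjoint)
  case (basic A) then show ?case by (rule conv)
next
  case empty then show ?case by (simp add: convergent_const)
next
  case (compl A)
  have "measure (m n) (space N - A) = measure (m n) (space N) - measure (m n) A" for n
  proof -
    interpret finite_measure "m n" by (rule fin)
    show ?thesis
      using finite_measure_compl[of A] compl(1) E(3) sets_m[of n] sets_eq_imp_space_eq[OF sets_m[of n]]
      by simp
  qed
  then show ?case using convergent_diff[OF sp compl(2)] by simp
next
  case (union A)
  have A: "A i \<in> sets N" for i using union(2) E(3) by auto
  define B where "B j = (\<Union>i\<in>{j..}. A i)" for j
  show ?case
  proof (rule convergent_approx)
    fix e :: real assume "0 < e"
    have "decseq B" unfolding B_def decseq_def by fastforce
    moreover have "(\<Inter>j. B j) = {}"
    proof -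
      { fix x assume x: "\<And>j. x \<in> B j"
        from x[of 0] obtain i where i: "x \<in> A i" unfolding B_def by auto
        from x[of "Suc i"] obtain k where k: "Suc i \<le> k" "x \<in> A k" unfolding B_def by auto
        then have False using union(1) i by (auto simp: disjoint_family_on_def) (metis disjoint_iff not_less_eq_eq order_refl) }
      then show ?thesis by auto
    qed
    moreover have "B i \<in> sets N" for i unfolding B_def using A by auto
    ultimately obtain j where j: "\<And>n i. j \<le> i \<Longrightarrow> measure (m n) (B i) \<le> e"
      using unif_tail[of B e] \<open>0 < e\<close> by blast
    have eq: "measure (m n) (\<Union>i. A i) = (\<Sum>i<j. measure (m n) (A i)) + measure (m n) (B j)" for n
    proof -
      interpret finite_measure "m n" by (rule fin)
      have 1: "(\<Union>i. A i) = (\<Union>i<j. A i) \<union> B j" unfolding B_def using linorder_not_le by fastforce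
      have 2: "(\<Union>i<j. A i) \<inter> B j = {}" unfolding B_def using union(1)
        by (auto simp: disjoint_family_on_def) (metis disjoint_iff linorder_not_le)
      have "measure (m n) (\<Union>i<j. A i) = (\<Sum>i<j. measure (m n) (A i))"
        by (rule finite_measure_finite_Union)
           (use A union(1) sets_m in \<open>auto simp: disjoint_family_on_def\<close>)
      then show ?thesis unfolding 1
        by (subst finite_measure_Union) (use A 2 \<open>\<And>i. B i \<in> sets N\<close> sets_m in auto)
    qed
    have "convergent (\<lambda>n. \<Sum>i<j. measure (m n) (A i))"
      by (rule convergent_sum) (use union in auto)
    moreover have "\<bar>measure (m n) (\<Union>i. A i) - (\<Sum>i<j. measure (m n) (A i))\<bar> \<le> e" for n
      using j[of j n] eq[of n] by simp
    ultimately show "\<exists>y. convergent y \<and> (\<forall>\<^sub>F n in sequentially. \<bar>measure (m n) (\<Union>i. A i) - y n\<bar> \<le> e)"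
      by (intro exI[of _ "\<lambda>n. \<Sum>i<j. measure (m n) (A i)"]) simp
  qed
qed

text \<open>Finite additivity passes to the limit at once. Countable additivity is obtained from
  continuity at the empty set, where \<open>unif_tail\<close> lets the bound for all
  \<open>n\<close> pass to the limit.\<close>

lemma limit_measure_exists:
  assumes conv: "\<And>A. A \<in> sets N \<Longrightarrow> convergent (\<lambda>n. measure (m n) A)"
  obtains L where "finite_measure L" "sets L = sets N"
    "\<And>A. A \<in> sets N \<Longrightarrow> (\<lambda>n. measure (m n) A) \<longlonglongrightarrow> measure L A"
proof -
  define l where "l A = lim (\<lambda>n. measure (m n) A)" for A
  have l: "(\<lambda>n. measure (m n) A) \<longlonglongrightarrow> l A" if "A \<in> sets N" for A
    using conv[OF that] unfolding l_def convergent_LIMSEQ_iff .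
  have l0: "0 \<le> l A" if "A \<in> sets N" for A
    by (rule LIMSEQ_le_const[OF l[OF that]]) auto
  have pos: "positive (sets N) (\<lambda>A. ennreal (l A))"
    unfolding positive_def l_def by simp
  have add: "l (A \<union> B) = l A + l B" if "A \<in> sets N" "B \<in> sets N" "A \<inter> B = {}" for A B
  proof -
    have "measure (m n) (A \<union> B) = measure (m n) A + measure (m n) B" for n
    proof -
      interpret finite_measure "m n" by (rule fin)
      show ?thesis using that sets_m by (intro finite_measure_Union) auto
    qed
    then have "(\<lambda>n. measure (m n) (A \<union> B)) \<longlonglongrightarrow> l A + l B"
      using tendsto_add[OF l l] that by simp
    then show ?thesis using LIMSEQ_unique l that by (metis sets.Un)
  qed
  have ca: "countably_additive (sets N) (\<lambda>A. ennreal (l A))"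
  proof (rule sets.empty_continuous_imp_countably_additive)
    show "positive (sets N) (\<lambda>A. ennreal (l A))" by (rule pos)
    show "additive (sets N) (\<lambda>A. ennreal (l A))"
      unfolding additive_def using add l0 by simp
    show "\<forall>A\<in>sets N. ennreal (l A) \<noteq> \<infinity>" by simp
    fix A :: "nat \<Rightarrow> 'a set" assume A: "range A \<subseteq> sets N" "decseq A" "(\<Inter>i. A i) = {}"
    have "(\<lambda>i. l (A i)) \<longlonglongrightarrow> 0"
    proof (rule LIMSEQ_I)
      fix r :: real assume "0 < r"
      then obtain j where j: "\<And>n i. j \<le> i \<Longrightarrow> measure (m n) (A i) \<le> r/2"
        using unif_tail[of A "r/2"] A by auto
      have "norm (l (A i) - 0) < r" if "j \<le> i" for i
      proof -
        have "A i \<in> sets N" using A by auto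
        then have "l (A i) \<le> r/2" by (intro LIMSEQ_le_const2[OF l]) (use j that in auto)
        then show ?thesis using l0[OF \<open>A i \<in> sets N\<close>] \<open>0 < r\<close> by simp
      qed
      then show "\<exists>no. \<forall>n\<ge>no. norm (l (A n) - 0) < r" by blast
    qed
    then show "(\<lambda>i. ennreal (l (A i))) \<longlonglongrightarrow> 0"
      using tendsto_ennrealI by fastforce
  qed
  define L where "L = measure_of (space N) (sets N) (\<lambda>A. ennreal (l A))"
  have sL: "sets L = sets N" unfolding L_def by simp
  have eL: "emeasure L A = ennreal (l A)" if "A \<in> sets N" for A
    by (rule emeasure_measure_of[OF L_def _ _ _])
       (use pos ca that sets.space_closed sL in auto)
  show ?thesis
  proof (rule that[of L])
    show "finite_measure L"
      by (rule finite_measureI) (use eL[OF sets.top] sets_eq_imp_space_eq[OF sL] in simp)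
    show "sets L = sets N" by (rule sL)
    show "(\<lambda>n. measure (m n) A) \<longlonglongrightarrow> measure L A" if "A \<in> sets N" for A
      using l[OF that] eL[OF that] l0[OF that] by (simp add: measure_def)
  qed
qed

end

text \<open>A bounded function is within \<open>1 / k\<close> of a step function with finitely many
  levels, whose integrals converge by hypothesis. The total masses are bounded, so the approximation
  error is uniform in \<open>n\<close>.\<close>

lemma integral_setwise_tendsto:
  fixes f :: "'a \<Rightarrow> real"
  assumes fin: "\<And>n. finite_measure (m n)" "finite_measure L"
    and sets_m: "\<And>n. sets (m n) = sets L"
    and conv: "\<And>A. A \<in> sets L \<Longrightarrow> (\<lambda>n. measure (m n) A) \<longlonglongrightarrow> measure L A"
    and f: "f \<in> borel_measurable L" "\<And>x. \<bar>f x\<bar> \<le> B"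
  shows "(\<lambda>n. LINT x|m n. f x) \<longlonglongrightarrow> (LINT x|L. f x)"
proof -
  \<comment> \<open>All values of \<open>\<lfloor>real k * f x\<rfloor>\<close> lie in this finite
    range; the margin of 1 on both sides absorbs the rounding.\<close>
  define I where "I k = {- int k * \<lceil>B\<rceil> - 1 .. int k * \<lceil>B\<rceil> + 1}" for k
  define g where "g k x = (\<Sum>i\<in>I k. (of_int i / real k) * indicat_real {x\<in>space L. \<lfloor>real k * f x\<rfloor> = i} x)" for k x
  have S[measurable]: "{x\<in>space L. \<lfloor>real k * f x\<rfloor> = i} \<in> sets L" for k i
    using f(1) by measurable
  have gk: "\<bar>f x - g k x\<bar> \<le> 1 / real k" if "k > 0" "x \<in> space L" for k x
  proof -
    let ?i = "\<lfloor>real k * f x\<rfloor>"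
    have "\<bar>real k * f x\<bar> \<le> real k * B" using f(2)[of x] that by (simp add: abs_mult)
    also have "\<dots> \<le> real k * of_int \<lceil>B\<rceil>" by (intro mult_left_mono) auto
    also have "\<dots> = of_int (int k * \<lceil>B\<rceil>)" by simp
    finally have "?i \<in> I k" unfolding I_def by (auto simp: floor_le_iff le_floor_iff abs_le_iff)
    then have "g k x = (\<Sum>i\<in>{?i}. (of_int i / real k) * indicat_real {x\<in>space L. \<lfloor>real k * f x\<rfloor> = i} x)"
      unfolding g_def by (intro sum.mono_neutral_right) (auto simp: I_def)
    then have g: "g k x = of_int ?i / real k" using that by simp
    have "\<bar>real k * f x - of_int ?i\<bar> \<le> 1" by linarith
    moreover have "real k * f x - of_int ?i = real k * (f x - g k x)"
      using g that by (simp add: right_diff_distrib)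
    ultimately have "real k * \<bar>f x - g k x\<bar> \<le> 1" by (simp add: abs_mult)
    then show ?thesis using that by (simp add: pos_le_divide_eq mult.commute)
  qed
  have sp: "space (m n) = space L" for n by (rule sets_eq_imp_space_eq[OF sets_m])
  have ig: "integrable M (g k)" "integrable M f"
      "(LINT x|M. g k x) = (\<Sum>i\<in>I k. (of_int i / real k) * measure M {x\<in>space L. \<lfloor>real k * f x\<rfloor> = i})"
    if "finite_measure M" "sets M = sets L" for M k
  proof -
    interpret finite_measure M by fact
    have sM[measurable_cong]: "sets M = sets L" and spM: "space M = space L"
      using that sets_eq_imp_space_eq by auto
    show "integrable M f"
      using f by (intro integrable_const_bound[of _ B]) (auto simp: measurable_cong_sets[OF sM])
    have s: "{x\<in>space L. \<lfloor>real k * f x\<rfloor> = i} \<in> sets M" for i using sM by simp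
    show "integrable M (g k)" unfolding g_def
      using s by (auto intro!: integrable_real_indicator simp: emeasure_eq_measure)
    show "(LINT x|M. g k x) = (\<Sum>i\<in>I k. (of_int i / real k) * measure M {x\<in>space L. \<lfloor>real k * f x\<rfloor> = i})"
      unfolding g_def using s
      by (subst Bochner_Integration.integral_sum) (auto intro!: integrable_real_indicator sum.cong simp: emeasure_eq_measure spM)
  qed
  have cg: "(\<lambda>n. LINT x|m n. g k x) \<longlonglongrightarrow> (LINT x|L. g k x)" for k
    unfolding ig(3)[OF fin(1) sets_m] ig(3)[OF fin(2) refl]
    by (intro tendsto_intros conv S)
  have "(\<lambda>n. measure (m n) (space L)) \<longlonglongrightarrow> measure L (space L)" using conv by simp
  then obtain Mb where Mb: "\<And>n. measure (m n) (space L) \<le> Mb"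
    using convergent_imp_bounded[of "\<lambda>n. measure (m n) (space L)"] by (fastforce simp: bounded_iff)
  \<comment> \<open>One bound for all masses including that of the limit. Being at least 1 it forces
    the \<open>k\<close> chosen below to be positive.\<close>
  define Mc where "Mc = max 1 (max Mb (measure L (space L)))"
  have diff: "\<bar>(LINT x|M. f x) - (LINT x|M. g k x)\<bar> \<le> Mc / real k"
    if "finite_measure M" "sets M = sets L" "measure M (space L) \<le> Mc" "k > 0" for M k
  proof -
    interpret finite_measure M by fact
    have "\<bar>(LINT x|M. f x) - (LINT x|M. g k x)\<bar> = \<bar>LINT x|M. f x - g k x\<bar>"
      using ig[OF that(1,2)] by simp
    also have "\<dots> \<le> (LINT x|M. \<bar>f x - g k x\<bar>)" by (rule integral_abs_bound)
    also have "\<dots> \<le> (LINT x|M. 1 / real k)"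
      using ig[OF that(1,2)] gk that sets_eq_imp_space_eq[OF that(2)] by (intro integral_mono) auto
    also have "\<dots> \<le> Mc / real k"
      using that sets_eq_imp_space_eq[OF that(2)] by (simp add: divide_right_mono)
    finally show ?thesis .
  qed
  show ?thesis
  proof (rule LIMSEQ_I)
    fix r :: real assume "0 < r"
    obtain k :: nat where k: "k > 0" "Mc / real k < r / 4"
    proof -
      obtain k :: nat where "real k > 4 * Mc / r" using reals_Archimedean2 by blast
      then have *: "4 * Mc < real k * r" using \<open>0 < r\<close> by (simp add: field_simps)
      have "Mc \<ge> 1" unfolding Mc_def by simp
      with * have "k > 0" by (auto intro!: Nat.gr0I)
      moreover from * this have "Mc / real k < r / 4" by (simp add: divide_less_eq mult.commute)
      ultimately show ?thesis by (rule that)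
    qed
    obtain no where no: "\<And>n. n \<ge> no \<Longrightarrow> norm ((LINT x|m n. g k x) - (LINT x|L. g k x)) < r / 4"
      using LIMSEQ_D[OF cg[of k], of "r/4"] \<open>0 < r\<close> by auto
    have "norm ((LINT x|m n. f x) - (LINT x|L. f x)) < r" if "n \<ge> no" for n
      using no[OF that] diff[OF fin(1) sets_m _ k(1), of n] diff[OF fin(2) refl _ k(1)] k(2) Mb[of n]
      unfolding Mc_def real_norm_def by linarith
    then show "\<exists>no. \<forall>n\<ge>no. norm ((LINT x|m n. f x) - (LINT x|L. f x)) < r" by blast
  qed
qed

text \<open>On rectangles the product measures converge because both factors do. Domination of the
  products extends the convergence to all product sets, and the limit is
  \<open>L \<Otimes>\<^sub>M L\<close> since both agree on rectangles, which are stable under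
  intersection.\<close>

lemma pair_setwise_tendsto:
  fixes m :: "nat \<Rightarrow> 'a measure"
  assumes "unif_dom_seq N m" and fL: "finite_measure L" and sL: "sets L = sets N"
    and conv: "\<And>A. A \<in> sets N \<Longrightarrow> (\<lambda>n. measure (m n) A) \<longlonglongrightarrow> measure L A"
    and pair: "unif_dom_seq (N \<Otimes>\<^sub>M N) (\<lambda>n. m n \<Otimes>\<^sub>M m n)"
    and A: "A \<in> sets (N \<Otimes>\<^sub>M N)"
  shows "(\<lambda>n. measure (m n \<Otimes>\<^sub>M m n) A) \<longlonglongrightarrow> measure (L \<Otimes>\<^sub>M L) A"
proof -
  interpret unif_dom_seq N m by fact
  interpret pp: unif_dom_seq "N \<Otimes>\<^sub>M N" "\<lambda>n. m n \<Otimes>\<^sub>M m n" by fact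
  interpret L: finite_measure L by fact
  let ?E = "{a \<times> b |a b. a \<in> sets N \<and> b \<in> sets N}"
  have rect: "measure (M \<Otimes>\<^sub>M M) (a \<times> b) = measure M a * measure M b"
    if "finite_measure M" "a \<in> sets M" "b \<in> sets M" for M :: "'a measure" and a b
  proof -
    interpret finite_measure M by fact
    show ?thesis using that emeasure_pair_measure_Times[of a M b]
      by (simp add: measure_def enn2real_mult)
  qed
  have cE: "(\<lambda>n. measure (m n \<Otimes>\<^sub>M m n) X) \<longlonglongrightarrow> measure (L \<Otimes>\<^sub>M L) X" if "X \<in> ?E" for X
  proof -
    from that obtain a b where X: "X = a \<times> b" and ab: "a \<in> sets N" "b \<in> sets N" by blast
    have r: "measure (m n \<Otimes>\<^sub>M m n) X = measure (m n) a * measure (m n) b" for n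
      unfolding X by (rule rect) (use fin sets_m ab in auto)
    have rL: "measure (L \<Otimes>\<^sub>M L) X = measure L a * measure L b"
      unfolding X by (rule rect) (use fL sL ab in auto)
    show ?thesis unfolding r rL by (intro tendsto_mult conv ab)
  qed
  have E: "Int_stable ?E" "?E \<subseteq> Pow (space (N \<Otimes>\<^sub>M N))" "sets (N \<Otimes>\<^sub>M N) = sigma_sets (space (N \<Otimes>\<^sub>M N)) ?E"
    using Int_stable_pair_measure_generator[of N N] pair_measure_closed[where A=N and B=N]
    by (auto simp: space_pair_measure sets_pair_measure)
  have sp: "space (N \<Otimes>\<^sub>M N) \<in> ?E" unfolding space_pair_measure by blast
  have cv: "convergent (\<lambda>n. measure (m n \<Otimes>\<^sub>M m n) X)" if "X \<in> sets (N \<Otimes>\<^sub>M N)" for X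
    by (rule pp.convergent_sets[OF E convergentI[OF cE] convergentI[OF cE[OF sp]] that])
  obtain L2 where L2: "finite_measure L2" "sets L2 = sets (N \<Otimes>\<^sub>M N)"
    "\<And>A. A \<in> sets (N \<Otimes>\<^sub>M N) \<Longrightarrow> (\<lambda>n. measure (m n \<Otimes>\<^sub>M m n) A) \<longlonglongrightarrow> measure L2 A"
    using pp.limit_measure_exists[OF cv] by blast
  interpret L2: finite_measure L2 by fact
  have fLL: "finite_measure (L \<Otimes>\<^sub>M L)"
    using fL by (intro finite_measure_pair_measure)
  interpret LL: finite_measure "L \<Otimes>\<^sub>M L" by fact
  have sLL: "sets (L \<Otimes>\<^sub>M L) = sets (N \<Otimes>\<^sub>M N)" using sL by (intro sets_pair_measure_cong)
  have "L \<Otimes>\<^sub>M L = L2"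
  proof (rule measure_eqI_generator_eq[OF E(1,2), where A="\<lambda>_. space (N \<Otimes>\<^sub>M N)"])
    fix X assume X: "X \<in> ?E"
    then have "X \<in> sets (N \<Otimes>\<^sub>M N)" unfolding E(3) by (rule sigma_sets.Basic)
    then have "measure (L \<Otimes>\<^sub>M L) X = measure L2 X" using LIMSEQ_unique cE[OF X] L2(3) by blast
    then show "emeasure (L \<Otimes>\<^sub>M L) X = emeasure L2 X"
      by (simp add: L2.emeasure_eq_measure LL.emeasure_eq_measure)
  next
    show "sets (L \<Otimes>\<^sub>M L) = sigma_sets (space (N \<Otimes>\<^sub>M N)) ?E" using sLL E(3) by (rule trans)
    show "sets L2 = sigma_sets (space (N \<Otimes>\<^sub>M N)) ?E" using L2(2) E(3) by (rule trans)
    show "range (\<lambda>_. space (N \<Otimes>\<^sub>M N)) \<subseteq> ?E" using sp by blast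
  qed (simp_all add: LL.emeasure_eq_measure)
  then show ?thesis using L2(3)[OF A] by simp
qed

section \<open>Volume distortion of expanding maps\<close>

text \<open>The inverse of \<open>S\<close> is Lipschitz with constant \<open>1 / c\<close>, so the
  preimage of a ball of radius \<open>r\<close> lies in a ball of radius \<open>r / c\<close>.
  Disjoint balls in \<open>U\<close> fill it up to a negligible set by Vitali's theorem, and the
  Lipschitz inverse maps that remainder to a negligible set.\<close>

lemma emeasure_preimage_expanding_open:
  fixes S :: "'a::euclidean_space \<Rightarrow> 'a"
  assumes c: "0 < c" "\<And>v w. c * dist v w \<le> dist (S v) (S w)" and surj: "surj S" and cont: "continuous_on UNIV S"
    and U: "open U"
  shows "emeasure lborel (S -` U) \<le> ennreal (1 / c ^ DIM('a)) * emeasure lborel U"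
proof -
  define k where "k = 1 / c ^ DIM('a)"
  have Sm: "S \<in> borel_measurable borel" using cont by (rule borel_measurable_continuous_onI)
  have Sv: "S -` X \<in> sets borel" if "X \<in> sets borel" for X using measurable_sets_borel[OF Sm that] by simp
  define P where "P = inv S"
  have SP: "S (P y) = y" for y unfolding P_def using surj by (rule surj_f_inv_f)
  have injS: "inj S"
  proof (rule injI)
    fix v w assume "S v = S w"
    then have "c * dist v w \<le> 0" using c(2)[of v w] by simp
    then show "v = w" using c(1) by (simp add: mult_le_0_iff)
  qed
  have PS: "P (S v) = v" for v unfolding P_def using injS by (rule inv_f_f)
  have Pl: "dist (P y) (P y') \<le> (1 / c) * dist y y'" for y y'
    using c(2)[of "P y" "P y'"] c(1) by (simp add: SP field_simps)
  have vim: "S -` X = P ` X" for X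
  proof (intro set_eqI iffI)
    fix v assume "v \<in> S -` X"
    then show "v \<in> P ` X" using PS[of v] by (intro image_eqI[of _ _ "S v"]) auto
  next
    fix v assume "v \<in> P ` X"
    then show "v \<in> S -` X" using SP by auto
  qed
  define K where "K = {(x, r). 0 < r \<and> ball x r \<subseteq> U}"
  have ex: "\<exists>i. i \<in> K \<and> x \<in> ball (fst i) (snd i) \<and> snd i < d" if xU: "x \<in> U" and d: "0 < d" for x d
  proof -
    obtain r where r: "0 < r" "ball x r \<subseteq> U" by (rule openE[OF U xU])
    have "ball x (min r (d/2)) \<subseteq> U" using r(2) subset_ball[of "min r (d/2)" r x] by simp
    then have "(x, min r (d/2)) \<in> K" using r(1) d by (simp add: K_def)
    then show ?thesis using r(1) d by (intro exI[of _ "(x, min r (d/2))"]) simp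
  qed
  \<comment> \<open>The balls of \<open>K\<close> are admissible for Vitali's theorem because
    \<open>ex\<close> provides arbitrarily small ones around every point of
    \<open>U\<close>.\<close>
  obtain C where C: "countable C" "C \<subseteq> K"
    "pairwise (\<lambda>i j. disjnt (ball (fst i) (snd i)) (ball (fst j) (snd j))) C"
    "negligible (U - (\<Union>i\<in>C. ball (fst i) (snd i)))"
    by (rule Vitali_covering_theorem_balls[of U K fst snd, OF ex])
  let ?B = "\<lambda>i :: 'a \<times> real. ball (fst i) (snd i)"
  let ?N = "U - (\<Union>i\<in>C. ?B i)"
  have dj: "disjoint_family_on ?B C" "disjoint_family_on (\<lambda>i. S -` ?B i) C"
    using C(3) unfolding disjoint_family_on_def pairwise_def disjnt_def by blast+
  have neg: "negligible (S -` ?N)"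
    unfolding vim
  proof (rule negligible_locally_Lipschitz_image[OF order_refl C(4)])
    show "\<exists>T B. open T \<and> x \<in> T \<and> (\<forall>y\<in>?N \<inter> T. norm (P y - P x) \<le> B * norm (y - x))" for x
      using Pl by (intro exI[of _ UNIV] exI[of _ "1/c"]) (auto simp: dist_norm)
  qed
  have Uo: "(\<Union>i\<in>C. ?B i) \<in> sets borel" using C(1) by (intro sets.countable_UN') auto
  have Nb: "?N \<in> sets borel" using U Uo by auto
  have null: "emeasure lborel (S -` ?N) = 0"
    using neg Sv[OF Nb] by (simp add: negligible_iff_null_sets null_sets_def)
  have SBi: "S -` ?B i \<in> sets borel" for i by (rule Sv) simp
  have SB: "(\<Union>i\<in>C. S -` ?B i) \<in> sets borel" using C(1) SBi by (intro sets.countable_UN') auto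
  have "emeasure lborel (S -` U) \<le> emeasure lborel ((\<Union>i\<in>C. S -` ?B i) \<union> S -` ?N)"
  proof (rule emeasure_mono)
    show "S -` U \<subseteq> (\<Union>i\<in>C. S -` ?B i) \<union> S -` ?N" by blast
    show "(\<Union>i\<in>C. S -` ?B i) \<union> S -` ?N \<in> sets lborel"
      unfolding sets_lborel by (rule sets.Un[OF SB Sv[OF Nb]])
  qed
  also have "\<dots> \<le> emeasure lborel (\<Union>i\<in>C. S -` ?B i) + emeasure lborel (S -` ?N)"
    by (rule emeasure_subadditive) (simp_all only: sets_lborel SB Sv[OF Nb])
  also have "\<dots> = (\<integral>\<^sup>+i. emeasure lborel (S -` ?B i) \<partial>count_space C)"
    unfolding null add_0_right by (rule emeasure_UN_countable) (use SBi C(1) dj(2) in simp_all)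
  also have "\<dots> \<le> (\<integral>\<^sup>+i. ennreal k * emeasure lborel (?B i) \<partial>count_space C)"
  proof (rule nn_integral_mono)
    fix i assume "i \<in> space (count_space C)"
    then have r: "0 < snd i" using C(2) by (auto simp: K_def)
    have "S -` ?B i \<subseteq> ball (P (fst i)) (snd i / c)"
    proof
      fix v assume "v \<in> S -` ?B i"
      then have "dist (fst i) (S v) < snd i" by simp
      moreover have "c * dist (P (fst i)) v \<le> dist (fst i) (S v)" using c(2)[of "P (fst i)" v] by (simp add: SP)
      ultimately have "c * dist (P (fst i)) v < snd i" by linarith
      then show "v \<in> ball (P (fst i)) (snd i / c)" using c(1) by (simp add: pos_less_divide_eq mult.commute)
    qed
    then have "emeasure lborel (S -` ?B i) \<le> emeasure lborel (ball (P (fst i)) (snd i / c))"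
      by (intro emeasure_mono) auto
    also have "\<dots> = ennreal (unit_ball_vol DIM('a) * (snd i / c) ^ DIM('a))"
      using r c(1) by (intro emeasure_ball) simp
    also have "unit_ball_vol DIM('a) * (snd i / c) ^ DIM('a) = k * (unit_ball_vol DIM('a) * snd i ^ DIM('a))"
      by (simp add: k_def power_divide)
    also have "ennreal \<dots> = ennreal k * emeasure lborel (?B i)"
    proof -
      have "0 \<le> k" using c(1) by (simp add: k_def)
      then show ?thesis using r by (simp only: emeasure_ball[OF less_imp_le[OF r]]) (rule ennreal_mult, simp_all)
    qed
    finally show "emeasure lborel (S -` ?B i) \<le> ennreal k * emeasure lborel (?B i)" .
  qed
  also have "\<dots> = ennreal k * emeasure lborel (\<Union>i\<in>C. ?B i)"
    using C(1) dj(1) by (subst emeasure_UN_countable) (auto simp: nn_integral_cmult)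
  also have "\<dots> \<le> ennreal k * emeasure lborel U"
  proof -
    have "(\<Union>i\<in>C. ?B i) \<subseteq> U"
    proof (rule UN_least)
      fix i assume "i \<in> C"
      then have "i \<in> K" using C(2) by blast
      then show "?B i \<subseteq> U" by (cases i) (simp add: K_def)
    qed
    then show ?thesis using U by (intro mult_left_mono emeasure_mono) auto
  qed
  finally show ?thesis by (simp add: k_def)
qed

lemma emeasure_preimage_expanding:
  fixes S :: "'a::euclidean_space \<Rightarrow> 'a"
  assumes c: "0 < c" "\<And>v w. c * dist v w \<le> dist (S v) (S w)" and surj: "surj S" and cont: "continuous_on UNIV S"
    and A: "A \<in> sets borel"
  shows "emeasure lborel (S -` A) \<le> ennreal (1 / c ^ DIM('a)) * emeasure lborel A"
proof (rule ennreal_le_epsilon)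
  fix e :: real assume "0 < e"
  define k where "k = 1 / c ^ DIM('a)"
  have k: "0 < k" using c(1) by (simp add: k_def)
  have Sm: "S \<in> borel_measurable borel" using cont by (rule borel_measurable_continuous_onI)
  \<comment> \<open>The excess \<open>e / k\<close> becomes \<open>e\<close> after multiplication
    with the distortion factor \<open>k\<close>.\<close>
  obtain U where U: "open U" "A \<subseteq> U" "emeasure lborel (U - A) < ennreal (e / k)"
    using outer_regular_lborel[OF A, of "e / k"] \<open>0 < e\<close> k by auto
  have "emeasure lborel (S -` A) \<le> emeasure lborel (S -` U)"
    using U measurable_sets_borel[OF Sm, of U] by (intro emeasure_mono) auto
  also have "\<dots> \<le> ennreal k * emeasure lborel U"
    unfolding k_def by (rule emeasure_preimage_expanding_open[OF c surj cont U(1)])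
  also have "emeasure lborel U \<le> emeasure lborel A + emeasure lborel (U - A)"
    using emeasure_subadditive[of A lborel "U - A"] A U by (simp add: Un_absorb1)
  also have "\<dots> \<le> emeasure lborel A + ennreal (e / k)" using U(3) by (intro add_left_mono) simp
  also have "ennreal k * \<dots> = ennreal k * emeasure lborel A + ennreal e"
    using k \<open>0 < e\<close> by (simp add: distrib_left ennreal_mult[symmetric])
  finally show "emeasure lborel (S -` A) \<le> ennreal (1 / c ^ DIM('a)) * emeasure lborel A + ennreal e"
    unfolding k_def by (simp add: mult_left_mono)
qed

text \<open>Solving for the preimage of \<open>y\<close> is the fixed point equation of
  \<open>T\<close>, a contraction with constant \<open>h * L / (1 - h)\<close>; this is below 1
  precisely because \<open>h * (1 + L) < 1\<close>.\<close>

lemma kick_surj: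
  fixes b :: "'a::euclidean_space \<Rightarrow> 'a"
  assumes L: "\<And>v w. norm (b v - b w) \<le> L * norm (v - w)" "0 \<le> L" and h: "0 < h" "h * (1 + L) < 1"
  shows "surj (\<lambda>v. (1 - h) *\<^sub>R v + h *\<^sub>R b v)"
  unfolding surj_def
proof
  fix y
  have "0 \<le> h * L" using h(1) L(2) by simp
  then have h1: "h < 1" using h(2) unfolding distrib_left mult_1_right by linarith
  define T where "T v = (1 / (1 - h)) *\<^sub>R (y - h *\<^sub>R b v)" for v
  have "\<exists>!v. v \<in> UNIV \<and> T v = v"
  proof (rule Banach_fix[where c="h * L / (1 - h)"])
    show "h * L / (1 - h) < 1" using h h1 by (simp add: divide_less_eq algebra_simps)
    show "0 \<le> h * L / (1 - h)" using h h1 L(2) by simp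
    fix v w :: 'a
    have "T v - T w = (1 / (1 - h)) *\<^sub>R (h *\<^sub>R (b w - b v))"
      unfolding T_def by (simp add: algebra_simps)
    then have "norm (T v - T w) = h / (1 - h) * norm (b v - b w)"
      using h h1 by (simp add: norm_minus_commute)
    also have "\<dots> \<le> h / (1 - h) * (L * norm (v - w))" using h h1 L by (intro mult_left_mono) auto
    finally show "dist (T v) (T w) \<le> h * L / (1 - h) * dist v w" by (simp add: dist_norm)
  qed (auto simp: complete_UNIV)
  then obtain v where "T v = v" by blast
  then have "(1 - h) *\<^sub>R T v = (1 - h) *\<^sub>R v" by simp
  then have "y - h *\<^sub>R b v = (1 - h) *\<^sub>R v" using h1 by (simp add: T_def)
  then have "(1 - h) *\<^sub>R v + h *\<^sub>R b v = y" by (simp add: algebra_simps)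
  then show "\<exists>v. y = (1 - h) *\<^sub>R v + h *\<^sub>R b v" by blast
qed

text \<open>The linear part scales distances by \<open>1 - h\<close> and the Lipschitz part can
  reduce them by at most \<open>h * L\<close> more, so distances shrink at most by the factor
  \<open>1 - h * (1 + L)\<close>.\<close>

lemma emeasure_kick_preimage:
  fixes b :: "'a::euclidean_space \<Rightarrow> 'a"
  assumes L: "\<And>v w. norm (b v - b w) \<le> L * norm (v - w)" "0 \<le> L" and h: "0 < h" "h * (1 + L) < 1"
    and A: "A \<in> sets borel"
  shows "emeasure lborel ((\<lambda>v. (1 - h) *\<^sub>R v + h *\<^sub>R b v) -` A) \<le> ennreal (1 / (1 - h * (1 + L)) ^ DIM('a)) * emeasure lborel A"
proof (rule emeasure_preimage_expanding[OF _ _ kick_surj[OF L h] _ A])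
  have "0 \<le> h * L" using h(1) L(2) by simp
  then have h1: "h \<le> 1" using h(2) unfolding distrib_left mult_1_right by linarith
  show "0 < 1 - h * (1 + L)" using h by simp
  fix v w
  have "norm ((1 - h) *\<^sub>R (v - w)) \<le> norm (((1 - h) *\<^sub>R v + h *\<^sub>R b v) - ((1 - h) *\<^sub>R w + h *\<^sub>R b w)) + norm (h *\<^sub>R (b v - b w))"
    by (rule order_trans[OF _ norm_triangle_ineq4]) (simp add: algebra_simps)
  moreover have "norm (h *\<^sub>R (b v - b w)) \<le> h * (L * norm (v - w))" using L h by simp
  moreover have "norm ((1 - h) *\<^sub>R (v - w)) = (1 - h) * norm (v - w)" using h1 by simp
  ultimately show "(1 - h * (1 + L)) * dist v w \<le> dist ((1 - h) *\<^sub>R v + h *\<^sub>R b v) ((1 - h) *\<^sub>R w + h *\<^sub>R b w)"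
    by (simp add: dist_norm algebra_simps)
next
  have "L-lipschitz_on UNIV b" using L by (intro lipschitz_onI) (auto simp: dist_norm)
  then have "continuous_on UNIV b" by (rule lipschitz_on_continuous_on)
  then show "continuous_on UNIV (\<lambda>v. (1 - h) *\<^sub>R v + h *\<^sub>R b v)" by (intro continuous_intros)
qed

section \<open>The time-discrete scheme\<close>

text \<open>The Lipschitz condition in the velocity holds only almost everywhere, for each fixed shift. This suffices
  because \<open>F\<close> is only ever integrated against measures with bounded density.\<close>
locale mean_field =
  fixes F :: "phase \<Rightarrow> real^2" and g :: "real^2 \<Rightarrow> real^2" and BF Bg L K0 :: real
    and mu0 :: "phase measure"
  assumes F_m [measurable]: "F \<in> borel_measurable borel" and F_b: "\<And>z. norm (F z) \<le> BF"
    and F_l: "\<And>e. AE z in lborel. norm (F (fst z, snd z + e) - F z) \<le> L * norm e" and L_nonneg: "0 \<le> L"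
    and g_m [measurable]: "g \<in> borel_measurable borel" and g_b: "\<And>x. norm (g x) \<le> Bg"
    and sets_mu0: "sets mu0 = sets borel" and fin_mu0: "finite_measure mu0"
    and dens_mu0: "\<And>A. A \<in> sets borel \<Longrightarrow> emeasure mu0 A \<le> ennreal K0 * emeasure lborel A" and K0_nonneg: "0 \<le> K0"
    and mom_mu0: "integrable mu0 (\<lambda>z. (norm z)\<^sup>2)"
begin

definition M :: real where "M = measure mu0 UNIV"
definition accel_bound :: real where "accel_bound = Bg + BF * M"
text \<open>The 1 accounts for the friction term \<open>- v\<close>, the product
  \<open>L * M\<close> for the interaction with a measure of mass \<open>M\<close>.\<close>

definition accel_lip :: real where "accel_lip = 1 + L * M"

text \<open>The friction \<open>- v\<close> of the acceleration is left out here and enters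
  \<open>kick\<close> through the factor \<open>1 - h\<close>. The new velocity is then a convex
  combination for \<open>h \<le> 1\<close>.\<close>

definition accel_field :: "phase measure \<Rightarrow> phase \<Rightarrow> real^2" where
  "accel_field mu z = g (fst z) + (LINT y|mu. F (z - y))"

definition kick :: "phase measure \<Rightarrow> real \<Rightarrow> phase \<Rightarrow> phase" where
  "kick mu h z = (fst z, (1 - h) *\<^sub>R snd z + h *\<^sub>R accel_field mu z)"

definition shear :: "real \<Rightarrow> phase \<Rightarrow> phase" where
  "shear h z = (fst z + h *\<^sub>R snd z, snd z)"

definition step :: "phase measure \<Rightarrow> real \<Rightarrow> phase \<Rightarrow> phase" where
  "step mu h z = shear h (kick mu h z)"

primrec scheme :: "real \<Rightarrow> nat \<Rightarrow> phase measure" where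
  "scheme h 0 = mu0"
| "scheme h (Suc k) = distr (scheme h k) borel (step (scheme h k) h)"

text \<open>The invariants of the scheme. The density bound is an inequality between measures, so it
  passes to image measures and to setwise limits without any choice of densities.\<close>

definition admissible :: "real \<Rightarrow> phase measure \<Rightarrow> bool" where
  "admissible c mu \<longleftrightarrow> sets mu = sets borel \<and> finite_measure mu \<and> measure mu UNIV = M \<and> 0 \<le> c \<and>
     (\<forall>A\<in>sets borel. emeasure mu A \<le> ennreal c * emeasure lborel A)"

lemma admissible_mu0: "admissible K0 mu0"
  using sets_mu0 fin_mu0 dens_mu0 K0_nonneg by (simp add: admissible_def M_def)

lemma M_nonneg: "0 \<le> M" and BF_nonneg: "0 \<le> BF" and Bg_nonneg: "0 \<le> Bg" and accel_bound_nonneg: "0 \<le> accel_bound" and accel_lip_ge: "1 \<le> accel_lip"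
proof -
  show M: "0 \<le> M" by (simp add: M_def)
  show BF: "0 \<le> BF" using F_b[of 0] norm_ge_zero order_trans by blast
  show Bg: "0 \<le> Bg" using g_b[of 0] norm_ge_zero order_trans by blast
  show "0 \<le> accel_bound" using M BF Bg by (simp add: accel_bound_def)
  show "1 \<le> accel_lip" using M L_nonneg by (simp add: accel_lip_def)
qed

lemma admissible_sets: "admissible c mu \<Longrightarrow> sets mu = sets borel" and admissible_finite: "admissible c mu \<Longrightarrow> finite_measure mu"
  and admissible_mass: "admissible c mu \<Longrightarrow> measure mu UNIV = M" and admissible_nonneg: "admissible c mu \<Longrightarrow> 0 \<le> c"
  and admissible_dens: "admissible c mu \<Longrightarrow> A \<in> sets borel \<Longrightarrow> emeasure mu A \<le> ennreal c * emeasure lborel A"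
  by (auto simp: admissible_def)

lemma admissible_space: "admissible c mu \<Longrightarrow> space mu = UNIV"
  using sets_eq_imp_space_eq[OF admissible_sets] by simp

lemma admissible_measurable: "admissible c mu \<Longrightarrow> f \<in> measurable borel N \<Longrightarrow> f \<in> measurable mu N"
  using measurable_cong_sets[OF admissible_sets refl] by blast

lemma admissible_AE:
  assumes mu: "admissible c mu" and P: "AE z in lborel. P z" shows "AE z in mu. P z"
proof -
  obtain N where N: "{z \<in> space lborel. \<not> P z} \<subseteq> N" "emeasure lborel N = 0" "N \<in> sets lborel"
    using P by (rule AE_E)
  have "emeasure mu N = 0" using admissible_dens[OF mu, of N] N by simp
  then show ?thesis using N admissible_sets[OF mu] by (intro AE_I[of _ _ N]) auto
qed

lemma admissible_integrable_bounded:
  fixes f :: "phase \<Rightarrow> 'b::{banach, second_countable_topology}"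
  assumes mu: "admissible c mu" and f: "f \<in> borel_measurable borel" "\<And>z. norm (f z) \<le> B"
  shows "integrable mu f" "norm (LINT z|mu. f z) \<le> B * M"
proof -
  interpret finite_measure mu by (rule admissible_finite[OF mu])
  show i: "integrable mu f"
    by (rule integrable_const_bound[of _ B]) (use f admissible_measurable[OF mu] in auto)
  have "norm (LINT z|mu. f z) \<le> (LINT z|mu. norm (f z))" by (rule integral_norm_bound)
  also have "\<dots> \<le> (LINT z|mu. B)" by (rule integral_mono) (use i f in auto)
  also have "\<dots> = B * M" using admissible_mass[OF mu] admissible_space[OF mu] by simp
  finally show "norm (LINT z|mu. f z) \<le> B * M" .
qed

lemma F_shift_measurable: "(\<lambda>y. F (z - y)) \<in> borel_measurable borel"
proof -
  have "(\<lambda>y. z - y) \<in> borel_measurable borel" by simp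
  from measurable_compose[OF this F_m] show ?thesis .
qed

lemma accel_field_measurable: assumes mu: "admissible c mu" shows "accel_field mu \<in> borel_measurable borel"
proof -
  interpret finite_measure mu by (rule admissible_finite[OF mu])
  have s: "sets (borel \<Otimes>\<^sub>M mu) = sets (borel :: (phase \<times> phase) measure)"
  proof -
    have "sets (borel \<Otimes>\<^sub>M mu) = sets ((borel :: phase measure) \<Otimes>\<^sub>M (borel :: phase measure))"
      by (rule sets_pair_measure_cong[OF refl admissible_sets[OF mu]])
    also have "\<dots> = sets (borel :: (phase \<times> phase) measure)" by (rule arg_cong[where f=sets], rule borel_prod)
    finally show ?thesis .
  qed
  have "(\<lambda>p :: phase \<times> phase. fst p - snd p) \<in> borel_measurable borel"
    by (intro borel_measurable_continuous_onI continuous_intros)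
  from measurable_compose[OF this F_m]
  have "(\<lambda>p. F (fst p - snd p)) \<in> borel_measurable (borel \<Otimes>\<^sub>M mu)"
    using measurable_cong_sets[OF s refl] by blast
  then have "(\<lambda>z. LINT y|mu. F (z - y)) \<in> borel_measurable borel"
    by (intro borel_measurable_lebesgue_integral) (simp add: case_prod_beta')
  moreover have "(\<lambda>z::phase. g (fst z)) \<in> borel_measurable borel"
    by (rule measurable_compose[OF _ g_m]) (intro borel_measurable_continuous_onI continuous_intros)
  ultimately have "(\<lambda>z. accel_field mu z) \<in> borel_measurable borel" unfolding accel_field_def by (intro borel_measurable_add)
  then show ?thesis by simp
qed

lemma conv_bound: "admissible c mu \<Longrightarrow> norm (LINT y|mu. F (z - y)) \<le> BF * M"
  by (rule admissible_integrable_bounded(2)[OF _ F_shift_measurable F_b])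

lemma accel_field_bound: assumes mu: "admissible c mu" shows "norm (accel_field mu z) \<le> accel_bound"
  unfolding accel_field_def accel_bound_def by (rule norm_triangle_le[OF add_mono[OF g_b conv_bound[OF mu]]])

text \<open>For the fixed shift \<open>v - w\<close> the difference of \<open>F\<close> is
  controlled off a null set. Its reflection through \<open>(x, w)\<close> is again null and is not
  charged by \<open>mu\<close>, so after integration the estimate holds for every pair of
  velocities.\<close>

lemma accel_field_lipschitz:
  assumes mu: "admissible c mu" shows "norm (accel_field mu (x, v) - accel_field mu (x, w)) \<le> L * M * norm (v - w)"
proof -
  interpret finite_measure mu by (rule admissible_finite[OF mu])
  have i: "integrable mu (\<lambda>y. F (z - y))" for z
    by (rule admissible_integrable_bounded(1)[OF mu F_shift_measurable F_b])
  have "AE y in lborel. norm (F ((x, v) - y) - F ((x, w) - y)) \<le> L * norm (v - w)"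
  proof -
    let ?P = "\<lambda>z. norm (F (fst z, snd z + (v - w)) - F z) \<le> L * norm (v - w)"
    \<comment> \<open>The reflection is an affine map of determinant of modulus 1, so it preserves
      Lebesgue measure.\<close>
    have eq: "lborel = density (distr lborel borel (\<lambda>y. (x, w) + (-1) *\<^sub>R y)) (\<lambda>_. ennreal (\<bar>-1\<bar> ^ DIM(phase)))"
      by (rule lborel_affine) simp
    have "AE z in density (distr lborel borel (\<lambda>y. (x, w) + (-1) *\<^sub>R y)) (\<lambda>_. ennreal (\<bar>-1\<bar> ^ DIM(phase))). ?P z"
      unfolding eq[symmetric] by (rule F_l)
    then have "AE z in distr lborel borel (\<lambda>y. (x, w) + (-1) *\<^sub>R y). ?P z"
      by (subst (asm) AE_density) simp_all
    then have "AE y in lborel. ?P ((x, w) + (-1) *\<^sub>R y)" by (rule AE_distrD[rotated]) simp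
    moreover have "?P ((x, w) + (-1) *\<^sub>R y) \<longleftrightarrow> norm (F ((x, v) - y) - F ((x, w) - y)) \<le> L * norm (v - w)" for y
    proof -
      have "(x, w) + (-1) *\<^sub>R y = (x, w) - y" by simp
      moreover have "(fst ((x, w) - y), snd ((x, w) - y) + (v - w)) = (x, v) - y" by (cases y) simp
      ultimately show ?thesis by (simp only:)
    qed
    ultimately show ?thesis by (simp only:)
  qed
  then have ae: "AE y in mu. norm (F ((x, v) - y) - F ((x, w) - y)) \<le> L * norm (v - w)" by (rule admissible_AE[OF mu])
  have "accel_field mu (x, v) - accel_field mu (x, w) = (LINT y|mu. F ((x, v) - y) - F ((x, w) - y))"
    unfolding accel_field_def using i by (simp add: Bochner_Integration.integral_diff)
  also have "norm \<dots> \<le> (LINT y|mu. norm (F ((x, v) - y) - F ((x, w) - y)))" by (rule integral_norm_bound)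
  also have "\<dots> \<le> (LINT y|mu. L * norm (v - w))"
    by (rule integral_mono_AE) (use i ae in auto)
  also have "\<dots> = L * M * norm (v - w)" using admissible_mass[OF mu] admissible_space[OF mu] by simp
  finally show ?thesis .
qed

section \<open>Growth of the density in one step\<close>

lemma phase_maps_measurable:
  "(fst :: phase \<Rightarrow> real^2) \<in> borel_measurable borel" "(snd :: phase \<Rightarrow> real^2) \<in> borel_measurable borel"
  by (intro borel_measurable_continuous_onI continuous_intros)+

lemma kick_measurable: assumes "admissible c mu" shows "kick mu h \<in> borel_measurable borel"
proof -
  have "(\<lambda>z. kick mu h z) \<in> borel_measurable borel" unfolding kick_def
    by (intro borel_measurable_Pair borel_measurable_add borel_measurable_scaleR borel_measurable_const
        phase_maps_measurable accel_field_measurable[OF assms])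
  then show ?thesis by simp
qed

lemma shear_measurable: "shear h \<in> borel_measurable borel"
proof -
  have "continuous_on UNIV (\<lambda>z. shear h z)" unfolding shear_def by (intro continuous_intros)
  then show ?thesis using borel_measurable_continuous_onI by simp
qed

lemma step_measurable: assumes "admissible c mu" shows "step mu h \<in> borel_measurable borel"
proof -
  have "(\<lambda>z. step mu h z) \<in> borel_measurable borel" unfolding step_def
    by (rule measurable_compose[OF kick_measurable[OF assms] shear_measurable])
  then show ?thesis by simp
qed

lemma emeasure_phase_fubini:
  fixes A :: "phase set" assumes "A \<in> sets borel"
  shows "emeasure lborel A = (\<integral>\<^sup>+x. emeasure lborel {v. (x, v) \<in> A} \<partial>lborel)"
    and "emeasure lborel A = (\<integral>\<^sup>+v. emeasure lborel {x. (x, v) \<in> A} \<partial>lborel)"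
    and "{v. (x, v) \<in> A} \<in> sets borel" "{x. (x, v) \<in> A} \<in> sets borel"
proof -
  have A: "A \<in> sets (lborel \<Otimes>\<^sub>M lborel)" using assms unfolding lborel_prod by simp
  have e: "emeasure lborel A = emeasure (lborel \<Otimes>\<^sub>M lborel) A" unfolding lborel_prod ..
  have v: "Pair x -` A = {v. (x, v) \<in> A}" "(\<lambda>x. (x, v)) -` A = {x. (x, v) \<in> A}" for x v by auto
  show "emeasure lborel A = (\<integral>\<^sup>+x. emeasure lborel {v. (x, v) \<in> A} \<partial>lborel)"
    unfolding e using lborel.emeasure_pair_measure_alt[OF A] unfolding v .
  show "emeasure lborel A = (\<integral>\<^sup>+v. emeasure lborel {x. (x, v) \<in> A} \<partial>lborel)"
    unfolding e using lborel_pair.emeasure_pair_measure_alt2[OF A] unfolding v .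
  show "{v. (x, v) \<in> A} \<in> sets borel" using sets_Pair1[OF A, of x] unfolding v by simp
  show "{x. (x, v) \<in> A} \<in> sets borel" using sets_Pair2[OF A, of v] unfolding v by simp
qed

text \<open>For fixed \<open>v\<close> the slice in \<open>x\<close> is translated by
  \<open>h v\<close>, so each slice keeps its measure.\<close>

lemma emeasure_shear:
  assumes A: "A \<in> sets borel" shows "emeasure lborel (shear h -` A) = emeasure lborel A"
proof -
  have sA: "shear h -` A \<in> sets borel" using measurable_sets_borel[OF shear_measurable A] by simp
  have "emeasure lborel {x. (x, v) \<in> shear h -` A} = emeasure lborel {x. (x, v) \<in> A}" for v
  proof -
    have "emeasure lborel {x. (x, v) \<in> A} = emeasure (distr lborel borel ((+) (h *\<^sub>R v))) {x. (x, v) \<in> A}"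
      unfolding lborel_distr_plus ..
    also have "\<dots> = emeasure lborel ((+) (h *\<^sub>R v) -` {x. (x, v) \<in> A})"
      using emeasure_phase_fubini(4)[OF A] by (subst emeasure_distr) auto
    also have "(+) (h *\<^sub>R v) -` {x. (x, v) \<in> A} = {x. (x, v) \<in> shear h -` A}"
      by (auto simp: shear_def add.commute)
    finally show ?thesis ..
  qed
  then show ?thesis by (subst (1 2) emeasure_phase_fubini(2)) (auto simp: A sA)
qed

text \<open>For fixed \<open>x\<close> the slice is a preimage under the map of
  \<open>emeasure_kick_preimage\<close> in the velocity plane; the exponent 2 is the dimension of
  that plane. Regularity of the field in \<open>x\<close> beyond measurability never enters.\<close>

lemma emeasure_kick:
  assumes mu: "admissible c mu" and h: "0 < h" "h * accel_lip < 1" and A: "A \<in> sets borel"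
  shows "emeasure lborel (kick mu h -` A) \<le> ennreal (1 / (1 - h * accel_lip)\<^sup>2) * emeasure lborel A"
proof -
  have sA: "kick mu h -` A \<in> sets borel" using measurable_sets_borel[OF kick_measurable[OF mu] A] by simp
  have "emeasure lborel {v. (x, v) \<in> kick mu h -` A} \<le> ennreal (1 / (1 - h * accel_lip)\<^sup>2) * emeasure lborel {v. (x, v) \<in> A}" for x
  proof -
    have "{v. (x, v) \<in> kick mu h -` A} = (\<lambda>v. (1 - h) *\<^sub>R v + h *\<^sub>R accel_field mu (x, v)) -` {v. (x, v) \<in> A}"
      by (auto simp: kick_def)
    then show ?thesis
      using emeasure_kick_preimage[of "\<lambda>v. accel_field mu (x, v)" "L * M" h "{v. (x, v) \<in> A}", OF accel_field_lipschitz[OF mu]]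
        L_nonneg M_nonneg h emeasure_phase_fubini(3)[OF A] by (simp add: accel_lip_def)
  qed
  then have "emeasure lborel (kick mu h -` A) \<le> (\<integral>\<^sup>+x. ennreal (1 / (1 - h * accel_lip)\<^sup>2) * emeasure lborel {v. (x, v) \<in> A} \<partial>lborel)"
    unfolding emeasure_phase_fubini(1)[OF sA] by (intro nn_integral_mono)
  also have "\<dots> = ennreal (1 / (1 - h * accel_lip)\<^sup>2) * emeasure lborel A"
    unfolding emeasure_phase_fubini(1)[OF A]
  proof (rule nn_integral_cmult)
    have "A \<in> sets (lborel \<Otimes>\<^sub>M lborel)" using A unfolding lborel_prod by simp
    from lborel.measurable_emeasure_Pair[OF this]
    show "(\<lambda>x. emeasure lborel {v. (x, v) \<in> A}) \<in> borel_measurable lborel" by (simp add: vimage_def)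
  qed
  finally show ?thesis .
qed

lemma admissible_step:
  assumes mu: "admissible c mu" and h: "0 < h" "h * accel_lip < 1"
  shows "admissible (c * (1 / (1 - h * accel_lip)\<^sup>2)) (distr mu borel (step mu h))"
proof -
  let ?d = "distr mu borel (step mu h)"
  interpret finite_measure mu by (rule admissible_finite[OF mu])
  have m: "step mu h \<in> measurable mu borel" by (rule admissible_measurable[OF mu step_measurable[OF mu]])
  have c: "0 \<le> c" by (rule admissible_nonneg[OF mu])
  have "emeasure ?d A \<le> ennreal (c * (1 / (1 - h * accel_lip)\<^sup>2)) * emeasure lborel A" if A: "A \<in> sets borel" for A
  proof -
    have vA: "step mu h -` A = kick mu h -` (shear h -` A)" by (auto simp: step_def)
    have sA: "shear h -` A \<in> sets borel" using measurable_sets_borel[OF shear_measurable A] by simp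
    have "emeasure ?d A = emeasure mu (step mu h -` A)"
      using A m admissible_space[OF mu] by (simp add: emeasure_distr)
    also have "\<dots> \<le> ennreal c * emeasure lborel (step mu h -` A)"
      by (rule admissible_dens[OF mu]) (use measurable_sets_borel[OF step_measurable[OF mu] A] in simp)
    also have "\<dots> \<le> ennreal c * (ennreal (1 / (1 - h * accel_lip)\<^sup>2) * emeasure lborel (shear h -` A))"
      unfolding vA by (intro mult_left_mono emeasure_kick[OF mu h sA]) simp
    also have "\<dots> = ennreal (c * (1 / (1 - h * accel_lip)\<^sup>2)) * emeasure lborel A"
    proof -
      have "ennreal (c * (1 / (1 - h * accel_lip)\<^sup>2)) = ennreal c * ennreal (1 / (1 - h * accel_lip)\<^sup>2)"
        by (rule ennreal_mult[OF c]) simp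
      then show ?thesis by (simp only: emeasure_shear[OF A] mult.assoc)
    qed
    finally show ?thesis .
  qed
  moreover have "measure ?d UNIV = M"
    using m admissible_space[OF mu] admissible_mass[OF mu] by (simp add: measure_distr)
  moreover have "finite_measure ?d" by (rule finite_measure_distr[OF m])
  ultimately show ?thesis unfolding admissible_def using c by auto
qed

text \<open>Makes the growth factors of successive steps accumulate to an exponential of the elapsed
  time. For \<open>y \<le> 1/2\<close> one has
  \<open>ln (1 - y) \<ge> - y - 2 * y^2 \<ge> - 2 * y\<close>, and the square doubles the
  exponent.\<close>

lemma inverse_square_le_exp:
  assumes "0 \<le> y" "y \<le> 1 / 2" shows "1 / (1 - y)\<^sup>2 \<le> exp (4 * y :: real)"
proof -
  have "- (2 * y) \<le> - y - 2 * y\<^sup>2" using assms mult_left_mono[of y "1/2" y] by (simp add: power2_eq_square)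
  also have "\<dots> \<le> ln (1 - y)" by (rule ln_one_minus_pos_lower_bound[OF assms])
  finally have "exp (- (2 * y)) \<le> 1 - y" using assms by (simp add: ln_ge_iff)
  then have "(exp (- (2 * y)))\<^sup>2 \<le> (1 - y)\<^sup>2" by (intro power_mono) auto
  then have "exp (- (4 * y)) \<le> (1 - y)\<^sup>2" by (simp add: power2_eq_square exp_add[symmetric])
  then have "inverse ((1 - y)\<^sup>2) \<le> inverse (exp (- (4 * y)))" by (intro le_imp_inverse_le) auto
  then show ?thesis by (simp add: exp_minus inverse_eq_divide)
qed

lemma admissible_mono: "admissible c mu \<Longrightarrow> c \<le> c' \<Longrightarrow> admissible c' mu"
proof -
  assume mu: "admissible c mu" and c: "c \<le> c'"
  have "emeasure mu A \<le> ennreal c' * emeasure lborel A" if "A \<in> sets borel" for A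
    using admissible_dens[OF mu that] mult_right_mono[OF ennreal_leI[OF c], of "emeasure lborel A"] by (rule order_trans) simp
  then show ?thesis using mu c unfolding admissible_def by auto
qed

text \<open>\<open>h \<le> 1\<close> makes the kick a convex combination, and the last condition is
  the range of \<open>inverse_square_le_exp\<close>.\<close>

definition small_step :: "real \<Rightarrow> bool" where "small_step h \<longleftrightarrow> 0 < h \<and> h \<le> 1 \<and> h * accel_lip \<le> 1 / 2"

lemma admissible_scheme: assumes h: "small_step h" shows "admissible (K0 * exp (4 * accel_lip * (real k * h))) (scheme h k)"
proof (induction k)
  case 0 then show ?case using admissible_mu0 by simp
next
  case (Suc k)
  have step_size: "0 < h" "h * accel_lip < 1" "h * accel_lip \<le> 1 / 2" using h by (auto simp: small_step_def)
  have "0 \<le> h * accel_lip" using step_size accel_lip_ge by simp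
  have "K0 * exp (4 * accel_lip * (real k * h)) * (1 / (1 - h * accel_lip)\<^sup>2) \<le> K0 * exp (4 * accel_lip * (real k * h)) * exp (4 * (h * accel_lip))"
    using inverse_square_le_exp[OF \<open>0 \<le> h * accel_lip\<close> step_size(3)] K0_nonneg by (intro mult_left_mono) auto
  also have "\<dots> = K0 * exp (4 * accel_lip * (real (Suc k) * h))"
    by (simp add: mult.assoc exp_add[symmetric] algebra_simps)
  finally show ?case using admissible_mono[OF admissible_step[OF Suc step_size(1,2)]] by simp
qed

end

section \<open>Moment bounds\<close>

lemma norm_phase_sq: "(norm z)\<^sup>2 = (norm (fst z))\<^sup>2 + (norm (snd z))\<^sup>2" for z :: phase
  by (simp add: norm_prod_def)

lemma le_one_plus_square: "0 \<le> x \<Longrightarrow> x \<le> 1 + x\<^sup>2" for x :: real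
  using zero_le_power2[of "x - 1"] unfolding power2_diff by simp

lemma norm_convex_sq:
  fixes v b :: "'a::real_normed_vector"
  assumes "0 \<le> h" "h \<le> 1"
  shows "(norm ((1 - h) *\<^sub>R v + h *\<^sub>R b))\<^sup>2 \<le> (1 - h) * (norm v)\<^sup>2 + h * (norm b)\<^sup>2"
proof -
  have "norm ((1 - h) *\<^sub>R v + h *\<^sub>R b) \<le> (1 - h) * norm v + h * norm b"
    using assms by (intro norm_triangle_le) simp
  then have "(norm ((1 - h) *\<^sub>R v + h *\<^sub>R b))\<^sup>2 \<le> ((1 - h) * norm v + h * norm b)\<^sup>2"
    by (rule power_mono) simp
  also have "\<dots> = (1 - h) * (norm v)\<^sup>2 + h * (norm b)\<^sup>2 - h * (1 - h) * (norm v - norm b)\<^sup>2"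
    by (simp add: power2_eq_square algebra_simps)
  also have "\<dots> \<le> (1 - h) * (norm v)\<^sup>2 + h * (norm b)\<^sup>2" using assms by simp
  finally show ?thesis .
qed

context mean_field
begin

text \<open>The displacement of one step divided by \<open>h\<close>. The first component is the
  velocity after the kick, because positions move last.\<close>

definition velocity_field :: "phase measure \<Rightarrow> real \<Rightarrow> phase \<Rightarrow> phase" where
  "velocity_field mu h z = ((1 - h) *\<^sub>R snd z + h *\<^sub>R accel_field mu z, accel_field mu z - snd z)"

lemma step_eq: "step mu h z = z + h *\<^sub>R velocity_field mu h z"
  by (cases z) (simp add: step_def shear_def kick_def velocity_field_def algebra_simps)

lemma new_v_sq:
  assumes "admissible c mu" "0 \<le> h" "h \<le> 1"
  shows "(norm ((1 - h) *\<^sub>R snd z + h *\<^sub>R accel_field mu z))\<^sup>2 \<le> (1 - h) * (norm (snd z))\<^sup>2 + h * accel_bound\<^sup>2"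
proof -
  have "(norm (accel_field mu z))\<^sup>2 \<le> accel_bound\<^sup>2" by (rule power_mono[OF accel_field_bound[OF assms(1)]]) simp
  then have "h * (norm (accel_field mu z))\<^sup>2 \<le> h * accel_bound\<^sup>2" using assms(2) by (rule mult_left_mono)
  with norm_convex_sq[OF assms(2,3), of "snd z" "accel_field mu z"] show ?thesis by linarith
qed

text \<open>Convexity bounds the position part by \<open>|v|^2 + accel_bound^2\<close>, and the
  velocity part is at most twice this sum, which explains the factor 3.\<close>

lemma velocity_field_bound:
  assumes mu: "admissible c mu" and h: "0 \<le> h" "h \<le> 1"
  shows "(norm (velocity_field mu h z))\<^sup>2 \<le> 3 * (norm (snd z))\<^sup>2 + 3 * accel_bound\<^sup>2"
proof -
  let ?v = "norm (snd z)"
  have "h * accel_bound\<^sup>2 \<le> 1 * accel_bound\<^sup>2" "(1 - h) * ?v\<^sup>2 \<le> 1 * ?v\<^sup>2" using h by (intro mult_right_mono; simp)+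
  then have 1: "(norm ((1 - h) *\<^sub>R snd z + h *\<^sub>R accel_field mu z))\<^sup>2 \<le> ?v\<^sup>2 + accel_bound\<^sup>2"
    using new_v_sq[OF mu h, of z] by linarith
  have "norm (accel_field mu z - snd z) \<le> accel_bound + ?v" using norm_triangle_ineq4[of "accel_field mu z" "snd z"] accel_field_bound[OF mu, of z] by linarith
  then have "(norm (accel_field mu z - snd z))\<^sup>2 \<le> (accel_bound + ?v)\<^sup>2" by (rule power_mono) simp
  also have "\<dots> \<le> 2 * ?v\<^sup>2 + 2 * accel_bound\<^sup>2"
    using zero_le_power2[of "accel_bound - ?v"] by (simp add: power2_eq_square algebra_simps)
  finally show ?thesis using 1 by (simp add: velocity_field_def norm_phase_sq)
qed

text \<open>With \<open>n = norm z\<close> and \<open>d\<close> the norm of the velocity field, the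
  step estimate needs \<open>n^2 + 2 * d^2\<close>. Inserting
  \<open>d^2 \<le> 3 * n^2 + 3 * accel_bound^2\<close> gives the coefficients 7 and 6.\<close>

definition moment_rate :: real where "moment_rate = 7 + 6 * accel_bound\<^sup>2"

lemma weight_step:
  assumes mu: "admissible c mu" and h: "0 \<le> h" "h \<le> 1"
  shows "1 + (norm (step mu h z))\<^sup>2 \<le> (1 + moment_rate * h) * (1 + (norm z)\<^sup>2)"
proof -
  let ?d = "norm (velocity_field mu h z)" and ?n = "norm z"
  have d: "?d\<^sup>2 \<le> 3 * ?n\<^sup>2 + 3 * accel_bound\<^sup>2"
    using velocity_field_bound[OF mu h, of z] norm_phase_sq[of z] zero_le_power2[of "norm (fst z)"] by linarith
  have "norm (step mu h z) \<le> ?n + h * ?d" unfolding step_eq using h by (intro norm_triangle_le) simp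
  then have "(norm (step mu h z))\<^sup>2 \<le> (?n + h * ?d)\<^sup>2" by (rule power_mono) simp
  also have "\<dots> = ?n\<^sup>2 + h * (2 * ?n * ?d) + (h * h) * ?d\<^sup>2" by (simp add: power2_eq_square algebra_simps)
  also have "\<dots> \<le> ?n\<^sup>2 + h * (?n\<^sup>2 + ?d\<^sup>2) + h * ?d\<^sup>2"
  proof (intro add_mono mult_left_mono mult_right_mono)
    show "2 * ?n * ?d \<le> ?n\<^sup>2 + ?d\<^sup>2" using zero_le_power2[of "?n - ?d"] by (simp add: power2_eq_square algebra_simps)
    show "h * h \<le> h" using h mult_left_mono[of h 1 h] by simp
  qed (use h in auto)
  also have "\<dots> = ?n\<^sup>2 + h * (?n\<^sup>2 + 2 * ?d\<^sup>2)" by (simp add: algebra_simps)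
  also have "\<dots> \<le> ?n\<^sup>2 + h * (moment_rate * (1 + ?n\<^sup>2))"
  proof (intro add_left_mono mult_left_mono h(1))
    have "?n\<^sup>2 + 2 * ?d\<^sup>2 \<le> 7 * ?n\<^sup>2 + 6 * accel_bound\<^sup>2" using d by linarith
    also have "\<dots> \<le> moment_rate * (1 + ?n\<^sup>2)" unfolding moment_rate_def by (simp add: algebra_simps)
    finally show "?n\<^sup>2 + 2 * ?d\<^sup>2 \<le> moment_rate * (1 + ?n\<^sup>2)" .
  qed
  finally show ?thesis by (simp add: algebra_simps)
qed

definition initial_moment :: real where "initial_moment = (LINT z|mu0. 1 + (norm z)\<^sup>2)"
text \<open>Twice the kinetic energy bound. The sum dominates the initial second velocity moment as
  well as \<open>accel_bound^2 * M\<close>, the two quantities that successive steps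
  average.\<close>

definition energy_bound :: real where "energy_bound = (LINT z|mu0. (norm (snd z))\<^sup>2) + accel_bound\<^sup>2 * M"

lemma norm_sq_measurable:
  "(\<lambda>z::phase. (norm z)\<^sup>2) \<in> borel_measurable borel" "(\<lambda>z::phase. (norm (snd z))\<^sup>2) \<in> borel_measurable borel"
  "(\<lambda>z::phase. (norm (fst z))\<^sup>2) \<in> borel_measurable borel"
  by (intro borel_measurable_continuous_onI continuous_intros)+

lemma integrable_snd_sq:
  assumes mu: "admissible c mu" and i: "integrable mu (\<lambda>z. (norm z)\<^sup>2)"
  shows "integrable mu (\<lambda>z. (norm (snd z))\<^sup>2)"
proof (rule Bochner_Integration.integrable_bound[OF i])
  show "(\<lambda>z. (norm (snd z))\<^sup>2) \<in> borel_measurable mu" by (rule admissible_measurable[OF mu norm_sq_measurable(2)])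
  show "AE z in mu. norm ((norm (snd z))\<^sup>2) \<le> norm ((norm z)\<^sup>2)"
    using norm_phase_sq by (intro AE_I2) simp
qed

lemma admissible_integrable_const: "admissible c mu \<Longrightarrow> integrable mu (\<lambda>z. b :: real)"
  using admissible_integrable_bounded(1)[of c mu "\<lambda>z. b" "\<bar>b\<bar>"] by simp

lemma admissible_integral_const: "admissible c mu \<Longrightarrow> (LINT z|mu. b :: real) = b * M"
  using admissible_mass admissible_space by simp

lemma moments_step:
  assumes mu: "admissible c mu" and i: "integrable mu (\<lambda>z. (norm z)\<^sup>2)" and h: "0 < h" "h \<le> 1"
  shows "integrable (distr mu borel (step mu h)) (\<lambda>z. (norm z)\<^sup>2)" (is "integrable ?nu _")
    and "(LINT z|distr mu borel (step mu h). 1 + (norm z)\<^sup>2) \<le> (1 + moment_rate * h) * (LINT z|mu. 1 + (norm z)\<^sup>2)"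
    and "(LINT z|distr mu borel (step mu h). (norm (snd z))\<^sup>2) \<le> (1 - h) * (LINT z|mu. (norm (snd z))\<^sup>2) + h * (accel_bound\<^sup>2 * M)"
proof -
  have h0: "0 \<le> h" using h by simp
  have m: "step mu h \<in> measurable mu borel" by (rule admissible_measurable[OF mu step_measurable[OF mu]])
  have W: "integrable mu (\<lambda>z. 1 + (norm z)\<^sup>2)" using i admissible_integrable_const[OF mu] by simp
  have iW: "integrable mu (\<lambda>z. 1 + (norm (step mu h z))\<^sup>2)"
  proof (rule Bochner_Integration.integrable_bound[of mu "\<lambda>z. (1 + moment_rate * h) * (1 + (norm z)\<^sup>2)"])
    show "integrable mu (\<lambda>z. (1 + moment_rate * h) * (1 + (norm z)\<^sup>2))" using W by (rule integrable_mult_right)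
    show "(\<lambda>z. 1 + (norm (step mu h z))\<^sup>2) \<in> borel_measurable mu"
      by (intro borel_measurable_add borel_measurable_const measurable_compose[OF m norm_sq_measurable(1)])
    show "AE z in mu. norm (1 + (norm (step mu h z))\<^sup>2) \<le> norm ((1 + moment_rate * h) * (1 + (norm z)\<^sup>2))"
    proof (intro AE_I2)
      fix z
      have "norm (1 + (norm (step mu h z))\<^sup>2) = 1 + (norm (step mu h z))\<^sup>2" by simp
      also have "\<dots> \<le> (1 + moment_rate * h) * (1 + (norm z)\<^sup>2)" by (rule weight_step[OF mu h0 h(2)])
      finally show "norm (1 + (norm (step mu h z))\<^sup>2) \<le> norm ((1 + moment_rate * h) * (1 + (norm z)\<^sup>2))" by simp
    qed
  qed
  have iN: "integrable mu (\<lambda>z. (norm (step mu h z))\<^sup>2)"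
    using Bochner_Integration.integrable_diff[OF iW admissible_integrable_const[OF mu, of 1]] by simp
  show iD: "integrable ?nu (\<lambda>z. (norm z)\<^sup>2)"
    using iN by (simp only: integrable_distr_eq[OF m norm_sq_measurable(1)])
  have "(LINT z|?nu. 1 + (norm z)\<^sup>2) = (LINT z|mu. 1 + (norm (step mu h z))\<^sup>2)"
    by (rule integral_distr[OF m]) (intro borel_measurable_add borel_measurable_const norm_sq_measurable)
  also have "\<dots> \<le> (LINT z|mu. (1 + moment_rate * h) * (1 + (norm z)\<^sup>2))"
    by (rule integral_mono[OF iW]) (use W weight_step[OF mu h0 h(2)] in auto)
  finally show "(LINT z|?nu. 1 + (norm z)\<^sup>2) \<le> (1 + moment_rate * h) * (LINT z|mu. 1 + (norm z)\<^sup>2)" by simp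
  have s: "snd (step mu h z) = (1 - h) *\<^sub>R snd z + h *\<^sub>R accel_field mu z" for z
    by (simp add: step_def shear_def kick_def)
  have iS: "integrable mu (\<lambda>z. (norm (snd (step mu h z)))\<^sup>2)"
  proof (rule Bochner_Integration.integrable_bound[OF iN])
    show "(\<lambda>z. (norm (snd (step mu h z)))\<^sup>2) \<in> borel_measurable mu" by (rule measurable_compose[OF m norm_sq_measurable(2)])
    show "AE z in mu. norm ((norm (snd (step mu h z)))\<^sup>2) \<le> norm ((norm (step mu h z))\<^sup>2)"
      using norm_phase_sq by (intro AE_I2) simp
  qed
  have iv: "integrable mu (\<lambda>z. (norm (snd z))\<^sup>2)" by (rule integrable_snd_sq[OF mu i])
  have "(LINT z|?nu. (norm (snd z))\<^sup>2) = (LINT z|mu. (norm (snd (step mu h z)))\<^sup>2)"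
    by (rule integral_distr[OF m norm_sq_measurable(2)])
  also have "\<dots> \<le> (LINT z|mu. (1 - h) * (norm (snd z))\<^sup>2 + h * accel_bound\<^sup>2)"
  proof (rule integral_mono[OF iS])
    show "integrable mu (\<lambda>z. (1 - h) * (norm (snd z))\<^sup>2 + h * accel_bound\<^sup>2)"
      by (intro Bochner_Integration.integrable_add integrable_mult_right iv admissible_integrable_const[OF mu])
    show "(norm (snd (step mu h z)))\<^sup>2 \<le> (1 - h) * (norm (snd z))\<^sup>2 + h * accel_bound\<^sup>2" for z
      unfolding s by (rule new_v_sq[OF mu h0 h(2)])
  qed
  also have "\<dots> = (1 - h) * (LINT z|mu. (norm (snd z))\<^sup>2) + h * accel_bound\<^sup>2 * M"
    using iv admissible_integrable_const[OF mu] admissible_integral_const[OF mu] by (subst Bochner_Integration.integral_add) auto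
  finally show "(LINT z|?nu. (norm (snd z))\<^sup>2) \<le> (1 - h) * (LINT z|mu. (norm (snd z))\<^sup>2) + h * (accel_bound\<^sup>2 * M)"
    by (simp add: mult.assoc)
qed

text \<open>The velocity moment satisfies a recursion by convex combinations and stays below
  \<open>energy_bound\<close> at all times. The full moment contains positions, which drift, so it
  is bounded only exponentially in time.\<close>

lemma moments_scheme:
  assumes h: "small_step h"
  shows "integrable (scheme h k) (\<lambda>z. (norm z)\<^sup>2) \<and> (LINT z|scheme h k. 1 + (norm z)\<^sup>2) \<le> exp (moment_rate * (real k * h)) * initial_moment \<and>
     (LINT z|scheme h k. (norm (snd z))\<^sup>2) \<le> energy_bound"
proof (induction k)
  case 0
  show ?case using mom_mu0 M_nonneg by (simp add: initial_moment_def energy_bound_def)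
next
  case (Suc k)
  have h': "0 < h" "h \<le> 1" using h by (auto simp: small_step_def)
  note st = moments_step[OF admissible_scheme[OF h] conjunct1[OF Suc] h']
  have initial_moment: "0 \<le> initial_moment" unfolding initial_moment_def by (rule integral_nonneg_AE) simp
  have "0 \<le> moment_rate" by (simp add: moment_rate_def)
  have "(LINT z|scheme h (Suc k). 1 + (norm z)\<^sup>2) \<le> (1 + moment_rate * h) * (LINT z|scheme h k. 1 + (norm z)\<^sup>2)"
    using st(2) by simp
  also have "\<dots> \<le> exp (moment_rate * h) * (exp (moment_rate * (real k * h)) * initial_moment)"
    using Suc initial_moment h' \<open>0 \<le> moment_rate\<close> exp_ge_add_one_self[of "moment_rate * h"] by (intro mult_mono) (auto intro!: integral_nonneg_AE)
  also have "\<dots> = exp (moment_rate * (real (Suc k) * h)) * initial_moment"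
  proof -
    have "moment_rate * (real (Suc k) * h) = moment_rate * h + moment_rate * (real k * h)" by (simp add: algebra_simps)
    then show ?thesis by (simp only: exp_add mult.assoc)
  qed
  finally have a: "(LINT z|scheme h (Suc k). 1 + (norm z)\<^sup>2) \<le> exp (moment_rate * (real (Suc k) * h)) * initial_moment" .
  have "(LINT z|scheme h (Suc k). (norm (snd z))\<^sup>2) \<le> (1 - h) * (LINT z|scheme h k. (norm (snd z))\<^sup>2) + h * (accel_bound\<^sup>2 * M)"
    using st(3) by simp
  also have "\<dots> \<le> (1 - h) * energy_bound + h * energy_bound"
  proof (intro add_mono mult_left_mono)
    have "0 \<le> (LINT z|mu0. (norm (snd z))\<^sup>2)" by (rule integral_nonneg_AE) simp
    then show "accel_bound\<^sup>2 * M \<le> energy_bound" by (simp add: energy_bound_def)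
  qed (use Suc h' in auto)
  also have "\<dots> = energy_bound" by (simp add: algebra_simps)
  finally show ?case using a st(1) by simp
qed

text \<open>Dominates the integral of \<open>1 + |velocity_field|^2\<close> over every measure of
  the scheme.\<close>

definition speed_bound :: real where "speed_bound = M + 3 * energy_bound + 3 * accel_bound\<^sup>2 * M"

lemma speed_bound_nonneg: "0 \<le> speed_bound"
proof -
  have "0 \<le> (LINT z|mu0. (norm (snd z))\<^sup>2)" by (rule integral_nonneg_AE) simp
  then show ?thesis using M_nonneg by (simp add: speed_bound_def energy_bound_def)
qed

text \<open>Common frame for two estimates: \<open>Q = 0\<close> with \<open>a\<close> of order
  \<open>h\<close> gives equicontinuity in time, the transport term as \<open>Q\<close> with
  \<open>a\<close> of order \<open>h^2\<close> gives the weak equation.\<close>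

lemma increment_scheme:
  fixes \<phi> Q :: "phase \<Rightarrow> real"
  assumes h: "small_step h" and \<phi>: "\<phi> \<in> borel_measurable borel" "\<And>z. \<bar>\<phi> z\<bar> \<le> B"
    and Q: "Q \<in> borel_measurable borel" "\<And>z. \<bar>Q z\<bar> \<le> B'" and a: "0 \<le> a"
    and le: "\<And>z. \<bar>\<phi> (step (scheme h k) h z) - \<phi> z - h * Q z\<bar> \<le> a * (1 + 3 * (norm (snd z))\<^sup>2 + 3 * accel_bound\<^sup>2)"
  shows "\<bar>(LINT z|scheme h (Suc k). \<phi> z) - (LINT z|scheme h k. \<phi> z) - h * (LINT z|scheme h k. Q z)\<bar> \<le> a * speed_bound"
proof -
  let ?mu = "scheme h k"
  have mu: "admissible (K0 * exp (4 * accel_lip * (real k * h))) ?mu" by (rule admissible_scheme[OF h])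
  have m: "step ?mu h \<in> measurable borel borel" by (rule step_measurable[OF mu])
  have i1: "integrable ?mu (\<lambda>z. \<phi> (step ?mu h z))"
    by (rule admissible_integrable_bounded(1)[OF mu measurable_compose[OF m \<phi>(1)]]) (use \<phi>(2) in simp)
  have i2: "integrable ?mu \<phi>" by (rule admissible_integrable_bounded(1)[OF mu \<phi>(1)]) (use \<phi>(2) in simp)
  have i3: "integrable ?mu Q" by (rule admissible_integrable_bounded(1)[OF mu Q(1)]) (use Q(2) in simp)
  have iv: "integrable ?mu (\<lambda>z. (norm (snd z))\<^sup>2)"
    using integrable_snd_sq[OF mu] moments_scheme[OF h] by blast
  have ib: "integrable ?mu (\<lambda>z. a * (1 + 3 * (norm (snd z))\<^sup>2 + 3 * accel_bound\<^sup>2))"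
    using iv admissible_integrable_const[OF mu] by simp
  have "(LINT z|scheme h (Suc k). \<phi> z) = (LINT z|?mu. \<phi> (step ?mu h z))"
    unfolding scheme.simps by (rule integral_distr[OF admissible_measurable[OF mu m] \<phi>(1)])
  then have "\<bar>(LINT z|scheme h (Suc k). \<phi> z) - (LINT z|?mu. \<phi> z) - h * (LINT z|?mu. Q z)\<bar>
     = \<bar>LINT z|?mu. \<phi> (step ?mu h z) - \<phi> z - h * Q z\<bar>" using i1 i2 i3 by simp
  also have "\<dots> \<le> (LINT z|?mu. \<bar>\<phi> (step ?mu h z) - \<phi> z - h * Q z\<bar>)" by (rule integral_abs_bound)
  also have "\<dots> \<le> (LINT z|?mu. a * (1 + 3 * (norm (snd z))\<^sup>2 + 3 * accel_bound\<^sup>2))"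
    by (rule integral_mono) (use i1 i2 i3 ib le in auto)
  also have "\<dots> = a * (M + 3 * (LINT z|?mu. (norm (snd z))\<^sup>2) + 3 * accel_bound\<^sup>2 * M)"
  proof -
    have sp: "measure ?mu (space ?mu) = M" using admissible_mass[OF mu] admissible_space[OF mu] by simp
    show ?thesis using iv admissible_integrable_const[OF mu] by (simp add: sp)
  qed
  also have "\<dots> \<le> a * speed_bound" using a moments_scheme[OF h, of k] unfolding speed_bound_def by (intro mult_left_mono) auto
  finally show ?thesis .
qed

lemma lipschitz_increment_scheme:
  fixes \<phi> :: "phase \<Rightarrow> real"
  assumes h: "small_step h" and \<phi>: "\<phi> \<in> borel_measurable borel" "\<And>z. \<bar>\<phi> z\<bar> \<le> B"
    and l: "\<And>x y. \<bar>\<phi> x - \<phi> y\<bar> \<le> l * norm (x - y)" "0 \<le> l"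
  shows "\<bar>(LINT z|scheme h (k + j). \<phi> z) - (LINT z|scheme h k. \<phi> z)\<bar> \<le> real j * h * (l * speed_bound)"
proof (induction j)
  case (Suc j)
  let ?mu = "scheme h (k + j)"
  have h': "0 \<le> h" "h \<le> 1" using h by (auto simp: small_step_def)
  have "\<bar>(LINT z|scheme h (Suc (k + j)). \<phi> z) - (LINT z|?mu. \<phi> z) - h * (LINT z|?mu. 0)\<bar> \<le> (h * l) * speed_bound"
  proof (rule increment_scheme[OF h \<phi>, where B'=0])
    fix z
    let ?d = "norm (velocity_field ?mu h z)"
    have "\<bar>\<phi> (step ?mu h z) - \<phi> z\<bar> \<le> l * (h * ?d)"
      using l(1)[of "step ?mu h z" z] h' unfolding step_eq by simp
    also have "?d \<le> 1 + ?d\<^sup>2" by (rule le_one_plus_square) simp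
    also have "1 + ?d\<^sup>2 \<le> 1 + 3 * (norm (snd z))\<^sup>2 + 3 * accel_bound\<^sup>2"
      using velocity_field_bound[OF admissible_scheme[OF h] h'] by simp
    finally show "\<bar>\<phi> (step ?mu h z) - \<phi> z - h * 0\<bar> \<le> h * l * (1 + 3 * (norm (snd z))\<^sup>2 + 3 * accel_bound\<^sup>2)"
      using h' l(2) by (simp add: mult_left_mono mult.assoc mult.left_commute)
  qed (use h' l in auto)
  then have "\<bar>(LINT z|scheme h (k + Suc j). \<phi> z) - (LINT z|?mu. \<phi> z)\<bar> \<le> h * (l * speed_bound)" by (simp add: mult.assoc)
  then have "\<bar>(LINT z|scheme h (k + Suc j). \<phi> z) - (LINT z|scheme h k. \<phi> z)\<bar> \<le> real j * h * (l * speed_bound) + h * (l * speed_bound)"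
    using Suc by linarith
  then show ?case by (simp only: of_nat_Suc distrib_right mult_1_left)
qed simp

text \<open>The summand \<open>2 * accel_lip\<close> makes every \<open>step_size n\<close> a small step.\<close>
definition step_size :: "nat \<Rightarrow> real" where "step_size n = 1 / (real n + 2 * accel_lip)"
text \<open>Piecewise constant in time: the measure of the scheme at the last grid time not after
  \<open>t\<close>. Rounding down lets bounds that increase in time be stated at \<open>t\<close>
  itself.\<close>

definition path :: "nat \<Rightarrow> real \<Rightarrow> phase measure" where "path n t = scheme (step_size n) (nat \<lfloor>t / step_size n\<rfloor>)"

lemma small_step_size: "small_step (step_size n)"
proof -
  have p: "1 \<le> real n + 2 * accel_lip" "2 * accel_lip \<le> real n + 2 * accel_lip" using accel_lip_ge by simp_all
  then show ?thesis unfolding small_step_def step_size_def by (simp add: divide_le_eq)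
qed

lemma step_size_pos: "0 < step_size n" using small_step_size by (simp add: small_step_def)

lemma step_size_tendsto: "step_size \<longlonglongrightarrow> 0"
proof -
  have "filterlim (\<lambda>n. real n + 2 * accel_lip) at_top sequentially"
    using filterlim_tendsto_add_at_top[OF tendsto_const[of "2 * accel_lip"] filterlim_real_sequentially] by (simp add: add.commute)
  then show ?thesis unfolding step_size_def
    by (intro tendsto_divide_0[OF tendsto_const] filterlim_at_top_imp_at_infinity)
qed

lemma floor_time:
  assumes "0 \<le> t" "0 < h"
  shows "real (nat \<lfloor>t / h\<rfloor>) * h \<le> t" "t < (real (nat \<lfloor>t / h\<rfloor>) + 1) * h"
proof -
  have f: "real (nat \<lfloor>t / h\<rfloor>) = of_int \<lfloor>t / h\<rfloor>" using assms by simp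
  have 1: "of_int \<lfloor>t / h\<rfloor> \<le> t / h" and 2: "t / h < of_int \<lfloor>t / h\<rfloor> + 1" by linarith+
  show "real (nat \<lfloor>t / h\<rfloor>) * h \<le> t" unfolding f by (rule pos_le_divide_eq[OF assms(2), THEN iffD1, OF 1])
  show "t < (real (nat \<lfloor>t / h\<rfloor>) + 1) * h" unfolding f by (rule pos_divide_less_eq[OF assms(2), THEN iffD1, OF 2])
qed

lemma admissible_path: assumes "0 \<le> t" shows "admissible (K0 * exp (4 * accel_lip * t)) (path n t)"
proof -
  have "K0 * exp (4 * accel_lip * (real (nat \<lfloor>t / step_size n\<rfloor>) * step_size n)) \<le> K0 * exp (4 * accel_lip * t)"
    using floor_time(1)[OF assms step_size_pos] K0_nonneg accel_lip_ge by (intro mult_left_mono) auto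
  then show ?thesis unfolding path_def using admissible_mono[OF admissible_scheme[OF small_step_size]] by blast
qed

lemma moments_path:
  assumes "0 \<le> t"
  shows "integrable (path n t) (\<lambda>z. (norm z)\<^sup>2)" "(LINT z|path n t. (norm z)\<^sup>2) \<le> exp (moment_rate * t) * initial_moment"
    "(LINT z|path n t. (norm (snd z))\<^sup>2) \<le> energy_bound"
proof -
  note m = moments_scheme[OF small_step_size, of n "nat \<lfloor>t / step_size n\<rfloor>", folded path_def]
  show i: "integrable (path n t) (\<lambda>z. (norm z)\<^sup>2)" and "(LINT z|path n t. (norm (snd z))\<^sup>2) \<le> energy_bound" using m by auto
  have initial_moment: "0 \<le> initial_moment" unfolding initial_moment_def by (rule integral_nonneg_AE) simp
  have moment_rate: "0 \<le> moment_rate" by (simp add: moment_rate_def)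
  have "(LINT z|path n t. (norm z)\<^sup>2) \<le> (LINT z|path n t. 1 + (norm z)\<^sup>2)"
    using i admissible_integrable_const[OF admissible_path[OF assms]] by (intro integral_mono) auto
  also have "\<dots> \<le> exp (moment_rate * (real (nat \<lfloor>t / step_size n\<rfloor>) * step_size n)) * initial_moment" using m by blast
  also have "\<dots> \<le> exp (moment_rate * t) * initial_moment" using floor_time(1)[OF assms step_size_pos] initial_moment moment_rate
    by (intro mult_right_mono) (auto intro!: mult_left_mono)
  finally show "(LINT z|path n t. (norm z)\<^sup>2) \<le> exp (moment_rate * t) * initial_moment" .
qed

text \<open>The grid times below \<open>s\<close> and \<open>t\<close> differ by at most
  \<open>\<bar>t - s\<bar>\<close> plus one step. The additional step disappears along the sequence,
  so the estimate is an asymptotic Lipschitz bound in time.\<close>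

lemma path_equicontinuous:
  fixes \<phi> :: "phase \<Rightarrow> real"
  assumes \<phi>: "\<phi> \<in> borel_measurable borel" "\<And>z. \<bar>\<phi> z\<bar> \<le> B"
    and l: "\<And>x y. \<bar>\<phi> x - \<phi> y\<bar> \<le> l * norm (x - y)" "0 \<le> l" and ts: "0 \<le> t" "0 \<le> s"
  shows "\<bar>(LINT z|path n t. \<phi> z) - (LINT z|path n s. \<phi> z)\<bar> \<le> l * speed_bound * (\<bar>t - s\<bar> + step_size n)"
proof -
  have *: "\<bar>(LINT z|path n t. \<phi> z) - (LINT z|path n s. \<phi> z)\<bar> \<le> l * speed_bound * (t - s + step_size n)"
    if "0 \<le> s" "s \<le> t" for s t
  proof -
    define k j where "k = nat \<lfloor>s / step_size n\<rfloor>" and "j = nat \<lfloor>t / step_size n\<rfloor> - k"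
    have "s / step_size n \<le> t / step_size n" using that step_size_pos by (simp add: divide_right_mono less_imp_le)
    then have le: "k \<le> nat \<lfloor>t / step_size n\<rfloor>" unfolding k_def by (intro nat_mono floor_mono)
    then have kj: "nat \<lfloor>t / step_size n\<rfloor> = k + j" by (simp add: j_def)
    have "real (k + j) * step_size n \<le> t" "s < (real k + 1) * step_size n"
      using floor_time(1)[OF _ step_size_pos, of t n] floor_time(2)[OF _ step_size_pos, of s n] that unfolding kj k_def by auto
    then have "real j * step_size n \<le> t - s + step_size n" by (simp add: algebra_simps)
    then have "real j * step_size n * (l * speed_bound) \<le> (t - s + step_size n) * (l * speed_bound)"
      using l(2) speed_bound_nonneg by (intro mult_right_mono) auto
    moreover have "\<bar>(LINT z|path n t. \<phi> z) - (LINT z|path n s. \<phi> z)\<bar> \<le> real j * step_size n * (l * speed_bound)"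
      unfolding path_def kj k_def[symmetric] by (rule lipschitz_increment_scheme[OF small_step_size \<phi> l])
    ultimately show ?thesis by (simp add: mult.commute)
  qed
  show ?thesis
  proof (cases "s \<le> t")
    case True then show ?thesis using *[OF ts(2) True] by simp
  next
    case False then show ?thesis using *[of t s] ts by (simp add: abs_minus_commute)
  qed
qed

end

section \<open>Uniform domination from density and moment bounds\<close>

lemma emeasure_density_const:
  "A \<in> sets N \<Longrightarrow> emeasure (density N (\<lambda>_. c)) A = c * emeasure N A"
  by (simp add: emeasure_density nn_integral_cmult_indicator)

lemma nn_integral_dominated_measure:
  fixes m :: "'a::euclidean_space measure"
  assumes s: "sets m = sets borel" and d: "\<And>A. A \<in> sets borel \<Longrightarrow> emeasure m A \<le> ennreal c * emeasure lborel A"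
    and f: "f \<in> borel_measurable borel"
  shows "(\<integral>\<^sup>+x. f x \<partial>m) \<le> ennreal c * (\<integral>\<^sup>+x. f x \<partial>lborel)"
proof -
  let ?D = "density lborel (\<lambda>_. ennreal c)"
  have "m \<le> ?D"
    using s d by (subst le_measure) (auto simp: emeasure_density_const emeasure_notin_sets le_fun_def intro!: emeasure_density_const)
  then have "(\<integral>\<^sup>+x. f x \<partial>m) \<le> (\<integral>\<^sup>+x. f x \<partial>?D)" using s by (intro nn_integral_mono_measure) auto
  also have "\<dots> = ennreal c * (\<integral>\<^sup>+x. f x \<partial>lborel)"
    using f by (subst nn_integral_density) (auto intro!: nn_integral_cmult)
  finally show ?thesis .
qed

text \<open>Chebyshev's inequality for the second moment.\<close>

lemma measure_outside_ball:
  fixes m :: "'a::euclidean_space measure"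
  assumes s: "sets m = sets borel" and fin: "finite_measure m"
    and i: "integrable m (\<lambda>z. (norm z)\<^sup>2)" and w: "(LINT z|m. (norm z)\<^sup>2) \<le> w" and R: "0 < R"
  shows "measure m (- cball 0 R) \<le> w / R\<^sup>2"
proof -
  interpret finite_measure m by fact
  have sp: "space m = UNIV" using sets_eq_imp_space_eq[OF s] by simp
  have A: "- cball 0 R \<in> sets m" unfolding s by simp
  have "R\<^sup>2 * measure m (- cball 0 R) = (LINT z|m. R\<^sup>2 * indicat_real (- cball 0 R) z)"
    using A sp by simp
  also have "\<dots> \<le> (LINT z|m. (norm z)\<^sup>2)"
  proof (rule integral_mono[OF _ i])
    show "integrable m (\<lambda>z. R\<^sup>2 * indicat_real (- cball 0 R) z)" using A
      by (intro integrable_mult_right integrable_real_indicator) (auto simp: emeasure_eq_measure)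
    fix z :: 'a
    show "R\<^sup>2 * indicat_real (- cball 0 R) z \<le> (norm z)\<^sup>2"
    proof (cases "z \<in> cball 0 R")
      case False
      then have "R\<^sup>2 \<le> (norm z)\<^sup>2" using R by (intro power_mono) auto
      then show ?thesis using False by simp
    qed simp
  qed
  finally have "R\<^sup>2 * measure m (- cball 0 R) \<le> w" using w by simp
  then show ?thesis using R by (simp add: pos_le_divide_eq mult.commute)
qed

lemma exists_radius:
  assumes "0 < (e::real)" obtains R where "0 < R" "w / R\<^sup>2 \<le> e"
proof -
  define R where "R = 1 + \<bar>w\<bar> / e"
  have R: "1 \<le> R" using assms by (simp add: R_def)
  have "\<bar>w\<bar> \<le> e * R" using assms by (simp add: R_def distrib_left)
  also have "\<dots> \<le> e * R\<^sup>2" using R assms mult_left_mono[of 1 R R] by (simp add: power2_eq_square)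
  finally have "w / R\<^sup>2 \<le> e" using R by (simp add: pos_divide_le_eq)
  then show ?thesis using R that[of R] by simp
qed

lemma pair_dominated:
  fixes m :: "'a::euclidean_space measure"
  assumes s: "sets m = sets borel" and fin: "finite_measure m" and c: "0 \<le> c"
    and d: "\<And>A. A \<in> sets borel \<Longrightarrow> emeasure m A \<le> ennreal c * emeasure lborel A"
    and E: "E \<in> sets (borel \<Otimes>\<^sub>M borel)"
  shows "emeasure (m \<Otimes>\<^sub>M m) E \<le> ennreal (c * c) * emeasure (lborel \<Otimes>\<^sub>M lborel) E"
proof -
  interpret finite_measure m by fact
  have sE: "E \<in> sets (m \<Otimes>\<^sub>M m)" using E sets_pair_measure_cong[OF s s] by simp
  have lE: "E \<in> sets (lborel \<Otimes>\<^sub>M lborel)" using E sets_pair_measure_cong[OF sets_lborel sets_lborel] by blast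
  have sl: "Pair x -` E \<in> sets borel" for x using sets_Pair1[OF E] .
  have mm: "(\<lambda>x. emeasure lborel (Pair x -` E)) \<in> borel_measurable borel"
    using lborel.measurable_emeasure_Pair[OF lE] by simp
  have "emeasure (m \<Otimes>\<^sub>M m) E = (\<integral>\<^sup>+x. emeasure m (Pair x -` E) \<partial>m)"
    by (rule emeasure_pair_measure_alt[OF sE])
  also have "\<dots> \<le> (\<integral>\<^sup>+x. ennreal c * emeasure lborel (Pair x -` E) \<partial>m)"
    by (rule nn_integral_mono) (rule d[OF sl])
  also have "\<dots> \<le> ennreal c * (\<integral>\<^sup>+x. ennreal c * emeasure lborel (Pair x -` E) \<partial>lborel)"
    by (rule nn_integral_dominated_measure[OF s d]) (use mm in auto)
  also have "(\<integral>\<^sup>+x. ennreal c * emeasure lborel (Pair x -` E) \<partial>lborel) = ennreal c * (\<integral>\<^sup>+x. emeasure lborel (Pair x -` E) \<partial>lborel)"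
    by (rule nn_integral_cmult) (use mm in simp)
  also have "(\<integral>\<^sup>+x. emeasure lborel (Pair x -` E) \<partial>lborel) = emeasure (lborel \<Otimes>\<^sub>M lborel) E"
    by (rule lborel.emeasure_pair_measure_alt[OF lE, symmetric])
  also have "ennreal c * (ennreal c * emeasure (lborel \<Otimes>\<^sub>M lborel) E) = ennreal (c * c) * emeasure (lborel \<Otimes>\<^sub>M lborel) E"
    by (simp only: ennreal_mult[OF c c] mult.assoc)
  finally show ?thesis .
qed

text \<open>The constants are common to all \<open>n\<close>: the density bound controls the
  measures inside a large ball, the second moment outside.\<close>

locale tight_family =
  fixes m :: "nat \<Rightarrow> 'a::euclidean_space measure" and c w Mb :: real
  assumes s: "\<And>n. sets (m n) = sets borel" and finm: "\<And>n. finite_measure (m n)" and c: "0 \<le> c"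
    and d: "\<And>n A. A \<in> sets borel \<Longrightarrow> emeasure (m n) A \<le> ennreal c * emeasure lborel A"
    and i: "\<And>n. integrable (m n) (\<lambda>z. (norm z)\<^sup>2)" and w: "\<And>n. (LINT z|m n. (norm z)\<^sup>2) \<le> w"
    and Mb: "\<And>n. measure (m n) UNIV \<le> Mb"
begin

text \<open>The dominating measure is \<open>k\<close> times \<open>N\<close> restricted to
  \<open>B\<close>, finite because \<open>B\<close> has finite measure. The mass of
  \<open>\<mu>\<close> outside \<open>B\<close> is left as the error.\<close>

lemma measure_le_density:
  assumes N: "\<And>A. A \<in> sets N \<Longrightarrow> emeasure (\<mu>::'b measure) A \<le> ennreal k * emeasure N A" "sets \<mu> = sets N" "finite_measure \<mu>"
    and B: "B \<in> sets N" "emeasure N B < \<infinity>" and k: "0 \<le> k"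
  shows "finite_measure (density N (\<lambda>x. ennreal k * indicator B x))"
    and "A \<in> sets N \<Longrightarrow> measure \<mu> A \<le> measure (density N (\<lambda>x. ennreal k * indicator B x)) A + measure \<mu> (space N - B)"
proof -
  let ?P = "density N (\<lambda>x. ennreal k * indicator B x)"
  interpret mu: finite_measure \<mu> by fact
  have eP: "emeasure ?P A = ennreal k * emeasure N (A \<inter> B)" if "A \<in> sets N" for A
  proof -
    have "emeasure ?P A = (\<integral>\<^sup>+x. ennreal k * indicator (A \<inter> B) x \<partial>N)"
      using that B by (subst emeasure_density) (auto intro!: nn_integral_cong split: split_indicator)
    also have "\<dots> = ennreal k * emeasure N (A \<inter> B)" using that B by (intro nn_integral_cmult_indicator) auto
    finally show ?thesis .
  qed
  have "emeasure ?P (space N) < \<infinity>"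
    using eP[OF sets.top] B by (simp add: Int_absorb1 sets.sets_into_space ennreal_mult_less_top)
  then show fP: "finite_measure ?P" by (intro finite_measureI) auto
  then interpret P: finite_measure ?P .
  assume A: "A \<in> sets N"
  have "emeasure \<mu> (A \<inter> B) \<le> emeasure ?P A" using N(1)[of "A \<inter> B"] A B eP[OF A] by auto
  then have 1: "measure \<mu> (A \<inter> B) \<le> measure ?P A"
    by (simp add: mu.emeasure_eq_measure P.emeasure_eq_measure)
  have "measure \<mu> A \<le> measure \<mu> ((A \<inter> B) \<union> (space N - B))"
    using A B N(2) sets.sets_into_space[OF A] by (intro mu.finite_measure_mono) auto
  also have "\<dots> \<le> measure \<mu> (A \<inter> B) + measure \<mu> (space N - B)"
    using A B N(2) by (intro measure_subadditive) (auto simp: mu.emeasure_eq_measure)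
  finally show "measure \<mu> A \<le> measure ?P A + measure \<mu> (space N - B)" using 1 by linarith
qed

lemma cball_fin: "emeasure lborel (cball (0::'a) R) < \<infinity>"
  using emeasure_bounded_finite[of "cball (0::'a) R"] by simp

lemma unif_dom: "unif_dom_seq borel m"
proof (rule unif_dom_seq.intro)
  fix e :: real assume "0 < e"
  obtain R where R: "0 < R" "w / R\<^sup>2 \<le> e" by (rule exists_radius[OF \<open>0 < e\<close>])
  let ?P = "density lborel (\<lambda>x. ennreal c * indicator (cball (0::'a) R) x)"
  have dl: "emeasure (m n) A \<le> ennreal c * emeasure lborel A" if "A \<in> sets lborel" for n A
    using d[of A n] that by (simp only: sets_lborel)
  have sl: "sets (m n) = sets lborel" for n by (simp only: s sets_lborel)
  have Bl: "cball (0::'a) R \<in> sets lborel" by simp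
  have "finite_measure ?P"
    by (rule measure_le_density(1)[OF dl sl finm Bl cball_fin c])
  moreover have "measure (m n) A \<le> measure ?P A + e" if "A \<in> sets borel" for n A
  proof -
    have "measure (m n) A \<le> measure ?P A + measure (m n) (space lborel - cball 0 R)"
      by (rule measure_le_density(2)[OF dl sl finm Bl cball_fin c]) (simp_all add: that)
    moreover have "measure (m n) (space lborel - cball 0 R) \<le> w / R\<^sup>2"
      using measure_outside_ball[OF s finm i w R(1)] by (simp add: Compl_eq_Diff_UNIV)
    ultimately show ?thesis using R(2) by linarith
  qed
  ultimately show "\<exists>P. finite_measure P \<and> sets P = sets borel \<and> (\<forall>n. \<forall>A\<in>sets borel. measure (m n) A \<le> measure P A + e)"
    by (intro exI[of _ ?P] conjI allI ballI) simp_all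
next
  show "finite_measure (m n)" "sets (m n) = sets borel" for n by (rule finm, rule s)
qed

lemma unif_dom_pair: "unif_dom_seq (borel \<Otimes>\<^sub>M borel) (\<lambda>n. m n \<Otimes>\<^sub>M m n)"
proof (rule unif_dom_seq.intro)
  fix e :: real assume "0 < e"
  have Mb0: "0 \<le> Mb" using Mb[of 0] measure_nonneg order_trans by blast
  \<comment> \<open>The complement of \<open>?C \<times> ?C\<close> is covered by two strips, each
    of mass at most the mass outside the ball times \<open>Mb\<close>, hence half of
    \<open>e\<close> for each. \<open>Mb + 1\<close> is positive even if \<open>Mb\<close> is
    zero.\<close>
  obtain R where R: "0 < R" "w / R\<^sup>2 \<le> e / (2 * (Mb + 1))" using exists_radius[of "e / (2 * (Mb + 1))" w] \<open>0 < e\<close> Mb0 by auto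
  let ?C = "cball (0::'a) R"
  let ?N = "lborel \<Otimes>\<^sub>M lborel :: ('a \<times> 'a) measure"
  let ?P = "density ?N (\<lambda>x. ennreal (c * c) * indicator (?C \<times> ?C) x)"
  have sN: "sets ?N = sets (borel \<Otimes>\<^sub>M borel)" by (rule sets_pair_measure_cong) auto
  have sm: "sets (m n \<Otimes>\<^sub>M m n) = sets (borel \<Otimes>\<^sub>M borel)" for n by (rule sets_pair_measure_cong[OF s s])
  have fp: "finite_measure (m n \<Otimes>\<^sub>M m n)" for n using finm by (intro finite_measure_pair_measure)
  have dom: "emeasure (m n \<Otimes>\<^sub>M m n) A \<le> ennreal (c * c) * emeasure ?N A" if "A \<in> sets ?N" for n A
    using pair_dominated[OF s finm c d, of A n] that by (simp only: sN)
  have smN: "sets (m n \<Otimes>\<^sub>M m n) = sets ?N" for n unfolding sm sN ..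
  have cc: "0 \<le> c * c" by simp
  have CC: "?C \<times> ?C \<in> sets ?N" by (intro pair_measureI) auto
  have "emeasure ?N (?C \<times> ?C) = emeasure lborel ?C * emeasure lborel ?C"
    by (rule lborel.emeasure_pair_measure_Times) auto
  then have CCf: "emeasure ?N (?C \<times> ?C) < \<infinity>" using cball_fin[of R] by (simp add: ennreal_mult_less_top)
  have "finite_measure ?P"
    by (rule measure_le_density(1)[OF dom smN fp CC CCf cc])
  moreover have "measure (m n \<Otimes>\<^sub>M m n) A \<le> measure ?P A + e" if "A \<in> sets (borel \<Otimes>\<^sub>M borel)" for n A
  proof -
    interpret finite_measure "m n" by (rule finm)
    interpret pp: finite_measure "m n \<Otimes>\<^sub>M m n" by (rule fp)
    have spN: "space ?N = UNIV" by (simp add: space_pair_measure)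
    have "measure (m n \<Otimes>\<^sub>M m n) A \<le> measure ?P A + measure (m n \<Otimes>\<^sub>M m n) (space ?N - ?C \<times> ?C)"
      by (rule measure_le_density(2)[OF dom smN fp CC CCf cc]) (simp_all only: sN that)
    moreover have "measure (m n \<Otimes>\<^sub>M m n) (space ?N - ?C \<times> ?C) \<le> e"
    proof -
      have rect: "measure (m n \<Otimes>\<^sub>M m n) (a \<times> b) = measure (m n) a * measure (m n) b" if "a \<in> sets borel" "b \<in> sets borel" for a b
        using that emeasure_pair_measure_Times[of a "m n" b] s by (simp add: measure_def enn2real_mult)
      have r1: "(- ?C) \<times> UNIV \<in> sets (m n \<Otimes>\<^sub>M m n)" "UNIV \<times> (- ?C) \<in> sets (m n \<Otimes>\<^sub>M m n)"
        using s by (auto intro!: pair_measureI)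
      have "space ?N - ?C \<times> ?C = ((- ?C) \<times> UNIV) \<union> (UNIV \<times> (- ?C))" unfolding spN by auto
      then have "measure (m n \<Otimes>\<^sub>M m n) (space ?N - ?C \<times> ?C) \<le> measure (m n \<Otimes>\<^sub>M m n) ((- ?C) \<times> UNIV) + measure (m n \<Otimes>\<^sub>M m n) (UNIV \<times> (- ?C))"
        using r1 by (simp only:) (intro measure_subadditive; simp add: pp.emeasure_eq_measure)
      also have "\<dots> = 2 * (measure (m n) (- ?C) * measure (m n) UNIV)"
        by (simp add: rect)
      also have "\<dots> \<le> 2 * (w / R\<^sup>2 * (Mb + 1))"
        using measure_outside_ball[OF s finm i w R(1), of n] Mb[of n] Mb0
          order_trans[OF measure_nonneg measure_outside_ball[OF s finm i w R(1), of n]]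
        by (intro mult_left_mono mult_mono) auto
      also have "\<dots> \<le> 2 * (e / (2 * (Mb + 1)) * (Mb + 1))" using R(2) Mb0 by (intro mult_left_mono mult_right_mono) auto
      also have "\<dots> = e" using Mb0 by (simp add: field_simps)
      finally show ?thesis .
    qed
    ultimately show ?thesis by linarith
  qed
  ultimately show "\<exists>P. finite_measure P \<and> sets P = sets (borel \<Otimes>\<^sub>M borel) \<and>
      (\<forall>n. \<forall>A\<in>sets (borel \<Otimes>\<^sub>M borel). measure (m n \<Otimes>\<^sub>M m n) A \<le> measure P A + e)"
    by (intro exI[of _ ?P] conjI allI ballI) (simp_all only: sets_density sN)
next
  show "finite_measure (m n \<Otimes>\<^sub>M m n)" for n by (rule finite_measure_pair_measure[OF finm finm])
  show "sets (m n \<Otimes>\<^sub>M m n) = sets (borel \<Otimes>\<^sub>M borel)" for n by (rule sets_pair_measure_cong[OF s s])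
qed

end

section \<open>Convergent subsequences\<close>

text \<open>A countable basis generates the Borel sets but need not be stable under intersection;
  its finite intersections are stable and still countable, which suits both the diagonal argument
  and Dynkin induction.\<close>

lemma countable_pi_system_borel:
  obtains E :: "'a::second_countable_topology set set" where
    "countable E" "Int_stable E" "E \<noteq> {}" "sets borel = sigma_sets UNIV E"
proof -
  obtain B :: "'a set set" where B: "countable B" "topological_basis B" using ex_countable_basis by blast
  define E where "E = Inter ` {X. finite X \<and> X \<subseteq> B}"
  have op: "open b" if "b \<in> B" for b using B(2) that by (rule topological_basis_open)
  have bB: "sets borel = sigma_sets UNIV B"
    by (subst borel_eq_countable_basis[OF B]) (rule sets_measure_of, simp)
  show ?thesis
  proof (rule that[of E])
    show "countable E" unfolding E_def using B(1) by (intro countable_image countable_Collect_finite_subset)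
    show "Int_stable E"
    proof (rule Int_stableI)
      fix a b assume "a \<in> E" "b \<in> E"
      then obtain X Y where "a = \<Inter>X" "b = \<Inter>Y" "finite X" "finite Y" "X \<subseteq> B" "Y \<subseteq> B" by (auto simp: E_def)
      then show "a \<inter> b \<in> E" unfolding E_def by (intro image_eqI[of _ _ "X \<union> Y"]) auto
    qed
    show "E \<noteq> {}" unfolding E_def by auto
    have "E \<subseteq> sigma_sets UNIV B"
    proof
      fix a assume "a \<in> E"
      then obtain X where X: "a = \<Inter>X" "finite X" "X \<subseteq> B" by (auto simp: E_def)
      have "open (\<Inter>X)"
      proof (rule open_Inter[OF X(2)], rule ballI)
        fix b assume "b \<in> X" then show "open b" using X(3) by (intro op) auto
      qed
      then have "a \<in> sets borel" unfolding X(1) by (rule borel_open)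
      then show "a \<in> sigma_sets UNIV B" unfolding bB .
    qed
    moreover have "B \<subseteq> E"
    proof
      fix b assume "b \<in> B" then show "b \<in> E" unfolding E_def by (intro image_eqI[of _ _ "{b}"]) auto
    qed
    ultimately show "sets borel = sigma_sets UNIV E"
      unfolding bB using sigma_sets_mono[of E UNIV B] sigma_sets_mono'[of B E UNIV] by blast
  qed
qed

context mean_field
begin

lemma tight_path: assumes "0 \<le> t"
  shows "tight_family (\<lambda>j. path (r j) t) (K0 * exp (4 * accel_lip * t)) (exp (moment_rate * t) * initial_moment) M"
proof (rule tight_family.intro)
  note a = admissible_path[OF assms]
  show "sets (path (r n) t) = sets borel" "finite_measure (path (r n) t)" for n using admissible_sets[OF a] admissible_finite[OF a] by auto
  show "0 \<le> K0 * exp (4 * accel_lip * t)" using admissible_nonneg[OF a] .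
  show "emeasure (path (r n) t) A \<le> ennreal (K0 * exp (4 * accel_lip * t)) * emeasure lborel A" if "A \<in> sets borel" for n A
    using admissible_dens[OF a that] .
  show "integrable (path (r n) t) (\<lambda>z. (norm z)\<^sup>2)" "(LINT z|path (r n) t. (norm z)\<^sup>2) \<le> exp (moment_rate * t) * initial_moment" for n
    using moments_path[OF assms] by auto
  show "measure (path (r n) t) UNIV \<le> M" for n using admissible_mass[OF a] by simp
qed

lemma unif_dom_path: "0 \<le> t \<Longrightarrow> unif_dom_seq borel (\<lambda>j. path (r j) t)"
  and unif_dom_path_pair: "0 \<le> t \<Longrightarrow> unif_dom_seq (borel \<Otimes>\<^sub>M borel) (\<lambda>j. path (r j) t \<Otimes>\<^sub>M path (r j) t)"
  using tight_family.unif_dom[OF tight_path] tight_family.unif_dom_pair[OF tight_path] by blast+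

lemma convergent_from_generator:
  assumes t: "0 \<le> t" and E: "Int_stable E" "sets borel = sigma_sets UNIV E"
    and conv: "\<And>A. A \<in> E \<Longrightarrow> convergent (\<lambda>j. measure (path (r j) t) A)" and A: "A \<in> sets borel"
  shows "convergent (\<lambda>j. measure (path (r j) t) A)"
proof (rule unif_dom_seq.convergent_sets[OF unif_dom_path[OF t] E(1)])
  show "E \<subseteq> Pow (space borel)" by simp
  show "sets borel = sigma_sets (space borel) E" using E(2) by simp
  show "convergent (\<lambda>j. measure (path (r j) t) (space borel))"
    using admissible_mass[OF admissible_path[OF t]] by (simp add: convergent_const)
qed (use conv A in auto)

lemma convergent_integral_path:
  fixes \<phi> :: "phase \<Rightarrow> real"
  assumes t: "0 \<le> t" and conv: "\<And>A. A \<in> sets borel \<Longrightarrow> convergent (\<lambda>j. measure (path (r j) t) A)"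
    and \<phi>: "\<phi> \<in> borel_measurable borel" "\<And>z. \<bar>\<phi> z\<bar> \<le> B"
  shows "convergent (\<lambda>j. LINT z|path (r j) t. \<phi> z)"
proof -
  obtain N where N: "finite_measure N" "sets N = sets borel"
    "\<And>A. A \<in> sets borel \<Longrightarrow> (\<lambda>n. measure (path (r n) t) A) \<longlonglongrightarrow> measure N A"
    by (rule unif_dom_seq.limit_measure_exists[OF unif_dom_path[OF t] conv]) (assumption, rule that, assumption, assumption, simp)
  have "(\<lambda>j. LINT z|path (r j) t. \<phi> z) \<longlonglongrightarrow> (LINT z|N. \<phi> z)"
  proof (rule integral_setwise_tendsto)
    show "finite_measure (path (r n) t)" "sets (path (r n) t) = sets N" for n
      using admissible_finite[OF admissible_path[OF t]] admissible_sets[OF admissible_path[OF t]] N(2) by auto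
    show "\<phi> \<in> borel_measurable N" using \<phi>(1) measurable_cong_sets[OF N(2) refl] by blast
  qed (use N \<phi> in auto)
  then show ?thesis by (rule convergentI)
qed

lemma step_size_subseq: "strict_mono r \<Longrightarrow> (\<lambda>j. step_size (r j)) \<longlonglongrightarrow> 0"
  using LIMSEQ_subseq_LIMSEQ[OF step_size_tendsto] by (simp add: comp_def)

text \<open>A rational time close to \<open>t\<close> changes the integral by little, uniformly in
  large \<open>j\<close>, so convergence at rational times suffices.\<close>

lemma convergent_lipschitz_path:
  fixes \<phi> :: "phase \<Rightarrow> real"
  assumes r: "strict_mono r" and t: "0 \<le> t"
    and conv: "\<And>q A. q \<in> \<rat> \<Longrightarrow> 0 \<le> q \<Longrightarrow> A \<in> sets borel \<Longrightarrow> convergent (\<lambda>j. measure (path (r j) q) A)"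
    and \<phi>: "\<phi> \<in> borel_measurable borel" "\<And>z. \<bar>\<phi> z\<bar> \<le> B"
    and l: "\<And>x y. \<bar>\<phi> x - \<phi> y\<bar> \<le> l * norm (x - y)" "0 \<le> l"
  shows "convergent (\<lambda>j. LINT z|path (r j) t. \<phi> z)"
proof (rule convergent_approx)
  fix e :: real assume "0 < e"
  \<comment> \<open>Both \<open>\<bar>t - q\<bar>\<close> and the step size will be below
    \<open>\<delta>\<close>, so the equicontinuity bound is at most
    \<open>(l * speed_bound + 1) * (2 * \<delta>)\<close>, which equals \<open>e\<close>.\<close>
  define \<delta> where "\<delta> = e / (2 * (l * speed_bound + 1))"
  have lD: "0 \<le> l * speed_bound" using l(2) speed_bound_nonneg by simp
  have \<delta>: "0 < \<delta>" using \<open>0 < e\<close> lD by (simp add: \<delta>_def)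
  obtain q where q: "q \<in> \<rat>" "t < q" "q < t + \<delta>" using Rats_dense_in_real[of t "t + \<delta>"] \<delta> by auto
  have q0: "0 \<le> q" using q t by simp
  have "\<forall>\<^sub>F j in sequentially. step_size (r j) < \<delta>" using order_tendstoD(2)[OF step_size_subseq[OF r] \<delta>] .
  then have "\<forall>\<^sub>F j in sequentially. \<bar>(LINT z|path (r j) t. \<phi> z) - (LINT z|path (r j) q. \<phi> z)\<bar> \<le> e"
  proof eventually_elim
    case (elim j)
    have "\<bar>(LINT z|path (r j) t. \<phi> z) - (LINT z|path (r j) q. \<phi> z)\<bar> \<le> l * speed_bound * (\<bar>t - q\<bar> + step_size (r j))"
      by (rule path_equicontinuous[OF \<phi> l t q0])
    also have "\<dots> \<le> (l * speed_bound + 1) * (2 * \<delta>)"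
      using q elim lD step_size_pos[of "r j"] by (intro mult_mono) auto
    also have "\<dots> = e"
    proof -
      have "K * (2 * (e / (2 * K))) = e" if "0 < K" for K :: real using that by simp
      from this[of "l * speed_bound + 1"] show ?thesis using lD unfolding \<delta>_def by simp
    qed
    finally show ?case .
  qed
  then show "\<exists>y. convergent y \<and> (\<forall>\<^sub>F j in sequentially. \<bar>(LINT z|path (r j) t. \<phi> z) - y j\<bar> \<le> e)"
    using convergent_integral_path[OF q0 conv[OF q(1) q0] \<phi>] by (intro exI[of _ "\<lambda>j. LINT z|path (r j) q. \<phi> z"]) simp
qed

text \<open>At an arbitrary time only integrals of bounded Lipschitz functions are known to
  converge. A Lipschitz function that is 1 on \<open>C\<close> and 0 outside a neighbourhood differs
  from the indicator only on a shell around \<open>C\<close>. The empty set is excluded because its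
  \<open>infdist\<close> is 0 by convention.\<close>

lemma convergent_closed_path:
  assumes r: "strict_mono r" and t: "0 \<le> t"
    and conv: "\<And>q A. q \<in> \<rat> \<Longrightarrow> 0 \<le> q \<Longrightarrow> A \<in> sets borel \<Longrightarrow> convergent (\<lambda>j. measure (path (r j) q) A)"
    and C: "closed C" "C \<noteq> {}"
  shows "convergent (\<lambda>j. measure (path (r j) t) C)"
proof (rule convergent_approx)
  fix e :: real assume "0 < e"
  \<comment> \<open>The shells leave out \<open>C\<close> itself, so they decrease to the empty set
    and \<open>unif_tail\<close> makes their mass small uniformly in \<open>j\<close>.\<close>
  define D where "D i = {z. 0 < infdist z C \<and> infdist z C < 1 / (real i + 1)}" for i
  have ci: "continuous_on UNIV (\<lambda>z. infdist z C)" by (intro continuous_intros)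
  have Dm: "D i \<in> sets borel" for i
  proof -
    have "open (D i)" unfolding D_def by (intro open_Collect_conj open_Collect_less continuous_intros ci)
    then show ?thesis by simp
  qed
  have dD: "decseq D" unfolding decseq_def D_def
  proof (intro allI impI subsetI CollectI)
    fix m n z assume "m \<le> n" and z: "z \<in> {z. 0 < infdist z C \<and> infdist z C < 1 / (real n + 1)}"
    have "1 / (real n + 1) \<le> 1 / (real m + 1)" using \<open>m \<le> n\<close> by (simp add: frac_le)
    then show "0 < infdist z C \<and> infdist z C < 1 / (real m + 1)" using z by auto
  qed
  have iD: "(\<Inter>i. D i) = {}"
  proof -
    { fix z assume z: "\<And>i. z \<in> D i"
      then have "0 < infdist z C" using z[of 0] by (simp add: D_def)
      then obtain i where "inverse (real (Suc i)) < infdist z C" using reals_Archimedean by blast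
      then have False using z[of i] by (simp add: D_def inverse_eq_divide add.commute) }
    then show ?thesis by auto
  qed
  obtain i where i: "\<And>n k. i \<le> k \<Longrightarrow> measure (path (r n) t) (D k) \<le> e"
  proof (rule unif_dom_seq.unif_tail[OF unif_dom_path[OF t, of r] Dm dD iD \<open>0 < e\<close>])
    fix j assume a: "\<And>n i. j \<le> i \<Longrightarrow> measure (path (r n) t) (D i) \<le> e"
    show thesis by (rule that[of j, OF a])
  qed
  define \<phi> where "\<phi> z = max 0 (1 - (real i + 1) * infdist z C)" for z
  have \<phi>m: "\<phi> \<in> borel_measurable borel"
  proof -
    have "continuous_on UNIV (\<lambda>z. \<phi> z)" unfolding \<phi>_def by (intro continuous_intros ci)
    then show ?thesis using borel_measurable_continuous_onI by simp
  qed
  have \<phi>b: "\<bar>\<phi> z\<bar> \<le> 1" for z unfolding \<phi>_def using infdist_nonneg[of z C] by (auto simp: max_def)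
  have \<phi>l: "\<bar>\<phi> x - \<phi> y\<bar> \<le> (real i + 1) * norm (x - y)" for x y
  proof -
    have "\<bar>\<phi> x - \<phi> y\<bar> \<le> \<bar>(real i + 1) * infdist x C - (real i + 1) * infdist y C\<bar>" unfolding \<phi>_def by (auto simp: max_def)
    also have "\<dots> = (real i + 1) * \<bar>infdist x C - infdist y C\<bar>" by (simp add: right_diff_distrib[symmetric] abs_mult)
    also have "\<dots> \<le> (real i + 1) * norm (x - y)"
      using infdist_triangle_abs[of x C y] by (intro mult_left_mono) (auto simp: dist_norm)
    finally show ?thesis .
  qed
  have Cm: "C \<in> sets borel" using C by simp
  have "\<bar>measure (path (r j) t) C - (LINT z|path (r j) t. \<phi> z)\<bar> \<le> e" for j
  proof -
    let ?mu = "path (r j) t"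
    have mu: "admissible (K0 * exp (4 * accel_lip * t)) ?mu" by (rule admissible_path[OF t])
    interpret finite_measure ?mu by (rule admissible_finite[OF mu])
    have ii: "integrable ?mu (indicat_real A)" "(LINT z|?mu. indicat_real A z) = measure ?mu A" if "A \<in> sets borel" for A
      using that admissible_sets[OF mu] admissible_space[OF mu] by (auto simp: emeasure_eq_measure)
    have i\<phi>: "integrable ?mu \<phi>" by (rule admissible_integrable_bounded(1)[OF mu \<phi>m]) (use \<phi>b in simp)
    have b: "indicat_real C z \<le> \<phi> z \<and> \<phi> z \<le> indicat_real C z + indicat_real (D i) z" for z
    proof (cases "z \<in> C")
      case True then show ?thesis by (simp add: \<phi>_def indicator_def)
    next
      case False
      then have "0 < infdist z C" using in_closed_iff_infdist_zero[OF C, of z] infdist_nonneg[of z C] by auto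
      show ?thesis
      proof (cases "infdist z C < 1 / (real i + 1)")
        case True
        then show ?thesis using False \<open>0 < infdist z C\<close> \<phi>b[of z] by (simp add: D_def \<phi>_def)
      next
        case notless: False
        then have "1 \<le> (real i + 1) * infdist z C" by (simp add: not_less divide_le_eq mult.commute)
        then show ?thesis using False by (simp add: \<phi>_def)
      qed
    qed
    have "measure ?mu C \<le> (LINT z|?mu. \<phi> z)" unfolding ii(2)[OF Cm, symmetric]
      by (rule integral_mono) (use ii Cm i\<phi> b in auto)
    moreover have "(LINT z|?mu. \<phi> z) \<le> (LINT z|?mu. indicat_real C z + indicat_real (D i) z)"
      by (rule integral_mono[OF i\<phi> Bochner_Integration.integrable_add[OF ii(1)[OF Cm] ii(1)[OF Dm]]]) (use b in auto)
    moreover have "\<dots> = measure ?mu C + measure ?mu (D i)"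
      by (simp only: Bochner_Integration.integral_add[OF ii(1)[OF Cm] ii(1)[OF Dm]] ii(2)[OF Cm] ii(2)[OF Dm])
    ultimately show ?thesis using i[of i j] by simp
  qed
  then show "\<exists>y. convergent y \<and> (\<forall>\<^sub>F j in sequentially. \<bar>measure (path (r j) t) C - y j\<bar> \<le> e)"
  proof (intro exI[of _ "\<lambda>j. LINT z|path (r j) t. \<phi> z"] conjI)
    show "convergent (\<lambda>j. LINT z|path (r j) t. \<phi> z)"
      by (rule convergent_lipschitz_path[OF r t _ \<phi>m \<phi>b \<phi>l]) (rule conv, assumption+, simp)
  qed simp
qed

text \<open>The diagonal argument runs over pairs of a rational time and a generating set. Dynkin
  induction extends it to all Borel sets at rational times, Lipschitz approximation to closed sets
  at all times, and a second Dynkin induction, now from the closed sets, to all Borel sets.\<close>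

lemma convergent_subsequence:
  obtains r where "strict_mono r"
    "\<And>t A. 0 \<le> t \<Longrightarrow> A \<in> sets borel \<Longrightarrow> convergent (\<lambda>j. measure (path (r j) t) A)"
proof -
  obtain E :: "phase set set" where E: "countable E" "Int_stable E" "E \<noteq> {}" "sets borel = sigma_sets UNIV E"
    by (rule countable_pi_system_borel)
  define I where "I = ((\<rat> :: real set) \<inter> {0..}) \<times> E"
  obtain b where "b \<in> E" using E(3) by blast
  then have "(0, b) \<in> I" by (simp add: I_def)
  then have I: "countable I" "I \<noteq> {}"
    unfolding I_def using E(1) countable_rat by (auto intro!: countable_SIGMA countable_Int1)
  define p where "p = from_nat_into I"
  have pI: "p n \<in> I" for n unfolding p_def using I(2) by (rule from_nat_into)
  have pS: "\<exists>n. p n = x" if "x \<in> I" for x unfolding p_def using from_nat_into_surj[OF I(1) that] .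
  define P where "P n s = convergent (\<lambda>j. measure (path (s j) (fst (p n))) (snd (p n)))" for n and s :: "nat \<Rightarrow> nat"
  interpret subseqs P
  proof
    fix n and s :: "nat \<Rightarrow> nat"
    assume "strict_mono s"
    have q: "0 \<le> fst (p n)" using pI[of n] by (auto simp: I_def)
    let ?f = "\<lambda>j. measure (path (s j) (fst (p n))) (snd (p n))"
    have "norm (?f j) \<le> M" for j
    proof -
      note a = admissible_path[OF q, of "s j"]
      interpret finite_measure "path (s j) (fst (p n))" by (rule admissible_finite[OF a])
      show ?thesis using bounded_measure[of "snd (p n)"] admissible_mass[OF a] admissible_space[OF a] by simp
    qed
    then have "bounded (range ?f)" unfolding bounded_iff by blast
    from bounded_imp_convergent_subsequence[OF this]
    obtain l r where "strict_mono r" "(?f \<circ> r) \<longlonglongrightarrow> l" by blast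
    then show "\<exists>r'. strict_mono r' \<and> P n (s \<circ> r')" unfolding P_def by (auto simp: comp_def convergent_def)
  qed
  define r where "r = diagseq"
  have r: "strict_mono r" unfolding r_def by (rule subseq_diagseq)
  have Pn: "P n r" for n
  proof -
    \<comment> \<open>The diagonal sequence is a subsequence of the \<open>n\<close>-th extraction
      only after its first terms; convergence ignores them.\<close>
    have "P n (diagseq \<circ> ((+) (Suc n)))"
    proof (rule diagseq_holds)
      fix r s n assume "strict_mono (r :: nat \<Rightarrow> nat)" "P n s"
      then show "P n (s \<circ> r)" unfolding P_def
        using convergent_subseq_convergent[of "\<lambda>j. measure (path (s j) (fst (p n))) (snd (p n))" r] by (simp add: comp_def)
    qed
    then have "convergent (\<lambda>j. measure (path (r (j + Suc n)) (fst (p n))) (snd (p n)))"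
      unfolding P_def r_def by (simp add: comp_def add.commute)
    then show ?thesis unfolding P_def by (rule convergent_ignore_initial_segment[THEN iffD1])
  qed
  have rat: "convergent (\<lambda>j. measure (path (r j) q) A)" if "q \<in> \<rat>" "0 \<le> q" "A \<in> sets borel" for q A
  proof (rule convergent_from_generator[OF that(2) E(2,4) _ that(3)])
    fix B assume "B \<in> E"
    then have "(q, B) \<in> I" using that by (simp add: I_def)
    then obtain n where "p n = (q, B)" using pS by blast
    then show "convergent (\<lambda>j. measure (path (r j) q) B)" using Pn[of n] by (simp add: P_def)
  qed
  show ?thesis
  proof (rule that[OF r])
    fix t :: real and A :: "phase set" assume t: "0 \<le> t" and A: "A \<in> sets borel"
    show "convergent (\<lambda>j. measure (path (r j) t) A)"
    proof (rule convergent_from_generator[OF t _ _ _ A])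
      show "Int_stable {C :: phase set. closed C}" by (rule Int_stableI) auto
      show "sets borel = sigma_sets UNIV {C :: phase set. closed C}"
        by (subst borel_eq_closed) (rule sets_measure_of, simp)
      fix C :: "phase set" assume "C \<in> {C. closed C}"
      then show "convergent (\<lambda>j. measure (path (r j) t) C)"
      proof (cases "C = {}")
        case True then show ?thesis by (simp add: convergent_const)
      next
        case False
        have "closed C" using \<open>C \<in> {C. closed C}\<close> by simp
        show ?thesis
          by (rule convergent_closed_path[OF r t _ \<open>closed C\<close> False]) (rule rat, assumption+)
      qed
    qed
  qed
qed

text \<open>Setwise convergence carries only bounded integrands to the limit, so the square of the
  speed is truncated at \<open>k\<close>; monotone convergence then removes the truncation.\<close>

lemma limit_energy:
  assumes t: "0 \<le> t" and N: "admissible c N"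
    and conv: "\<And>A. A \<in> sets borel \<Longrightarrow> (\<lambda>j. measure (path (r j) t) A) \<longlonglongrightarrow> measure N A"
  shows "integrable N (\<lambda>z. (norm (snd z))\<^sup>2) \<and> (LINT z|N. (norm (snd z))\<^sup>2) \<le> energy_bound"
proof -
  define f where "f k z = min ((norm (snd z))\<^sup>2) (real k)" for k :: nat and z :: phase
  have fm: "f k \<in> borel_measurable borel" for k
  proof -
    have "(\<lambda>z. f k z) \<in> borel_measurable borel" unfolding f_def
      by (intro borel_measurable_min norm_sq_measurable borel_measurable_const)
    then show ?thesis by simp
  qed
  have fb: "\<bar>f k z\<bar> \<le> real k" for k z by (simp add: f_def)
  have fi: "integrable N (f k)" for k by (rule admissible_integrable_bounded(1)[OF N fm]) (use fb in simp)
  have le: "(LINT z|N. f k z) \<le> energy_bound" for k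
  proof (rule LIMSEQ_le_const2)
    show "(\<lambda>j. LINT z|path (r j) t. f k z) \<longlonglongrightarrow> (LINT z|N. f k z)"
    proof (rule integral_setwise_tendsto)
      show "finite_measure (path (r n) t)" "sets (path (r n) t) = sets N" for n
        using admissible_finite[OF admissible_path[OF t]] admissible_sets[OF admissible_path[OF t]] admissible_sets[OF N] by auto
      show "f k \<in> borel_measurable N" by (rule admissible_measurable[OF N fm])
      show "finite_measure N" by (rule admissible_finite[OF N])
    qed (use conv admissible_sets[OF N] fb in auto)
    have "(LINT z|path (r j) t. f k z) \<le> energy_bound" for j
    proof -
      note a = admissible_path[OF t, of "r j"]
      have "(LINT z|path (r j) t. f k z) \<le> (LINT z|path (r j) t. (norm (snd z))\<^sup>2)"
      proof (rule integral_mono)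
        show "integrable (path (r j) t) (f k)" by (rule admissible_integrable_bounded(1)[OF a fm]) (use fb in simp)
        show "integrable (path (r j) t) (\<lambda>z. (norm (snd z))\<^sup>2)" by (rule integrable_snd_sq[OF a moments_path(1)[OF t]])
      qed (simp add: f_def)
      then show ?thesis using moments_path(3)[OF t, of "r j"] by linarith
    qed
    then show "\<exists>n0. \<forall>j\<ge>n0. (LINT z|path (r j) t. f k z) \<le> energy_bound" by blast
  qed
  have mono: "(LINT z|N. f k z) \<le> (LINT z|N. f k' z)" if "k \<le> k'" for k k'
    by (rule integral_mono[OF fi fi]) (use that in \<open>auto simp: f_def min_def\<close>)
  have "incseq (\<lambda>k. LINT z|N. f k z)" using mono by (simp add: incseq_def)
  then obtain x where x: "(\<lambda>k. LINT z|N. f k z) \<longlonglongrightarrow> x"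
    using incseq_convergent[of "\<lambda>k. LINT z|N. f k z" energy_bound] le by blast
  have ae: "AE z in N. mono (\<lambda>k. f k z)" by (intro AE_I2 monoI) (auto simp: f_def min_def)
  have lim: "AE z in N. (\<lambda>k. f k z) \<longlonglongrightarrow> (norm (snd z))\<^sup>2"
  proof (intro AE_I2 tendsto_eventually)
    fix z :: phase
    obtain k0 :: nat where "(norm (snd z))\<^sup>2 \<le> real k0" using real_arch_simple by blast
    then show "\<forall>\<^sub>F k in sequentially. f k z = (norm (snd z))\<^sup>2"
      unfolding eventually_sequentially f_def by (intro exI[of _ k0]) (auto simp: min_def)
  qed
  have m: "(\<lambda>z. (norm (snd z))\<^sup>2) \<in> borel_measurable N" by (rule admissible_measurable[OF N norm_sq_measurable(2)])
  have "integrable N (\<lambda>z. (norm (snd z))\<^sup>2)" by (rule integrable_monotone_convergence[OF fi ae lim x m])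
  moreover have "(LINT z|N. (norm (snd z))\<^sup>2) = x" by (rule integral_monotone_convergence[OF fi ae lim x m])
  moreover have "x \<le> energy_bound" by (rule LIMSEQ_le_const2[OF x]) (use le in auto)
  ultimately show ?thesis by simp
qed

lemma limit_path:
  obtains r nu where "strict_mono r" "\<And>t. 0 \<le> t \<Longrightarrow> admissible (K0 * exp (4 * accel_lip * t)) (nu t)"
    "\<And>t A. 0 \<le> t \<Longrightarrow> A \<in> sets borel \<Longrightarrow> (\<lambda>j. measure (path (r j) t) A) \<longlonglongrightarrow> measure (nu t) A"
    "\<And>t. 0 \<le> t \<Longrightarrow> integrable (nu t) (\<lambda>z. (norm (snd z))\<^sup>2) \<and> (LINT z|nu t. (norm (snd z))\<^sup>2) \<le> energy_bound"
proof -
  obtain r where r: "strict_mono r"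
    and cv: "\<And>t A. 0 \<le> t \<Longrightarrow> A \<in> sets borel \<Longrightarrow> convergent (\<lambda>j. measure (path (r j) t) A)"
    by (rule convergent_subsequence) (rule that, assumption, simp)
  have "\<exists>N. admissible (K0 * exp (4 * accel_lip * t)) N \<and> (\<forall>A\<in>sets borel. (\<lambda>j. measure (path (r j) t) A) \<longlonglongrightarrow> measure N A)"
    if t: "0 \<le> t" for t
  proof -
    obtain N where N: "finite_measure N" "sets N = sets borel"
      "\<And>A. A \<in> sets borel \<Longrightarrow> (\<lambda>n. measure (path (r n) t) A) \<longlonglongrightarrow> measure N A"
      by (rule unif_dom_seq.limit_measure_exists[OF unif_dom_path[OF t] cv[OF t]]) (assumption, rule that, assumption, assumption, simp)
    interpret N: finite_measure N by fact
    have "measure N UNIV = M"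
      using LIMSEQ_unique[OF N(3)[of UNIV]] admissible_mass[OF admissible_path[OF t]] by simp
    moreover have "emeasure N A \<le> ennreal (K0 * exp (4 * accel_lip * t)) * emeasure lborel A" if A: "A \<in> sets borel" for A
    proof (cases "ennreal (K0 * exp (4 * accel_lip * t)) * emeasure lborel A")
      case (real x)
      have "measure (path (r n) t) A \<le> x" for n
      proof -
        note a = admissible_path[OF t, of "r n"]
        interpret finite_measure "path (r n) t" by (rule admissible_finite[OF a])
        show ?thesis using admissible_dens[OF a A] unfolding real emeasure_eq_measure using real(1) by simp
      qed
      then have "measure N A \<le> x" by (intro LIMSEQ_le_const2[OF N(3)[OF A]]) auto
      then show ?thesis unfolding real N.emeasure_eq_measure by (rule ennreal_leI)
    qed simp
    ultimately have "admissible (K0 * exp (4 * accel_lip * t)) N" using N admissible_nonneg[OF admissible_path[OF t]] unfolding admissible_def by auto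
    then show ?thesis using N(3) by blast
  qed
  then have "\<forall>t\<in>{0..}. \<exists>N. admissible (K0 * exp (4 * accel_lip * t)) N \<and> (\<forall>A\<in>sets borel. (\<lambda>j. measure (path (r j) t) A) \<longlonglongrightarrow> measure N A)"
    by simp
  \<comment> \<open>The limit is chosen separately for each time, so nothing is known yet about its
    dependence on \<open>t\<close> except that it is a pointwise limit of piecewise constant
    paths.\<close>
  from bchoice[OF this] obtain nu where nu': "\<forall>t\<in>{0..}. admissible (K0 * exp (4 * accel_lip * t)) (nu t) \<and>
     (\<forall>A\<in>sets borel. (\<lambda>j. measure (path (r j) t) A) \<longlonglongrightarrow> measure (nu t) A)" ..
  have nu: "admissible (K0 * exp (4 * accel_lip * t)) (nu t)" if "0 \<le> t" for t using nu' that by simp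
  have nuA: "(\<lambda>j. measure (path (r j) t) A) \<longlonglongrightarrow> measure (nu t) A" if "0 \<le> t" "A \<in> sets borel" for t A using nu' that by simp
  show ?thesis
  proof (rule that[OF r nu nuA])
    show "integrable (nu t) (\<lambda>z. (norm (snd z))\<^sup>2) \<and> (LINT z|nu t. (norm (snd z))\<^sup>2) \<le> energy_bound" if "0 \<le> t" for t
      by (rule limit_energy[OF that nu[OF that] nuA[OF that]])
  qed
qed

end

section \<open>Passage to the limit\<close>

lemma floor_index_measurable: "(\<lambda>s::real. nat \<lfloor>s / h\<rfloor>) \<in> measurable borel (count_space UNIV)"
  by measurable

text \<open>The integrand is constant on grid cells, so the complete cells add up to the sum
  exactly; the error is the last incomplete cell, of length at most \<open>h\<close>.\<close>

lemma step_function_integral: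
  fixes q :: "nat \<Rightarrow> real"
  assumes q: "\<And>j. \<bar>q j\<bar> \<le> B" and h: "0 < h" and t: "0 \<le> t"
  shows "\<bar>(LINT s:{0..t}|lborel. q (nat \<lfloor>s / h\<rfloor>)) - (\<Sum>j<nat \<lfloor>t / h\<rfloor>. h * q j)\<bar> \<le> h * B"
proof -
  define f where "f s = q (nat \<lfloor>s / h\<rfloor>)" for s
  have fm: "f \<in> borel_measurable borel" unfolding f_def
    by (rule measurable_compose[OF floor_index_measurable]) simp
  have fb: "\<bar>f s\<bar> \<le> B" for s unfolding f_def by (rule q)
  have B: "0 \<le> B" using q[of 0] by linarith
  have int: "integrable lborel (\<lambda>s. indicat_real A s * f s)" if "A \<in> sets borel" "A \<subseteq> {0..b}" for A b
  proof (rule Bochner_Integration.integrable_bound[of lborel "\<lambda>s. B * indicat_real {0..b} s"])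
    show "integrable lborel (\<lambda>s. B * indicat_real {0..b} s)" by (intro integrable_mult_right integrable_real_indicator) (auto simp: emeasure_lborel_Icc_eq)
    show "(\<lambda>s. indicat_real A s * f s) \<in> borel_measurable lborel" using that fm by auto
    show "AE s in lborel. norm (indicat_real A s * f s) \<le> norm (B * indicat_real {0..b} s)"
      using that(2) fb B by (intro AE_I2) (auto simp: indicator_def)
  qed
  have sum: "(LINT s|lborel. indicat_real {0..<real k * h} s * f s) = (\<Sum>j<k. h * q j)" for k
  proof (induction k)
    case 0 show ?case by simp
  next
    case (Suc k)
    let ?I = "{real k * h..<real (Suc k) * h}"
    have kh: "0 \<le> real k * h" "real k * h \<le> real (Suc k) * h" using h by (auto simp: mult_right_mono)
    have fq: "f s = q k" if "s \<in> ?I" for s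
    proof -
      have "real k \<le> s / h" "s / h < real k + 1" using that h by (auto simp: pos_le_divide_eq pos_divide_less_eq algebra_simps)
      then have "\<lfloor>s / h\<rfloor> = int k" by (intro floor_unique) auto
      then show ?thesis by (simp add: f_def)
    qed
    have "(LINT s|lborel. indicat_real {0..<real (Suc k) * h} s * f s) =
       (LINT s|lborel. indicat_real {0..<real k * h} s * f s + indicat_real ?I s * f s)"
      using kh by (intro Bochner_Integration.integral_cong) (auto simp: indicator_def)
    also have "\<dots> = (LINT s|lborel. indicat_real {0..<real k * h} s * f s) + (LINT s|lborel. indicat_real ?I s * f s)"
    proof (rule Bochner_Integration.integral_add)
      show "integrable lborel (\<lambda>s. indicat_real {0..<real k * h} s * f s)" by (rule int[of _ "real k * h"]) auto
      show "integrable lborel (\<lambda>s. indicat_real ?I s * f s)" by (rule int[of _ "real (Suc k) * h"]) (use kh in auto)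
    qed
    also have "(LINT s|lborel. indicat_real ?I s * f s) = (LINT s|lborel. q k * indicat_real ?I s)"
      using fq by (intro Bochner_Integration.integral_cong) (auto simp: indicator_def)
    also have "\<dots> = h * q k" using kh by (simp add: algebra_simps)
    finally show ?case using Suc by simp
  qed
  define k where "k = nat \<lfloor>t / h\<rfloor>"
  have kt: "real k * h \<le> t" "t < (real k + 1) * h"
  proof -
    have f: "real k = of_int \<lfloor>t / h\<rfloor>" using t h by (simp add: k_def)
    have 1: "of_int \<lfloor>t / h\<rfloor> \<le> t / h" and 2: "t / h < of_int \<lfloor>t / h\<rfloor> + 1" by linarith+
    show "real k * h \<le> t" unfolding f by (rule pos_le_divide_eq[OF h, THEN iffD1, OF 1])
    show "t < (real k + 1) * h" unfolding f by (rule pos_divide_less_eq[OF h, THEN iffD1, OF 2])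
  qed
  have k0: "0 \<le> real k * h" using h by simp
  have "(LINT s:{0..t}|lborel. f s) = (LINT s|lborel. indicat_real {0..<real k * h} s * f s + indicat_real {real k * h..t} s * f s)"
    unfolding set_lebesgue_integral_def using kt k0 by (intro Bochner_Integration.integral_cong) (auto simp: indicator_def)
  also have "\<dots> = (LINT s|lborel. indicat_real {0..<real k * h} s * f s) + (LINT s|lborel. indicat_real {real k * h..t} s * f s)"
  proof (rule Bochner_Integration.integral_add)
    show "integrable lborel (\<lambda>s. indicat_real {0..<real k * h} s * f s)" by (rule int[of _ "real k * h"]) auto
    show "integrable lborel (\<lambda>s. indicat_real {real k * h..t} s * f s)" by (rule int[of _ t]) (use k0 in auto)
  qed
  finally have e: "(LINT s:{0..t}|lborel. f s) - (\<Sum>j<k. h * q j) = (LINT s|lborel. indicat_real {real k * h..t} s * f s)"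
    unfolding sum by simp
  have "\<bar>LINT s|lborel. indicat_real {real k * h..t} s * f s\<bar> \<le> (LINT s|lborel. \<bar>indicat_real {real k * h..t} s * f s\<bar>)"
    by (rule integral_abs_bound)
  also have "\<dots> \<le> (LINT s|lborel. B * indicat_real {real k * h..t} s)"
  proof (rule integral_mono')
    show "integrable lborel (\<lambda>s. B * indicat_real {real k * h..t} s)" by (intro integrable_mult_right integrable_real_indicator) (auto simp: emeasure_lborel_Icc_eq)
    show "\<bar>indicat_real {real k * h..t} s * f s\<bar> \<le> B * indicat_real {real k * h..t} s" for s using fb B by (simp add: indicator_def)
    show "0 \<le> B * indicat_real {real k * h..t} s" for s using B by simp
  qed
  also have "\<dots> = B * (t - real k * h)" using kt by simp
  also have "\<dots> \<le> h * B" using kt B mult_left_mono[of "t - real k * h" h B] by (simp add: algebra_simps)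
  finally show ?thesis using e unfolding f_def k_def by simp
qed

text \<open>A function of the grid index is measurable in time whatever its values. The limit
  \<open>f\<close> inherits measurability as a pointwise limit, and dominated convergence does the
  rest.\<close>

lemma step_function_limit:
  fixes \<beta> :: "nat \<Rightarrow> nat \<Rightarrow> real" and h :: "nat \<Rightarrow> real"
  assumes b: "\<And>n k. \<bar>\<beta> n k\<bar> \<le> B" and t: "0 \<le> t"
    and lim: "\<And>s. 0 \<le> s \<Longrightarrow> (\<lambda>n. \<beta> n (nat \<lfloor>s / h n\<rfloor>)) \<longlonglongrightarrow> f s"
  shows "set_integrable lborel {0..t} f"
    and "(\<lambda>n. LINT s:{0..t}|lborel. \<beta> n (nat \<lfloor>s / h n\<rfloor>)) \<longlonglongrightarrow> (LINT s:{0..t}|lborel. f s)"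
proof -
  let ?g = "\<lambda>n s. indicat_real {0..t} s *\<^sub>R \<beta> n (nat \<lfloor>s / h n\<rfloor>)"
  let ?G = "\<lambda>s. indicat_real {0..t} s *\<^sub>R f s"
  have gm: "?g n \<in> borel_measurable lborel" for n
  proof -
    have "(\<lambda>s. \<beta> n (nat \<lfloor>s / h n\<rfloor>)) \<in> borel_measurable borel"
      by (rule measurable_compose[OF floor_index_measurable[of "h n"], of "\<beta> n"]) simp
    then show ?thesis by simp
  qed
  have l: "(\<lambda>n. ?g n s) \<longlonglongrightarrow> ?G s" for s
    using lim[of s] by (cases "s \<in> {0..t}") (auto intro: tendsto_scaleR)
  have Gm: "?G \<in> borel_measurable lborel" by (rule borel_measurable_LIMSEQ_real[OF l gm])
  have w: "integrable lborel (\<lambda>s. B * indicat_real {0..t} s)" by (intro integrable_mult_right integrable_real_indicator) (auto simp: emeasure_lborel_Icc_eq)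
  have nb: "norm (?g n s) \<le> B * indicat_real {0..t} s" for n s using b[of n "nat \<lfloor>s / h n\<rfloor>"] by (simp add: indicator_def)
  show "set_integrable lborel {0..t} f" unfolding set_integrable_def
    by (rule integrable_dominated_convergence[where s="?g", OF Gm gm w AE_I2[OF l] AE_I2[OF nb]])
  show "(\<lambda>n. LINT s:{0..t}|lborel. \<beta> n (nat \<lfloor>s / h n\<rfloor>)) \<longlonglongrightarrow> (LINT s:{0..t}|lborel. f s)"
    unfolding set_lebesgue_integral_def
    by (rule integral_dominated_convergence[where s="?g", OF Gm gm w AE_I2[OF l] AE_I2[OF nb]])
qed

section \<open>Gradients of test functions on phase space\<close>

lemma phase_derivative:
  fixes \<phi> :: "phase \<Rightarrow> real"
  assumes d: "\<And>z. \<phi> differentiable (at z)"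
  shows "frechet_derivative \<phi> (at z) (a, b) = a \<bullet> grad_x \<phi> z + b \<bullet> grad_v \<phi> z"
    and "grad_x \<phi> z $ i = frechet_derivative \<phi> (at z) (axis i 1, 0)"
    and "grad_v \<phi> z $ i = frechet_derivative \<phi> (at z) (0, axis i 1)"
proof -
  let ?D = "frechet_derivative \<phi> (at z)"
  have D: "(\<phi> has_derivative ?D) (at z)" using d frechet_derivative_works by blast
  have Dx: "(\<phi> has_derivative ?D) (at (fst z, snd z))" using D by simp
  have "((\<lambda>x. (x, snd z)) has_derivative (\<lambda>h. (h, 0))) (at (fst z))" by (auto intro!: derivative_eq_intros)
  from has_derivative_compose[OF this Dx]
  have "((\<lambda>x. \<phi> (x, snd z)) has_derivative (\<lambda>h. ?D (h, 0))) (at (fst z))" .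
  from frechet_derivative_at[OF this] have x: "frechet_derivative (\<lambda>x. \<phi> (x, snd z)) (at (fst z)) = (\<lambda>h. ?D (h, 0))" ..
  have "((\<lambda>v. (fst z, v)) has_derivative (\<lambda>h. (0, h))) (at (snd z))" by (auto intro!: derivative_eq_intros)
  from has_derivative_compose[OF this Dx]
  have "((\<lambda>v. \<phi> (fst z, v)) has_derivative (\<lambda>h. ?D (0, h))) (at (snd z))" .
  from frechet_derivative_at[OF this] have v: "frechet_derivative (\<lambda>v. \<phi> (fst z, v)) (at (snd z)) = (\<lambda>h. ?D (0, h))" ..
  show gx: "grad_x \<phi> z $ i = ?D (axis i 1, 0)" for i unfolding grad_x_def grad_def x by simp
  show gv: "grad_v \<phi> z $ i = ?D (0, axis i 1)" for i unfolding grad_v_def grad_def v by simp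
  have lin: "linear ?D" by (rule has_derivative_linear[OF D])
  have ab: "(a, b) = (a $ 1) *\<^sub>R (axis 1 1, 0) + ((a $ 2) *\<^sub>R (axis 2 1, 0) + ((b $ 1) *\<^sub>R (0, axis 1 1) + (b $ 2) *\<^sub>R (0, axis 2 1)))"
    by (simp add: vec_eq_iff axis_def forall_2)
  have "?D (a, b) = (a $ 1) * ?D (axis 1 1, 0) + ((a $ 2) * ?D (axis 2 1, 0) + ((b $ 1) * ?D (0, axis 1 1) + (b $ 2) * ?D (0, axis 2 1)))"
    by (subst ab) (simp only: linear_add[OF lin] linear_scale[OF lin] real_scaleR_def)
  then show "?D (a, b) = a \<bullet> grad_x \<phi> z + b \<bullet> grad_v \<phi> z"
    by (simp add: inner_vec_def sum_2 gx gv)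
qed

text \<open>\<open>\<rho>\<close> is a radius of the support. The products with
  \<open>norm (snd z)\<close> are bounded because the gradients vanish where the velocity exceeds
  \<open>\<rho>\<close>; this makes the unbounded coefficient \<open>v\<close> of the equation
  harmless.\<close>

lemma test_fun_gradients:
  fixes \<phi> :: "phase \<Rightarrow> real"
  assumes T: "test_fun UNIV \<phi>"
  obtains P \<rho> where "0 \<le> P" "0 \<le> \<rho>" "\<And>z. norm (grad_x \<phi> z) \<le> P" "\<And>z. norm (grad_v \<phi> z) \<le> P"
    "\<And>z. norm (snd z) * norm (grad_x \<phi> z) \<le> \<rho> * P" "\<And>z. norm (snd z) * norm (grad_v \<phi> z) \<le> \<rho> * P"
    "grad_x \<phi> \<in> borel_measurable borel" "grad_v \<phi> \<in> borel_measurable borel"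
proof -
  have C: "C_k k \<phi>" for k using T by (simp add: test_fun_def smooth_fun_def)
  have K: "compact (closure {z. \<phi> z \<noteq> 0})" using T by (simp add: test_fun_def)
  have d: "\<phi> differentiable (at z)" for z using C[of "Suc 0"] unfolding C_k.simps by blast
  obtain P where P: "0 \<le> P" "\<And>x h. \<bar>frechet_derivative \<phi> (at x) h\<bar> \<le> P * norm h"
    using compact_support_deriv_bound[OF C K] by blast
  note pd = phase_derivative[OF d]
  have nx: "norm (grad_x \<phi> z) \<le> P" for z
  proof -
    have "frechet_derivative \<phi> (at z) (grad_x \<phi> z, 0) = norm (grad_x \<phi> z) * norm (grad_x \<phi> z)"
      unfolding pd(1) by (simp add: dot_square_norm power2_eq_square)
    then have "norm (grad_x \<phi> z) * norm (grad_x \<phi> z) \<le> P * norm (grad_x \<phi> z)"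
      using P(2)[of z "(grad_x \<phi> z, 0)"] by (simp add: norm_Pair)
    then show ?thesis using P(1) by (cases "grad_x \<phi> z = 0") auto
  qed
  have nv: "norm (grad_v \<phi> z) \<le> P" for z
  proof -
    have "frechet_derivative \<phi> (at z) (0, grad_v \<phi> z) = norm (grad_v \<phi> z) * norm (grad_v \<phi> z)"
      unfolding pd(1) by (simp add: dot_square_norm power2_eq_square)
    then have "norm (grad_v \<phi> z) * norm (grad_v \<phi> z) \<le> P * norm (grad_v \<phi> z)"
      using P(2)[of z "(0, grad_v \<phi> z)"] by (simp add: norm_Pair)
    then show ?thesis using P(1) by (cases "grad_v \<phi> z = 0") auto
  qed
  have "bounded (closure {z. \<phi> z \<noteq> 0})" using K by (rule compact_imp_bounded)
  then obtain \<rho> where \<rho>: "0 < \<rho>" "\<And>z. z \<in> closure {z. \<phi> z \<noteq> 0} \<Longrightarrow> norm z \<le> \<rho>" unfolding bounded_pos by blast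
  have out: "norm (snd z) \<le> \<rho> \<or> grad_x \<phi> z = 0 \<and> grad_v \<phi> z = 0" for z
  proof (cases "z \<in> closure {z. \<phi> z \<noteq> 0}")
    case True then show ?thesis using \<rho>(2)[OF True] norm_snd_le[of "snd z" "fst z"] by simp
  next
    case False
    then show ?thesis using pd(2,3)[of z] frechet_derivative_outside_support[OF False] by (simp add: vec_eq_iff)
  qed
  have cont: "continuous_on UNIV (\<lambda>z. frechet_derivative \<phi> (at z) h)" for h
    using C[of "Suc 0"] unfolding C_k.simps by blast
  have "continuous_on UNIV (\<lambda>z. \<chi> i. grad_x \<phi> z $ i)" "continuous_on UNIV (\<lambda>z. \<chi> i. grad_v \<phi> z $ i)"
    unfolding pd(2,3) by (intro continuous_on_vec_lambda cont)+
  then have m: "grad_x \<phi> \<in> borel_measurable borel" "grad_v \<phi> \<in> borel_measurable borel"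
    by (simp_all add: borel_measurable_continuous_onI)
  show ?thesis
  proof (rule that[OF P(1) less_imp_le[OF \<rho>(1)] nx nv _ _ m])
    show "norm (snd z) * norm (grad_x \<phi> z) \<le> \<rho> * P" for z
      using out[of z] nx[of z] P(1) \<rho>(1) by (auto intro: mult_mono)
    show "norm (snd z) * norm (grad_v \<phi> z) \<le> \<rho> * P" for z
      using out[of z] nv[of z] P(1) \<rho>(1) by (auto intro: mult_mono)
  qed
qed

locale mean_field_limit = mean_field +
  fixes r :: "nat \<Rightarrow> nat" and nu :: "real \<Rightarrow> phase measure"
  assumes r: "strict_mono r" and nu_admissible: "\<And>t. 0 \<le> t \<Longrightarrow> admissible (K0 * exp (4 * accel_lip * t)) (nu t)"
    and nu_lim: "\<And>t A. 0 \<le> t \<Longrightarrow> A \<in> sets borel \<Longrightarrow> (\<lambda>j. measure (path (r j) t) A) \<longlonglongrightarrow> measure (nu t) A"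
    and nu_energy: "\<And>t. 0 \<le> t \<Longrightarrow> integrable (nu t) (\<lambda>z. (norm (snd z))\<^sup>2) \<and> (LINT z|nu t. (norm (snd z))\<^sup>2) \<le> energy_bound"
    and unif_pair: "\<And>t. 0 \<le> t \<Longrightarrow> unif_dom_seq (borel \<Otimes>\<^sub>M borel) (\<lambda>j. path (r j) t \<Otimes>\<^sub>M path (r j) t)"
    and unif_single: "\<And>t. 0 \<le> t \<Longrightarrow> unif_dom_seq borel (\<lambda>j. path (r j) t)"
begin

lemma integral_limit:
  fixes \<phi> :: "phase \<Rightarrow> real"
  assumes t: "0 \<le> t" and \<phi>: "\<phi> \<in> borel_measurable borel" "\<And>z. \<bar>\<phi> z\<bar> \<le> B"
  shows "(\<lambda>j. LINT z|path (r j) t. \<phi> z) \<longlonglongrightarrow> (LINT z|nu t. \<phi> z)"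
proof (rule integral_setwise_tendsto[where B=B])
  note a = admissible_path[OF t] and N = nu_admissible[OF t]
  show "finite_measure (path (r n) t)" "sets (path (r n) t) = sets (nu t)" for n
    using admissible_finite[OF a] admissible_sets[OF a] admissible_sets[OF N] by auto
  show "finite_measure (nu t)" by (rule admissible_finite[OF N])
  show "\<phi> \<in> borel_measurable (nu t)" by (rule admissible_measurable[OF N \<phi>(1)])
  show "(\<lambda>n. measure (path (r n) t) A) \<longlonglongrightarrow> measure (nu t) A" if "A \<in> sets (nu t)" for A
    using nu_lim[OF t] that admissible_sets[OF N] by simp
qed (rule \<phi>(2))

end

context mean_field
begin

text \<open>By Fubini the quadratic term is a linear functional of the product measure with a
  bounded measurable integrand, the form to which \<open>pair_setwise_tendsto\<close>
  applies.\<close>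

lemma double_integral:
  fixes D :: "phase \<Rightarrow> real^2"
  assumes mu: "admissible c mu" and D: "D \<in> borel_measurable borel" "\<And>z. norm (D z) \<le> P" "0 \<le> P"
  shows "(LINT z|mu. (LINT y|mu. F (z - y)) \<bullet> D z) = (LINT p|(mu \<Otimes>\<^sub>M mu). F (fst p - snd p) \<bullet> D (fst p))"
    and "(\<lambda>p. F (fst p - snd p) \<bullet> D (fst p)) \<in> borel_measurable (borel \<Otimes>\<^sub>M borel)"
    and "\<bar>F (fst p - snd p) \<bullet> D (fst p)\<bar> \<le> BF * P"
proof -
  interpret finite_measure mu by (rule admissible_finite[OF mu])
  interpret pp: pair_sigma_finite mu mu ..
  show b: "\<bar>F (fst p - snd p) \<bullet> D (fst p)\<bar> \<le> BF * P" for p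
    using F_b D BF_nonneg by (intro order_trans[OF Cauchy_Schwarz_ineq2] mult_mono) auto
  have s: "sets (mu \<Otimes>\<^sub>M mu) = sets (borel \<Otimes>\<^sub>M borel)" by (rule sets_pair_measure_cong[OF admissible_sets[OF mu] admissible_sets[OF mu]])
  have "(\<lambda>p :: phase \<times> phase. fst p - snd p) \<in> borel_measurable borel" "(fst :: phase \<times> phase \<Rightarrow> phase) \<in> borel_measurable borel"
    by (intro borel_measurable_continuous_onI continuous_intros)+
  from measurable_compose[OF this(1) F_m] measurable_compose[OF this(2) D(1)]
  have "(\<lambda>p. F (fst p - snd p) \<bullet> D (fst p)) \<in> borel_measurable borel" by (intro borel_measurable_inner)
  then show m: "(\<lambda>p. F (fst p - snd p) \<bullet> D (fst p)) \<in> borel_measurable (borel \<Otimes>\<^sub>M borel)" unfolding borel_prod .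
  interpret fp: finite_measure "mu \<Otimes>\<^sub>M mu" by (intro finite_measure_pair_measure admissible_finite[OF mu])
  have "integrable (mu \<Otimes>\<^sub>M mu) (\<lambda>p. F (fst p - snd p) \<bullet> D (fst p))"
  proof (rule fp.integrable_const_bound[of _ "BF * P", OF AE_I2])
    show "(\<lambda>p. F (fst p - snd p) \<bullet> D (fst p)) \<in> borel_measurable (mu \<Otimes>\<^sub>M mu)"
      using m by (simp only: measurable_cong_sets[OF s refl])
  qed (use b in simp)
  from pp.integral_fst'[OF this]
  have "(LINT z|mu. LINT y|mu. F (z - y) \<bullet> D z) = (LINT p|(mu \<Otimes>\<^sub>M mu). F (fst p - snd p) \<bullet> D (fst p))" by simp
  moreover have "(LINT y|mu. F (z - y) \<bullet> D z) = (LINT y|mu. F (z - y)) \<bullet> D z" for z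
    by (rule integral_inner_left) (use admissible_integrable_bounded(1)[OF mu F_shift_measurable F_b] in simp)
  ultimately show "(LINT z|mu. (LINT y|mu. F (z - y)) \<bullet> D z) = (LINT p|(mu \<Otimes>\<^sub>M mu). F (fst p - snd p) \<bullet> D (fst p))" by simp
qed

end

section \<open>The weak equation for the scheme, up to consistency errors\<close>

context mean_field
begin

definition transport_term :: "(phase \<Rightarrow> real^2) \<Rightarrow> (phase \<Rightarrow> real^2) \<Rightarrow> phase measure \<Rightarrow> phase \<Rightarrow> real" where
  "transport_term Dx Dv mu z = snd z \<bullet> Dx z + (LINT y|mu. F (z - y)) \<bullet> Dv z + (g (fst z) - snd z) \<bullet> Dv z"

lemma conv_measurable: assumes "admissible c mu" shows "(\<lambda>z. LINT y|mu. F (z - y)) \<in> borel_measurable borel"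
proof -
  have "(\<lambda>z. accel_field mu z - g (fst z)) \<in> borel_measurable borel"
    by (intro borel_measurable_diff accel_field_measurable[OF assms] measurable_compose[OF phase_maps_measurable(1) g_m])
  then show ?thesis by (simp add: accel_field_def)
qed

lemma drift_terms:
  fixes Dx Dv :: "phase \<Rightarrow> real^2"
  assumes m: "Dx \<in> borel_measurable borel" "Dv \<in> borel_measurable borel"
    and b: "\<And>z. norm (Dv z) \<le> P" "\<And>z. norm (snd z) * norm (Dx z) \<le> \<rho> * P" "\<And>z. norm (snd z) * norm (Dv z) \<le> \<rho> * P" "0 \<le> P"
  shows "(\<lambda>z. snd z \<bullet> Dx z) \<in> borel_measurable borel" "\<And>z. \<bar>snd z \<bullet> Dx z\<bar> \<le> \<rho> * P"
    and "(\<lambda>z. (g (fst z) - snd z) \<bullet> Dv z) \<in> borel_measurable borel" "\<And>z. \<bar>(g (fst z) - snd z) \<bullet> Dv z\<bar> \<le> Bg * P + \<rho> * P"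
    and "admissible c mu \<Longrightarrow> (\<lambda>z. (LINT y|mu. F (z - y)) \<bullet> Dv z) \<in> borel_measurable borel"
    and "admissible c mu \<Longrightarrow> \<bar>(LINT y|mu. F (z - y)) \<bullet> Dv z\<bar> \<le> BF * M * P"
proof -
  show "(\<lambda>z. snd z \<bullet> Dx z) \<in> borel_measurable borel" "(\<lambda>z. (g (fst z) - snd z) \<bullet> Dv z) \<in> borel_measurable borel"
    by (intro borel_measurable_inner borel_measurable_diff phase_maps_measurable m measurable_compose[OF phase_maps_measurable(1) g_m])+
  show "(\<lambda>z. (LINT y|mu. F (z - y)) \<bullet> Dv z) \<in> borel_measurable borel" if "admissible c mu"
    by (intro borel_measurable_inner conv_measurable[OF that] m)
  show "\<bar>snd z \<bullet> Dx z\<bar> \<le> \<rho> * P" for z by (rule order_trans[OF Cauchy_Schwarz_ineq2 b(2)])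
  show "\<bar>(LINT y|mu. F (z - y)) \<bullet> Dv z\<bar> \<le> BF * M * P" if "admissible c mu"
    by (rule order_trans[OF Cauchy_Schwarz_ineq2 mult_mono[OF conv_bound[OF that] b(1)]]) (use BF_nonneg M_nonneg in auto)
  show "\<bar>(g (fst z) - snd z) \<bullet> Dv z\<bar> \<le> Bg * P + \<rho> * P" for z
  proof -
    have "\<bar>(g (fst z) - snd z) \<bullet> Dv z\<bar> \<le> \<bar>g (fst z) \<bullet> Dv z\<bar> + \<bar>snd z \<bullet> Dv z\<bar>"
      unfolding inner_diff_left by (rule abs_triangle_ineq4)
    also have "\<dots> \<le> Bg * P + \<rho> * P"
    proof (rule add_mono)
      show "\<bar>g (fst z) \<bullet> Dv z\<bar> \<le> Bg * P"
        by (rule order_trans[OF Cauchy_Schwarz_ineq2 mult_mono[OF g_b b(1)]]) (use Bg_nonneg in auto)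
      show "\<bar>snd z \<bullet> Dv z\<bar> \<le> \<rho> * P" by (rule order_trans[OF Cauchy_Schwarz_ineq2 b(3)])
    qed
    finally show ?thesis .
  qed
qed

text \<open>Each step contributes an error of order \<open>h^2\<close> from two sources: the Taylor
  remainder of \<open>\<phi>\<close>, with constant \<open>Ct\<close>, and the use of the new
  velocity for moving positions, with constant \<open>P\<close>.\<close>

lemma scheme_weak:
  fixes \<phi> :: "phase \<Rightarrow> real"
  assumes T: "test_fun UNIV \<phi>"
  obtains C3 where "0 \<le> C3"
    "\<And>h k. small_step h \<Longrightarrow> \<bar>(LINT z|scheme h k. \<phi> z) - (LINT z|mu0. \<phi> z)
        - (\<Sum>j<k. h * (LINT z|scheme h j. transport_term (grad_x \<phi>) (grad_v \<phi>) (scheme h j) z))\<bar> \<le> real k * h\<^sup>2 * C3"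
proof -
  have C: "C_k k \<phi>" for k using T by (simp add: test_fun_def smooth_fun_def)
  have K: "compact (closure {z. \<phi> z \<noteq> 0})" using T by (simp add: test_fun_def)
  have d: "\<phi> differentiable (at z)" for z using C[of "Suc 0"] unfolding C_k.simps by blast
  have cont: "continuous_on UNIV \<phi>" using C[of 0] by simp
  have \<phi>m: "\<phi> \<in> borel_measurable borel" by (rule borel_measurable_continuous_onI[OF cont])
  have z0: "\<phi> z = 0" if "z \<notin> closure {z. \<phi> z \<noteq> 0}" for z
    using that closure_subset[of "{z. \<phi> z \<noteq> 0}"] by auto
  obtain B where B: "0 \<le> B" "\<And>z. \<bar>\<phi> z\<bar> \<le> B" using compact_support_bounded[OF cont K z0] by blast
  obtain Ct where Ct: "0 \<le> Ct" "\<And>z d. \<bar>\<phi> (z + d) - \<phi> z - frechet_derivative \<phi> (at z) d\<bar> \<le> Ct * (norm d)\<^sup>2"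
    using compact_support_taylor[OF C K] by blast
  obtain P \<rho> where P: "0 \<le> P" "0 \<le> \<rho>" "\<And>z. norm (grad_x \<phi> z) \<le> P" "\<And>z. norm (grad_v \<phi> z) \<le> P"
    "\<And>z. norm (snd z) * norm (grad_x \<phi> z) \<le> \<rho> * P" "\<And>z. norm (snd z) * norm (grad_v \<phi> z) \<le> \<rho> * P"
    "grad_x \<phi> \<in> borel_measurable borel" "grad_v \<phi> \<in> borel_measurable borel"
    using test_fun_gradients[OF T] by blast
  note dt = drift_terms[OF P(7,8,4,5,6,1)]
  let ?Q = "transport_term (grad_x \<phi>) (grad_v \<phi>)"
  have Qm: "?Q mu \<in> borel_measurable borel" if "admissible c mu" for c mu
  proof -
    have "(\<lambda>z. ?Q mu z) \<in> borel_measurable borel"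
      unfolding transport_term_def by (intro borel_measurable_add dt(1,3) dt(5)[OF that])
    then show ?thesis by simp
  qed
  have Qb: "\<bar>?Q mu z\<bar> \<le> \<rho> * P + BF * M * P + (Bg * P + \<rho> * P)" if "admissible c mu" for c mu z
    using dt(2)[of z] dt(4)[of z] dt(6)[OF that, of z] unfolding transport_term_def by linarith
  define C3 where "C3 = (Ct + P) * speed_bound"
  have inc: "\<bar>(LINT z|scheme h (Suc k). \<phi> z) - (LINT z|scheme h k. \<phi> z) - h * (LINT z|scheme h k. ?Q (scheme h k) z)\<bar> \<le> h\<^sup>2 * C3"
    if h: "small_step h" for h k
  proof -
    let ?mu = "scheme h k"
    note mu = admissible_scheme[OF h, of k]
    have h': "0 \<le> h" "h \<le> 1" using h by (auto simp: small_step_def)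
    have "\<bar>(LINT z|scheme h (Suc k). \<phi> z) - (LINT z|?mu. \<phi> z) - h * (LINT z|?mu. ?Q ?mu z)\<bar> \<le> (h\<^sup>2 * (Ct + P)) * speed_bound"
    proof (rule increment_scheme[OF h \<phi>m B(2) Qm[OF mu] Qb[OF mu]])
      show "0 \<le> h\<^sup>2 * (Ct + P)" using Ct(1) P(1) by simp
      fix z
      let ?d = "velocity_field ?mu h z"
      have lin: "linear (frechet_derivative \<phi> (at z))" using d by (rule linear_frechet_derivative)
      have "frechet_derivative \<phi> (at z) (h *\<^sub>R ?d) = h * frechet_derivative \<phi> (at z) ?d"
        using linear_scale[OF lin] by simp
      also have "frechet_derivative \<phi> (at z) ?d = ((1 - h) *\<^sub>R snd z + h *\<^sub>R accel_field ?mu z) \<bullet> grad_x \<phi> z + (accel_field ?mu z - snd z) \<bullet> grad_v \<phi> z"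
        unfolding velocity_field_def by (rule phase_derivative(1)[OF d])
      \<comment> \<open>The velocity after the kick exceeds the old one by
        \<open>h * (accel - v)\<close>; this term is not part of the equation and is split off as
        the second error.\<close>
      also have "\<dots> = ?Q ?mu z + h * ((accel_field ?mu z - snd z) \<bullet> grad_x \<phi> z)"
        unfolding transport_term_def accel_field_def by (simp add: algebra_simps)
      finally have D: "frechet_derivative \<phi> (at z) (h *\<^sub>R ?d) = h * ?Q ?mu z + h\<^sup>2 * ((accel_field ?mu z - snd z) \<bullet> grad_x \<phi> z)"
        by (simp add: algebra_simps power2_eq_square)
      have nd: "(norm ?d)\<^sup>2 \<le> 3 * (norm (snd z))\<^sup>2 + 3 * accel_bound\<^sup>2" by (rule velocity_field_bound[OF mu h'])
      have "norm (accel_field ?mu z - snd z) \<le> norm ?d" unfolding velocity_field_def by (rule norm_snd_le)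
      then have "norm (accel_field ?mu z - snd z) \<le> 1 + (norm ?d)\<^sup>2" using le_one_plus_square[of "norm ?d"] by simp
      then have "\<bar>(accel_field ?mu z - snd z) \<bullet> grad_x \<phi> z\<bar> \<le> (1 + (norm ?d)\<^sup>2) * P"
        using P(3)[of z] by (intro order_trans[OF Cauchy_Schwarz_ineq2] mult_mono) auto
      then have e1: "\<bar>h\<^sup>2 * ((accel_field ?mu z - snd z) \<bullet> grad_x \<phi> z)\<bar> \<le> h\<^sup>2 * ((1 + (norm ?d)\<^sup>2) * P)"
        unfolding abs_mult by (simp add: mult_left_mono)
      have "\<bar>\<phi> (z + h *\<^sub>R ?d) - \<phi> z - frechet_derivative \<phi> (at z) (h *\<^sub>R ?d)\<bar> \<le> Ct * (norm (h *\<^sub>R ?d))\<^sup>2" by (rule Ct(2))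
      also have "\<dots> = h\<^sup>2 * (Ct * (norm ?d)\<^sup>2)" by (simp add: power_mult_distrib)
      also have "\<dots> \<le> h\<^sup>2 * (Ct * (1 + (norm ?d)\<^sup>2))" using Ct(1) by (intro mult_left_mono) auto
      finally have "\<bar>\<phi> (step ?mu h z) - \<phi> z - h * ?Q ?mu z\<bar> \<le> h\<^sup>2 * (Ct * (1 + (norm ?d)\<^sup>2)) + h\<^sup>2 * ((1 + (norm ?d)\<^sup>2) * P)"
        using e1 unfolding D step_eq by linarith
      also have "\<dots> = h\<^sup>2 * (Ct + P) * (1 + (norm ?d)\<^sup>2)" by (simp add: algebra_simps)
      also have "\<dots> \<le> h\<^sup>2 * (Ct + P) * (1 + 3 * (norm (snd z))\<^sup>2 + 3 * accel_bound\<^sup>2)"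
        using nd Ct(1) P(1) by (intro mult_left_mono) auto
      finally show "\<bar>\<phi> (step ?mu h z) - \<phi> z - h * ?Q ?mu z\<bar> \<le> h\<^sup>2 * (Ct + P) * (1 + 3 * (norm (snd z))\<^sup>2 + 3 * accel_bound\<^sup>2)" .
    qed
    then show ?thesis by (simp only: C3_def mult.assoc)
  qed
  show ?thesis
  proof (rule that[of C3])
    show "0 \<le> C3" using Ct(1) P(1) speed_bound_nonneg by (simp add: C3_def)
    fix h k assume h: "small_step h"
    show "\<bar>(LINT z|scheme h k. \<phi> z) - (LINT z|mu0. \<phi> z)
        - (\<Sum>j<k. h * (LINT z|scheme h j. ?Q (scheme h j) z))\<bar> \<le> real k * h\<^sup>2 * C3"
    proof (induction k)
      case (Suc k)
      have "real (Suc k) * h\<^sup>2 * C3 = real k * h\<^sup>2 * C3 + h\<^sup>2 * C3" by (simp add: algebra_simps)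
      then show ?case using Suc inc[OF h, of k] unfolding sum.lessThan_Suc by linarith
    qed simp
  qed
qed

end

section \<open>The weak equation for the limit measures\<close>

context mean_field_limit
begin

lemma step_size_r_tendsto: "(\<lambda>j. step_size (r j)) \<longlonglongrightarrow> 0"
  using LIMSEQ_subseq_LIMSEQ[OF step_size_tendsto r] by (simp add: comp_def)

lemma interaction_limit:
  fixes D :: "phase \<Rightarrow> real^2"
  assumes t: "0 \<le> t" and D: "D \<in> borel_measurable borel" "\<And>z. norm (D z) \<le> P" "0 \<le> P"
  shows "(\<lambda>j. LINT z|path (r j) t. (LINT y|path (r j) t. F (z - y)) \<bullet> D z) \<longlonglongrightarrow> (LINT z|nu t. (LINT y|nu t. F (z - y)) \<bullet> D z)"
proof -
  note a = admissible_path[OF t] and N = nu_admissible[OF t]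
  let ?f = "\<lambda>p. F (fst p - snd p) \<bullet> D (fst p)"
  have sN: "sets (nu t \<Otimes>\<^sub>M nu t) = sets (borel \<Otimes>\<^sub>M borel)" by (rule sets_pair_measure_cong[OF admissible_sets[OF N] admissible_sets[OF N]])
  have sa: "sets (path (r n) t \<Otimes>\<^sub>M path (r n) t) = sets (borel \<Otimes>\<^sub>M borel)" for n by (rule sets_pair_measure_cong[OF admissible_sets[OF a] admissible_sets[OF a]])
  have "(\<lambda>j. LINT p|(path (r j) t \<Otimes>\<^sub>M path (r j) t). ?f p) \<longlonglongrightarrow> (LINT p|(nu t \<Otimes>\<^sub>M nu t). ?f p)"
  proof (rule integral_setwise_tendsto[where B="BF * P"])
    show "finite_measure (path (r n) t \<Otimes>\<^sub>M path (r n) t)" for n by (intro finite_measure_pair_measure admissible_finite[OF a])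
    show "finite_measure (nu t \<Otimes>\<^sub>M nu t)" by (intro finite_measure_pair_measure admissible_finite[OF N])
    show "sets (path (r n) t \<Otimes>\<^sub>M path (r n) t) = sets (nu t \<Otimes>\<^sub>M nu t)" for n unfolding sN sa ..
    show "(\<lambda>n. measure (path (r n) t \<Otimes>\<^sub>M path (r n) t) A) \<longlonglongrightarrow> measure (nu t \<Otimes>\<^sub>M nu t) A" if "A \<in> sets (nu t \<Otimes>\<^sub>M nu t)" for A
      by (rule pair_setwise_tendsto[OF unif_single[OF t] admissible_finite[OF N] admissible_sets[OF N] nu_lim[OF t] unif_pair[OF t]])
         (use that sN in auto)
    show "?f \<in> borel_measurable (nu t \<Otimes>\<^sub>M nu t)"
      using double_integral(2)[OF N D] measurable_cong_sets[OF sN refl] by blast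
    show "\<bar>?f p\<bar> \<le> BF * P" for p by (rule double_integral(3)[OF N D])
  qed
  then show ?thesis by (simp only: double_integral(1)[OF a D] double_integral(1)[OF N D])
qed

text \<open>Along a path a functional of the measure depends on time only through the grid index, so
  measurability in \<open>s\<close> holds for any \<open>\<Phi>\<close>, including the quadratic
  one.\<close>

lemma time_limit:
  assumes t: "0 \<le> t" and b: "\<And>c mu. admissible c mu \<Longrightarrow> \<bar>\<Phi> mu\<bar> \<le> B"
    and lim: "\<And>s. 0 \<le> s \<Longrightarrow> (\<lambda>j. \<Phi> (path (r j) s)) \<longlonglongrightarrow> (f s :: real)"
  shows "set_integrable lborel {0..t} f" and "(\<lambda>j. LINT s:{0..t}|lborel. \<Phi> (path (r j) s)) \<longlonglongrightarrow> (LINT s:{0..t}|lborel. f s)"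
  unfolding path_def
  using step_function_limit[of "\<lambda>n k. \<Phi> (scheme (step_size (r n)) k)" B t "\<lambda>n. step_size (r n)" f, OF b[OF admissible_scheme[OF small_step_size]] t] lim[unfolded path_def]
  by blast+

lemma weak_limit:
  fixes \<phi> :: "phase \<Rightarrow> real"
  assumes T: "test_fun UNIV \<phi>" and t: "0 \<le> t"
  shows "set_integrable lborel {0..t} (\<lambda>s. LINT z|nu s. snd z \<bullet> grad_x \<phi> z)" (is "set_integrable _ _ ?b1")
    and "set_integrable lborel {0..t} (\<lambda>s. LINT z|nu s. (LINT y|nu s. F (z - y)) \<bullet> grad_v \<phi> z)" (is "set_integrable _ _ ?b2")
    and "set_integrable lborel {0..t} (\<lambda>s. LINT z|nu s. (g (fst z) - snd z) \<bullet> grad_v \<phi> z)" (is "set_integrable _ _ ?b3")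
    and "(LINT z|nu t. \<phi> z) = (LINT z|mu0. \<phi> z) + (LINT s:{0..t}|lborel. LINT z|nu s. snd z \<bullet> grad_x \<phi> z)
      + (LINT s:{0..t}|lborel. LINT z|nu s. (LINT y|nu s. F (z - y)) \<bullet> grad_v \<phi> z)
      + (LINT s:{0..t}|lborel. LINT z|nu s. (g (fst z) - snd z) \<bullet> grad_v \<phi> z)"
proof -
  obtain P \<rho> where P: "0 \<le> P" "0 \<le> \<rho>" "\<And>z. norm (grad_x \<phi> z) \<le> P" "\<And>z. norm (grad_v \<phi> z) \<le> P"
    "\<And>z. norm (snd z) * norm (grad_x \<phi> z) \<le> \<rho> * P" "\<And>z. norm (snd z) * norm (grad_v \<phi> z) \<le> \<rho> * P"
    "grad_x \<phi> \<in> borel_measurable borel" "grad_v \<phi> \<in> borel_measurable borel"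
    using test_fun_gradients[OF T] by blast
  note dt = drift_terms[OF P(7,8,4,5,6,1)]
  define \<Phi>1 where "\<Phi>1 mu = (LINT z|mu. snd z \<bullet> grad_x \<phi> z)" for mu
  define \<Phi>2 where "\<Phi>2 mu = (LINT z|mu. (LINT y|mu. F (z - y)) \<bullet> grad_v \<phi> z)" for mu
  define \<Phi>3 where "\<Phi>3 mu = (LINT z|mu. (g (fst z) - snd z) \<bullet> grad_v \<phi> z)" for mu
  have i1: "integrable mu (\<lambda>z. snd z \<bullet> grad_x \<phi> z)" "\<bar>\<Phi>1 mu\<bar> \<le> \<rho> * P * M" if "admissible c mu" for c mu
    using admissible_integrable_bounded[OF that dt(1)] dt(2) by (auto simp: \<Phi>1_def)
  have i2: "integrable mu (\<lambda>z. (LINT y|mu. F (z - y)) \<bullet> grad_v \<phi> z)" "\<bar>\<Phi>2 mu\<bar> \<le> BF * M * P * M" if "admissible c mu" for c mu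
    using admissible_integrable_bounded[OF that dt(5)[OF that]] dt(6)[OF that] by (auto simp: \<Phi>2_def)
  have i3: "integrable mu (\<lambda>z. (g (fst z) - snd z) \<bullet> grad_v \<phi> z)" "\<bar>\<Phi>3 mu\<bar> \<le> (Bg * P + \<rho> * P) * M" if "admissible c mu" for c mu
    using admissible_integrable_bounded[OF that dt(3)] dt(4) by (auto simp: \<Phi>3_def)
  have l1: "(\<lambda>j. \<Phi>1 (path (r j) s)) \<longlonglongrightarrow> ?b1 s" if "0 \<le> s" for s unfolding \<Phi>1_def by (rule integral_limit[OF that dt(1,2)])
  have l2: "(\<lambda>j. \<Phi>2 (path (r j) s)) \<longlonglongrightarrow> ?b2 s" if "0 \<le> s" for s unfolding \<Phi>2_def by (rule interaction_limit[OF that P(8,4,1)])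
  have l3: "(\<lambda>j. \<Phi>3 (path (r j) s)) \<longlonglongrightarrow> ?b3 s" if "0 \<le> s" for s unfolding \<Phi>3_def by (rule integral_limit[OF that dt(3,4)])
  show s1: "set_integrable lborel {0..t} ?b1" by (rule time_limit(1)[OF t i1(2) l1])
  show s2: "set_integrable lborel {0..t} ?b2" by (rule time_limit(1)[OF t i2(2) l2])
  show s3: "set_integrable lborel {0..t} ?b3" by (rule time_limit(1)[OF t i3(2) l3])
  define \<Phi> where "\<Phi> mu = (LINT z|mu. transport_term (grad_x \<phi>) (grad_v \<phi>) mu z)" for mu
  have \<Phi>: "\<Phi> mu = \<Phi>1 mu + \<Phi>2 mu + \<Phi>3 mu" if "admissible c mu" for c mu
    unfolding \<Phi>_def transport_term_def \<Phi>1_def \<Phi>2_def \<Phi>3_def using i1(1)[OF that] i2(1)[OF that] i3(1)[OF that] by simp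
  define BQ where "BQ = \<rho> * P * M + BF * M * P * M + (Bg * P + \<rho> * P) * M"
  have \<Phi>b: "\<bar>\<Phi> mu\<bar> \<le> BQ" if "admissible c mu" for c mu
    using i1(2)[OF that] i2(2)[OF that] i3(2)[OF that] unfolding \<Phi>[OF that] BQ_def by linarith
  have \<Phi>l: "(\<lambda>j. \<Phi> (path (r j) s)) \<longlonglongrightarrow> ?b1 s + ?b2 s + ?b3 s" if "0 \<le> s" for s
    unfolding \<Phi>[OF admissible_path[OF that]] by (intro tendsto_add l1 l2 l3 that)
  have lim1: "(\<lambda>j. LINT s:{0..t}|lborel. \<Phi> (path (r j) s)) \<longlonglongrightarrow> (LINT s:{0..t}|lborel. ?b1 s + ?b2 s + ?b3 s)"
    by (rule time_limit(2)[OF t \<Phi>b \<Phi>l])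
  have split: "(LINT s:{0..t}|lborel. ?b1 s + ?b2 s + ?b3 s) = (LINT s:{0..t}|lborel. ?b1 s) + (LINT s:{0..t}|lborel. ?b2 s) + (LINT s:{0..t}|lborel. ?b3 s)"
    using set_integral_add(2)[OF set_integral_add(1)[OF s1 s2] s3] set_integral_add(2)[OF s1 s2] by simp
  have cont: "continuous_on UNIV \<phi>" using T C_k.simps(1) unfolding test_fun_def smooth_fun_def by blast
  have \<phi>m: "\<phi> \<in> borel_measurable borel" by (rule borel_measurable_continuous_onI[OF cont])
  have z0: "\<phi> z = 0" if "z \<notin> closure {z. \<phi> z \<noteq> 0}" for z
    using that closure_subset[of "{z. \<phi> z \<noteq> 0}"] by auto
  have K: "compact (closure {z. \<phi> z \<noteq> 0})" using T by (simp add: test_fun_def)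
  obtain B where B: "0 \<le> B" "\<And>z. \<bar>\<phi> z\<bar> \<le> B" using compact_support_bounded[OF cont K z0] by blast
  have lim2: "(\<lambda>j. LINT z|path (r j) t. \<phi> z) \<longlonglongrightarrow> (LINT z|nu t. \<phi> z)" by (rule integral_limit[OF t \<phi>m B(2)])
  obtain C3 where C3: "0 \<le> C3" "\<And>h k. small_step h \<Longrightarrow> \<bar>(LINT z|scheme h k. \<phi> z) - (LINT z|mu0. \<phi> z)
        - (\<Sum>j<k. h * (LINT z|scheme h j. transport_term (grad_x \<phi>) (grad_v \<phi>) (scheme h j) z))\<bar> \<le> real k * h\<^sup>2 * C3"
    using scheme_weak[OF T] by blast
  \<comment> \<open>The number of steps times \<open>step_size n\<close> is at most
    \<open>t\<close>, so consistency errors sum to \<open>t * C3\<close> times the step size;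
    \<open>BQ\<close> comes from the last incomplete grid cell.\<close>
  have est: "\<bar>(LINT z|path n t. \<phi> z) - (LINT z|mu0. \<phi> z) - (LINT s:{0..t}|lborel. \<Phi> (path n s))\<bar> \<le> step_size n * (t * C3 + BQ)" for n
  proof -
    let ?h = "step_size n" and ?k = "nat \<lfloor>t / step_size n\<rfloor>"
    have 1: "\<bar>(LINT z|path n t. \<phi> z) - (LINT z|mu0. \<phi> z) - (\<Sum>j<?k. ?h * \<Phi> (scheme ?h j))\<bar> \<le> real ?k * ?h\<^sup>2 * C3"
      using C3(2)[OF small_step_size, of n ?k] unfolding \<Phi>_def path_def .
    have 2: "\<bar>(LINT s:{0..t}|lborel. \<Phi> (path n s)) - (\<Sum>j<?k. ?h * \<Phi> (scheme ?h j))\<bar> \<le> ?h * BQ"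
      unfolding path_def by (rule step_function_integral[OF \<Phi>b[OF admissible_scheme[OF small_step_size]] step_size_pos t])
    have "real ?k * ?h\<^sup>2 * C3 = ?h * ((real ?k * ?h) * C3)" by (simp add: power2_eq_square algebra_simps)
    also have "\<dots> \<le> ?h * (t * C3)"
      using floor_time(1)[OF t step_size_pos[of n]] C3(1) step_size_pos[of n] by (intro mult_left_mono mult_right_mono) auto
    finally show ?thesis using 1 2 by (simp only: distrib_left)
  qed
  have "(\<lambda>j. (LINT z|path (r j) t. \<phi> z) - (LINT z|mu0. \<phi> z) - (LINT s:{0..t}|lborel. \<Phi> (path (r j) s))) \<longlonglongrightarrow> 0"
  proof (rule Lim_null_comparison)
    show "\<forall>\<^sub>F j in sequentially. norm ((LINT z|path (r j) t. \<phi> z) - (LINT z|mu0. \<phi> z) - (LINT s:{0..t}|lborel. \<Phi> (path (r j) s))) \<le> step_size (r j) * (t * C3 + BQ)"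
      using est by simp
    show "(\<lambda>j. step_size (r j) * (t * C3 + BQ)) \<longlonglongrightarrow> 0" using tendsto_mult_left_zero[OF step_size_r_tendsto] .
  qed
  moreover have "(\<lambda>j. (LINT z|path (r j) t. \<phi> z) - (LINT z|mu0. \<phi> z) - (LINT s:{0..t}|lborel. \<Phi> (path (r j) s)))
     \<longlonglongrightarrow> (LINT z|nu t. \<phi> z) - (LINT z|mu0. \<phi> z) - (LINT s:{0..t}|lborel. ?b1 s + ?b2 s + ?b3 s)"
    by (intro tendsto_diff lim2 tendsto_const lim1)
  ultimately have "(LINT z|nu t. \<phi> z) - (LINT z|mu0. \<phi> z) - (LINT s:{0..t}|lborel. ?b1 s + ?b2 s + ?b3 s) = 0"
    using LIMSEQ_unique by blast
  then show "(LINT z|nu t. \<phi> z) = (LINT z|mu0. \<phi> z) + (LINT s:{0..t}|lborel. ?b1 s) + (LINT s:{0..t}|lborel. ?b2 s) + (LINT s:{0..t}|lborel. ?b3 s)"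
    unfolding split by linarith
qed

end

section \<open>Densities of the limit measures\<close>

lemma AE_lborel_reflect:
  fixes P :: "'a::euclidean_space \<Rightarrow> bool"
  assumes "AE z in lborel. P z" shows "AE y in lborel. P (c - y)"
proof -
  have eq: "lborel = density (distr lborel borel (\<lambda>y::'a. c + (-1) *\<^sub>R y)) (\<lambda>_. ennreal (\<bar>-1\<bar> ^ DIM('a)))"
    by (rule lborel_affine) simp
  have "AE z in density (distr lborel borel (\<lambda>y::'a. c + (-1) *\<^sub>R y)) (\<lambda>_. ennreal (\<bar>-1\<bar> ^ DIM('a))). P z"
    unfolding eq[symmetric] by (rule assms)
  then have "AE z in distr lborel borel (\<lambda>y. c + (-1) *\<^sub>R y). P z"
    by (subst (asm) AE_density) simp_all
  then have "AE y in lborel. P (c + (-1) *\<^sub>R y)" by (rule AE_distrD[rotated]) simp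
  then show ?thesis by simp
qed

text \<open>Bridge between the Lebesgue integrals of the definitions and Borel integrands.
  Completeness of the measure makes \<open>h\<close> measurable although it is only almost
  everywhere equal to a Borel function.\<close>

lemma lebesgue_borel_AE:
  fixes h h' :: "'a::euclidean_space \<Rightarrow> 'b::{banach, second_countable_topology}"
  assumes h': "h' \<in> borel_measurable borel" and ae: "AE z in lborel. h z = h' z"
  shows "h \<in> borel_measurable lebesgue" "integrable lebesgue h \<longleftrightarrow> integrable lborel h'"
    "(LINT z|lebesgue. h z) = (LINT z|lborel. h' z)"
proof -
  have ael: "AE z in lebesgue. h z = h' z" using ae by (simp add: AE_completion_iff)
  have hl: "h' \<in> borel_measurable lebesgue" by (rule borel_imp_lebesgue[OF h'])
  show m: "h \<in> borel_measurable lebesgue"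
  proof (rule measurableI)
    fix B :: "'b set" assume B: "B \<in> sets borel"
    show "h -` B \<inter> space lebesgue \<in> sets lebesgue"
    proof (rule completion.in_sets_AE)
      show "AE x in lebesgue. x \<in> h' -` B \<inter> space lebesgue \<longleftrightarrow> x \<in> h -` B \<inter> space lebesgue"
        using ael by eventually_elim simp
      show "h' -` B \<inter> space lebesgue \<in> sets lebesgue" by (rule measurable_sets[OF hl B])
    qed simp
  qed simp
  have "integrable lebesgue h \<longleftrightarrow> integrable lebesgue h'" by (rule integrable_cong_AE[OF m hl ael])
  then show "integrable lebesgue h \<longleftrightarrow> integrable lborel h'" using integrable_completion[of h' lborel] h' by simp
  have "(LINT z|lebesgue. h z) = (LINT z|lebesgue. h' z)" by (rule integral_cong_AE[OF m hl ael])
  then show "(LINT z|lebesgue. h z) = (LINT z|lborel. h' z)" using integral_completion[of h' lborel] h' by simp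
qed

lemma One_inner: "b \<in> Basis \<Longrightarrow> (One :: 'a::euclidean_space) \<bullet> b = 1"
proof -
  assume b: "b \<in> Basis"
  have "(One :: 'a) \<bullet> b = (\<Sum>i\<in>Basis. if i = b then 1 else 0)"
    unfolding inner_sum_left by (rule sum.cong) (auto simp: inner_Basis b)
  then show ?thesis using b by simp
qed

section \<open>Means over small cubes\<close>

lemma measure_cube:
  assumes "0 \<le> c" shows "measure lborel (cbox x (x + c *\<^sub>R (One :: 'a::euclidean_space))) = c ^ DIM('a)"
proof -
  have "\<And>b. b \<in> Basis \<Longrightarrow> x \<bullet> b \<le> (x + c *\<^sub>R (One :: 'a)) \<bullet> b"
    using assms One_inner by (simp add: inner_add_left)
  then have "measure lborel (cbox x (x + c *\<^sub>R (One :: 'a))) = (\<Prod>b\<in>Basis. ((x + c *\<^sub>R One) - x) \<bullet> b)"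
    by (subst measure_lborel_cbox) auto
  also have "\<dots> = (\<Prod>b\<in>(Basis :: 'a set). c)" by (rule prod.cong) (simp_all add: One_inner)
  finally show ?thesis by simp
qed

lemma measure_cube_measurable:
  fixes m :: "'a::euclidean_space measure"
  assumes fin: "finite_measure m" and s: "sets m = sets borel"
  shows "(\<lambda>x. measure m (cbox x (x + c *\<^sub>R One))) \<in> borel_measurable borel"
proof -
  interpret finite_measure m by fact
  define Q where "Q = {p :: 'a \<times> 'a. snd p \<in> cbox (fst p) (fst p + c *\<^sub>R One)}"
  have "closed {p :: 'a \<times> 'a. \<forall>b\<in>Basis. fst p \<bullet> b \<le> snd p \<bullet> b \<and> snd p \<bullet> b \<le> (fst p + c *\<^sub>R One) \<bullet> b}"
  proof -
    have "{p :: 'a \<times> 'a. \<forall>b\<in>Basis. fst p \<bullet> b \<le> snd p \<bullet> b \<and> snd p \<bullet> b \<le> (fst p + c *\<^sub>R One) \<bullet> b}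
      = (\<Inter>b\<in>Basis. {p. fst p \<bullet> b \<le> snd p \<bullet> b \<and> snd p \<bullet> b \<le> (fst p + c *\<^sub>R One) \<bullet> b})" by auto
    then show ?thesis
      by (simp only:) (intro closed_INT ballI closed_Collect_conj closed_Collect_le continuous_intros)
  qed
  then have "closed Q" unfolding Q_def mem_box .
  then have "Q \<in> sets (borel \<Otimes>\<^sub>M borel)" unfolding borel_prod by (rule borel_closed)
  also have "sets (borel \<Otimes>\<^sub>M borel) = sets (borel \<Otimes>\<^sub>M m)" by (rule sets_pair_measure_cong) (simp_all add: s)
  finally have "(\<lambda>x. emeasure m (Pair x -` Q)) \<in> borel_measurable borel" by (rule measurable_emeasure_Pair)
  moreover have "Pair x -` Q = cbox x (x + c *\<^sub>R One)" for x by (auto simp: Q_def)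
  ultimately have "(\<lambda>x. emeasure m (cbox x (x + c *\<^sub>R One))) \<in> borel_measurable borel" by simp
  then show ?thesis unfolding measure_def by (rule borel_measurable_enn2real)
qed

context mean_field_limit
begin

text \<open>Limits of cube means are jointly measurable in time and phase, which is not clear for
  densities that are chosen separately at each time. Negative times are clamped to 0, as nothing is known about \<open>nu\<close> there.\<close>
definition cube_mean :: "nat \<Rightarrow> real \<Rightarrow> phase \<Rightarrow> real" where
  "cube_mean k t x = measure (nu (max 0 t)) (cbox x (x + (1 / (real k + 1)) *\<^sub>R One)) / (1 / (real k + 1)) ^ DIM(phase)"

definition dens :: "real \<Rightarrow> phase \<Rightarrow> real" where "dens t x = lim (\<lambda>k. cube_mean k t x)"

text \<open>Along the scheme the measure of a cube is measurable in its corner for each grid index,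
  and the index is a measurable function of time. Joint measurability passes to the limit in
  \<open>j\<close> and then to the limit over shrinking cubes.\<close>

lemma dens_measurable: "(\<lambda>p. dens (fst p) (snd p)) \<in> borel_measurable borel"
proof -
  have "(\<lambda>p. cube_mean k (fst p) (snd p)) \<in> borel_measurable borel" for k
  proof -
    define c where "c = 1 / (real k + 1)"
    let ?B = "\<lambda>p :: real \<times> phase. cbox (snd p) (snd p + c *\<^sub>R One)"
    have sn: "(snd :: real \<times> phase \<Rightarrow> phase) \<in> borel_measurable borel" "(\<lambda>p :: real \<times> phase. max 0 (fst p)) \<in> borel_measurable borel"
      by (intro borel_measurable_continuous_onI continuous_intros)+
    have "(\<lambda>p. measure (nu (max 0 (fst p))) (?B p)) \<in> borel_measurable borel"
    proof (rule borel_measurable_LIMSEQ_real)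
      show "(\<lambda>j. measure (path (r j) (max 0 (fst p))) (?B p)) \<longlonglongrightarrow> measure (nu (max 0 (fst p))) (?B p)" for p
        by (rule nu_lim) simp_all
      fix j
      have "(\<lambda>p. measure (scheme (step_size (r j)) i) (?B p)) \<in> borel_measurable borel" for i
        by (rule measurable_compose[OF sn(1) measure_cube_measurable])
           (use admissible_finite[OF admissible_scheme[OF small_step_size]] admissible_sets[OF admissible_scheme[OF small_step_size]] in auto)
      moreover have "(\<lambda>p :: real \<times> phase. nat \<lfloor>max 0 (fst p) / step_size (r j)\<rfloor>) \<in> measurable borel (count_space UNIV)"
        by (rule measurable_compose[OF sn(2) floor_index_measurable])
      ultimately show "(\<lambda>p. measure (path (r j) (max 0 (fst p))) (?B p)) \<in> borel_measurable borel"
        unfolding path_def by (rule measurable_compose_countable)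
    qed
    then show ?thesis unfolding cube_mean_def c_def by (rule borel_measurable_divide) simp
  qed
  then show ?thesis unfolding dens_def by (rule borel_measurable_lim_metric)
qed

lemma dens_section_measurable: "dens t \<in> borel_measurable borel"
proof -
  have "(\<lambda>x :: phase. (t, x)) \<in> borel_measurable borel" by (intro borel_measurable_continuous_onI continuous_intros)
  from measurable_compose[OF this dens_measurable] show ?thesis by simp
qed

text \<open>At a fixed time the cube means converge almost everywhere to the Radon-Nikodym density
  by Lebesgue differentiation. So \<open>dens t\<close> is a version of that density, and it
  inherits the upper bound that the cube means satisfy at every point.\<close>

lemma dens_nu:
  assumes t: "0 \<le> t"
  shows "AE z in lborel. 0 \<le> dens t z \<and> dens t z \<le> K0 * exp (4 * accel_lip * t)"
    and "nu t = density lborel (\<lambda>z. ennreal (dens t z))"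
proof -
  let ?N = "nu t" and ?c = "K0 * exp (4 * accel_lip * t)"
  note N = nu_admissible[OF t]
  have c: "0 \<le> ?c" by (rule admissible_nonneg[OF N])
  interpret N: finite_measure ?N by (rule admissible_finite[OF N])
  have sN: "sets ?N = sets lborel" using admissible_sets[OF N] by simp
  have ac: "absolutely_continuous lborel ?N"
    unfolding absolutely_continuous_def
  proof
    fix A assume A: "A \<in> null_sets (lborel :: phase measure)"
    then have "emeasure ?N A = 0" using admissible_dens[OF N, of A] by (auto simp: null_sets_def)
    then show "A \<in> null_sets ?N" using A sN by (auto simp: null_sets_def)
  qed
  have sf: "sigma_finite_measure (lborel :: phase measure)" by (rule sigma_finite_lborel)
  obtain D where D: "D \<in> borel_measurable lborel" "AE x in lborel. RN_deriv lborel ?N x = ennreal (D x)" "\<And>x. 0 \<le> D x"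
  proof (rule sigma_finite_measure.real_RN_deriv[OF sf admissible_finite[OF N] ac sN])
    fix D assume D: "D \<in> borel_measurable lborel" "AE x in lborel. RN_deriv lborel ?N x = ennreal (D x)" "\<And>x. 0 \<le> D x"
    show thesis by (rule that[OF D])
  qed
  have ND: "?N = density lborel (\<lambda>x. ennreal (D x))"
    using sigma_finite_measure.density_RN_deriv[OF sf ac sN] density_cong[of "RN_deriv lborel ?N" lborel "\<lambda>x. ennreal (D x)"] D(1,2) by simp
  have Dint: "integrable lborel D"
  proof (rule integrableI_nonneg[OF D(1)])
    show "AE x in lborel. 0 \<le> D x" using D(3) by simp
    have "(\<integral>\<^sup>+x. ennreal (D x) \<partial>lborel) = emeasure ?N (space ?N)"
      unfolding ND using D(1) by (subst emeasure_density) (auto intro!: nn_integral_cong)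
    then show "(\<integral>\<^sup>+x. ennreal (D x) \<partial>lborel) < \<infinity>" using N.emeasure_finite[of "space ?N"] by (simp add: less_top[symmetric])
  qed
  have sD: "set_integrable lborel A D" if "A \<in> sets borel" for A
    unfolding set_integrable_def using Dint that by (intro integrable_mult_indicator) auto
  have mD: "measure ?N (cbox a b) = integral (cbox a b) D" for a b
  proof -
    have "emeasure ?N (cbox a b) = (\<integral>\<^sup>+x. ennreal (indicat_real (cbox a b) x *\<^sub>R D x) \<partial>lborel)"
      unfolding ND using D(1,3) by (subst emeasure_density) (auto intro!: nn_integral_cong split: split_indicator)
    also have "\<dots> = ennreal (LINT x|lborel. indicat_real (cbox a b) x *\<^sub>R D x)"
      by (rule nn_integral_eq_integral) (use sD[of "cbox a b"] D(3) in \<open>auto simp: set_integrable_def\<close>)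
    finally have "measure ?N (cbox a b) = (LINT x:cbox a b|lborel. D x)"
      unfolding set_lebesgue_integral_def using D(3) by (simp add: N.emeasure_eq_measure integral_nonneg_AE)
    then show ?thesis using set_borel_integral_eq_integral(2)[OF sD[of "cbox a b"]] by simp
  qed
  have Dhk: "D integrable_on cbox a b" for a b using set_borel_integral_eq_integral(1)[OF sD[of "cbox a b"]] by simp
  obtain Z where Z: "negligible Z" "\<And>x e. x \<notin> Z \<Longrightarrow> 0 < e \<Longrightarrow> \<exists>d>0. \<forall>h. 0 < h \<and> h < d \<longrightarrow>
      norm (integral (cbox x (x + h *\<^sub>R One)) D /\<^sub>R h ^ DIM(phase) - D x) < e"
  proof (rule integrable_ccontinuous_explicit[of D, OF Dhk])
    fix Z assume Z: "negligible Z" "\<And>x e. x \<notin> Z \<Longrightarrow> 0 < e \<Longrightarrow> \<exists>d>0. \<forall>h. 0 < h \<and> h < d \<longrightarrow>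
      norm (integral (cbox x (x + h *\<^sub>R One)) D /\<^sub>R h ^ DIM(phase) - D x) < e"
    show thesis by (rule that[OF Z])
  qed
  have lim: "(\<lambda>k. cube_mean k t x) \<longlonglongrightarrow> D x" if x: "x \<notin> Z" for x
  proof (rule LIMSEQ_I)
    fix e :: real assume "0 < e"
    obtain d where d: "0 < d" "\<And>h. 0 < h \<Longrightarrow> h < d \<Longrightarrow> norm (integral (cbox x (x + h *\<^sub>R One)) D /\<^sub>R h ^ DIM(phase) - D x) < e"
      using Z(2)[OF x \<open>0 < e\<close>] by auto
    obtain k0 where k0: "inverse (real (Suc k0)) < d" using reals_Archimedean[OF d(1)] by blast
    have "norm (cube_mean k t x - D x) < e" if "k0 \<le> k" for k
    proof -
      have "1 / (real k + 1) \<le> inverse (real (Suc k0))" using that by (simp add: inverse_eq_divide frac_le)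
      then have "1 / (real k + 1) < d" using k0 by linarith
      then have "norm (integral (cbox x (x + (1 / (real k + 1)) *\<^sub>R One)) D /\<^sub>R (1 / (real k + 1)) ^ DIM(phase) - D x) < e"
        by (intro d(2)) auto
      moreover have "cube_mean k t x = integral (cbox x (x + (1 / (real k + 1)) *\<^sub>R One)) D /\<^sub>R (1 / (real k + 1)) ^ DIM(phase)"
        unfolding cube_mean_def using t mD by (simp only: max_absorb2) (simp only: divide_inverse real_scaleR_def mult.commute)
      ultimately show ?thesis by (simp only:)
    qed
    then show "\<exists>n0. \<forall>k\<ge>n0. norm (cube_mean k t x - D x) < e" by blast
  qed
  have q: "cube_mean k t x \<le> ?c" for k x
  proof -
    let ?h = "1 / (real k + 1)"
    let ?C = "cbox x (x + ?h *\<^sub>R One)"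
    have "emeasure ?N ?C \<le> ennreal ?c * emeasure lborel ?C" by (rule admissible_dens[OF N]) simp
    also have "\<dots> = ennreal (?c * measure lborel ?C)"
      using c emeasure_lborel_cbox_finite[of x "x + ?h *\<^sub>R One"] by (simp add: ennreal_mult emeasure_eq_ennreal_measure)
    finally have "measure ?N ?C \<le> ?c * measure lborel ?C" using c by (simp add: N.emeasure_eq_measure)
    also have "measure lborel ?C = ?h ^ DIM(phase)" by (rule measure_cube) simp
    finally have "measure ?N ?C \<le> ?c * ?h ^ DIM(phase)" .
    moreover have "0 < ?h ^ DIM(phase)" by simp
    ultimately have "measure ?N ?C / ?h ^ DIM(phase) \<le> ?c" by (simp only: pos_divide_le_eq)
    then show ?thesis unfolding cube_mean_def using t by (simp only: max_absorb2)
  qed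
  have "AE x in lborel. x \<notin> Z"
    using AE_not_in[of Z lebesgue] Z(1) unfolding negligible_iff_null_sets AE_completion_iff .
  then have ae: "AE x in lborel. dens t x = D x \<and> D x \<le> ?c"
  proof eventually_elim
    case (elim x)
    have "dens t x = D x" unfolding dens_def by (rule limI[OF lim[OF elim]])
    moreover have "D x \<le> ?c" by (rule LIMSEQ_le_const2[OF lim[OF elim]]) (use q in auto)
    ultimately show ?case ..
  qed
  then show "AE z in lborel. 0 \<le> dens t z \<and> dens t z \<le> ?c"
  proof eventually_elim
    case (elim x)
    then show ?case using D(3)[of x] by simp
  qed
  have aeD: "AE x in lborel. ennreal (D x) = ennreal (dens t x)" using ae by eventually_elim simp
  show "nu t = density lborel (\<lambda>z. ennreal (dens t z))"
    by (subst ND, rule density_cong[OF _ _ aeD]) (use D(1) dens_section_measurable in simp_all)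
qed

lemma nu_integral:
  fixes \<psi> :: "phase \<Rightarrow> 'b::{banach, second_countable_topology}"
  assumes t: "0 \<le> t" and \<psi>: "\<psi> \<in> borel_measurable borel"
  shows "integrable (nu t) \<psi> \<longleftrightarrow> integrable lborel (\<lambda>z. dens t z *\<^sub>R \<psi> z)"
    and "(LINT z|nu t. \<psi> z) = (LINT z|lborel. dens t z *\<^sub>R \<psi> z)"
proof -
  have nn: "AE z in lborel. 0 \<le> dens t z" using dens_nu(1)[OF t] by eventually_elim simp
  have m: "\<psi> \<in> borel_measurable lborel" "dens t \<in> borel_measurable lborel" using \<psi> dens_section_measurable by auto
  show "integrable (nu t) \<psi> \<longleftrightarrow> integrable lborel (\<lambda>z. dens t z *\<^sub>R \<psi> z)"
    unfolding dens_nu(2)[OF t] by (rule integrable_density[OF m nn])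
  show "(LINT z|nu t. \<psi> z) = (LINT z|lborel. dens t z *\<^sub>R \<psi> z)"
    unfolding dens_nu(2)[OF t] by (rule integral_density[OF m nn])
qed

end

section \<open>Existence of weak solutions\<close>

text \<open>Borel versions of the components are assembled into a vector, and points where the norm
  exceeds the essential bound, a null set, are reset to 0. The bound then holds everywhere.\<close>

lemma Linf_borel_version:
  fixes g :: "real^2 \<Rightarrow> real^2"
  assumes g: "in_Linf lebesgue g"
  obtains g' B where "g' \<in> borel_measurable borel" "AE x in lborel. g x = g' x" "\<forall>x. norm (g' x) \<le> B"
proof -
  have gm: "g \<in> borel_measurable lebesgue" using g by (simp add: in_Linf_def)
  have "\<exists>k. k \<in> borel_measurable borel \<and> (AE x in lborel. g x $ i = k x)" for i
  proof -
    have "(\<lambda>x. g x $ i) \<in> borel_measurable lebesgue"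
      by (rule measurable_compose[OF gm]) (intro borel_measurable_continuous_onI continuous_intros)
    from completion_ex_borel_measurable_real[OF this] show ?thesis by auto
  qed
  then have "\<forall>i. \<exists>k. k \<in> borel_measurable borel \<and> (AE x in lborel. g x $ i = k x)" by (rule allI)
  from choice[OF this] obtain k where kk: "\<forall>i. k i \<in> borel_measurable borel \<and> (AE x in lborel. g x $ i = k i x)" ..
  have k: "k i \<in> borel_measurable borel" "AE x in lborel. g x $ i = k i x" for i using kk by auto
  define B where "B = max 0 (Linf_norm lebesgue g)"
  define g1 where "g1 x = (\<chi> i. k i x)" for x
  have g1m: "g1 \<in> borel_measurable borel"
  proof -
    have "(\<lambda>x. \<Sum>i\<in>UNIV. k i x *\<^sub>R axis i (1::real)) \<in> borel_measurable borel"
      using k(1) by (intro borel_measurable_sum borel_measurable_scaleR) auto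
    moreover have "g1 = (\<lambda>x. \<Sum>i\<in>UNIV. k i x *\<^sub>R axis i (1::real))"
      by (rule ext) (simp add: g1_def vec_eq_iff sum_2 axis_def forall_2)
    ultimately show ?thesis by (simp only:)
  qed
  define g' where "g' x = (if norm (g1 x) \<le> B then g1 x else 0)" for x
  show ?thesis
  proof (rule that[of g' B])
    have "{x. norm (g1 x) \<le> B} \<in> sets borel" using g1m by measurable
    then have "(\<lambda>x. g' x) \<in> borel_measurable borel" unfolding g'_def using g1m
      by (intro measurable_If) auto
    then show "g' \<in> borel_measurable borel" by simp
    show "\<forall>x. norm (g' x) \<le> B" by (simp add: g'_def B_def)
    have "AE x in lborel. norm (g x) \<le> B" using in_Linf_AE[OF g] unfolding AE_completion_iff B_def by eventually_elim simp
    moreover have "AE x in lborel. \<forall>i. g x $ i = k i x" using k(2) by (simp add: AE_all_countable)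
    ultimately show "AE x in lborel. g x = g' x"
    proof eventually_elim
      case (elim x)
      then have "g x = g1 x" by (simp add: g1_def vec_eq_iff)
      then show ?case using elim(1) by (simp add: g'_def)
    qed
  qed
qed

lemma nonneg_Linf_borel_version:
  fixes f :: "'a::euclidean_space \<Rightarrow> real"
  assumes f: "in_Linf lebesgue f" and nn: "AE z in lebesgue. 0 \<le> f z"
  obtains f' where "f' \<in> borel_measurable borel" "AE z in lborel. f z = f' z"
    "\<forall>z. 0 \<le> f' z \<and> f' z \<le> Linf_norm lebesgue f" "0 \<le> Linf_norm lebesgue f"
proof -
  let ?K = "Linf_norm lebesgue f"
  have fm: "f \<in> borel_measurable lebesgue" using f by (simp add: in_Linf_def)
  have ae: "AE z in lborel. 0 \<le> f z \<and> f z \<le> ?K"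
    using in_Linf_AE[OF f] nn unfolding AE_completion_iff by eventually_elim simp
  \<comment> \<open>A negative value would make falsity hold almost everywhere, that is, the whole
    space would be a null set.\<close>
  have K: "0 \<le> ?K"
  proof (rule ccontr)
    assume neg: "\<not> 0 \<le> ?K"
    have "AE z in (lborel :: 'a measure). False" by (rule eventually_mono[OF ae]) (use neg in auto)
    then obtain N where "{z \<in> space lborel. \<not> False} \<subseteq> N" "emeasure lborel N = 0" "N \<in> sets (lborel :: 'a measure)" by (rule AE_E)
    then show False by (simp add: top.extremum_unique)
  qed
  obtain k where k: "k \<in> borel_measurable borel" "AE z in lborel. f z = k z"
    using completion_ex_borel_measurable_real[OF fm] by auto
  show ?thesis
  proof (rule that[of "\<lambda>z. max 0 (min ?K (k z))"])
    show "(\<lambda>z. max 0 (min ?K (k z))) \<in> borel_measurable borel" using k(1) by simp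
    show "AE z in lborel. f z = max 0 (min ?K (k z))" using k(2) ae by eventually_elim simp
  qed (use K in auto)
qed

text \<open>The cylinder over a null set is null although the velocity plane has infinite measure,
  because \<open>0 * \<infinity> = 0\<close> for measures.\<close>

lemma AE_fst_lborel:
  assumes "AE x in (lborel :: (real^2) measure). P x" shows "AE z in (lborel :: phase measure). P (fst z)"
proof -
  obtain N where N: "{x \<in> space lborel. \<not> P x} \<subseteq> N" "emeasure lborel N = 0" "N \<in> sets (lborel :: (real^2) measure)"
    using assms by (rule AE_E)
  have "emeasure (lborel \<Otimes>\<^sub>M lborel :: phase measure) (N \<times> UNIV) = emeasure lborel N * emeasure (lborel :: (real^2) measure) UNIV"
    by (rule lborel.emeasure_pair_measure_Times) (use N in auto)
  then have e: "emeasure (lborel :: phase measure) (N \<times> UNIV) = 0" unfolding lborel_prod N(2) by simp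
  have "N \<times> UNIV \<in> sets (lborel \<Otimes>\<^sub>M lborel :: phase measure)" using N(3) by (intro pair_measureI) auto
  then have s: "N \<times> UNIV \<in> sets (lborel :: phase measure)" unfolding lborel_prod .
  show ?thesis by (rule AE_I[OF _ e s]) (use N(1) in auto)
qed

section \<open>The density as a weak solution\<close>

context mean_field_limit
begin

text \<open>At every \<open>s \<ge> 0\<close> the inner integrals agree exactly, so the outer
  integrands coincide on \<open>{0..t}\<close> and inherit integrability.\<close>

lemma time_integral_transfer:
  assumes T: "\<And>s. 0 \<le> s \<Longrightarrow> T s \<in> borel_measurable borel" "\<And>s. 0 \<le> s \<Longrightarrow> integrable (nu s) (T s)"
    and Q: "\<And>s. 0 \<le> s \<Longrightarrow> AE z in lborel. Q s z = dens s z * T s z"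
    and b: "set_integrable lborel {0..t} (\<lambda>s. LINT z|nu s. T s z)"
  shows "time_integrable t Q" "(LINT s:{0..t}|lebesgue. LINT z|lebesgue. Q s z) = (LINT s:{0..t}|lborel. LINT z|nu s. T s z)"
proof -
  have m: "(\<lambda>z. dens s z * T s z) \<in> borel_measurable borel" if "0 \<le> s" for s
    using T(1)[OF that] dens_section_measurable by (rule borel_measurable_times[rotated])
  have i: "integrable lebesgue (Q s)" "(LINT z|lebesgue. Q s z) = (LINT z|nu s. T s z)" if "0 \<le> s" for s
    using lebesgue_borel_AE(2,3)[OF m[OF that] Q[OF that]] nu_integral[OF that T(1)[OF that]] T(2)[OF that] by auto
  have eq: "indicat_real {0..t} s *\<^sub>R (LINT z|lebesgue. Q s z) = indicat_real {0..t} s *\<^sub>R (LINT z|nu s. T s z)" for s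
    using i(2)[of s] by (cases "0 \<le> s") auto
  let ?b = "\<lambda>s. indicat_real {0..t} s *\<^sub>R (LINT z|nu s. T s z)"
  have ib: "integrable lborel ?b" using b unfolding set_integrable_def .
  then have bm: "?b \<in> borel_measurable lborel" by (rule borel_measurable_integrable)
  have "AE s in lebesgue_on {0..t}. integrable lebesgue (Q s)"
    by (rule AE_I2) (use i(1) in \<open>simp add: space_restrict_space\<close>)
  moreover have "set_integrable lebesgue {0..t} (\<lambda>s. LINT z|lebesgue. Q s z)"
    unfolding set_integrable_def eq using ib integrable_completion[OF bm] by simp
  ultimately show "time_integrable t Q" unfolding time_integrable_def ..
  show "(LINT s:{0..t}|lebesgue. LINT z|lebesgue. Q s z) = (LINT s:{0..t}|lborel. LINT z|nu s. T s z)"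
    unfolding set_lebesgue_integral_def eq by (rule integral_completion[OF bm])
qed

text \<open>The null set where the force differs from its Borel version is reflected to a null set
  for each \<open>(x, v)\<close>, so the convolution agrees at every point and not merely almost
  everywhere.\<close>

lemma conv_dens:
  assumes s: "0 \<le> s" and FG: "AE z in lborel. H z = F z"
  shows "integrable lebesgue (\<lambda>(y, w). dens s (y, w) *\<^sub>R H (x - y, v - w))"
    and "conv H (dens s) (x, v) = (LINT y|nu s. F ((x, v) - y))"
proof -
  have m: "(\<lambda>y. dens s y *\<^sub>R F ((x, v) - y)) \<in> borel_measurable borel"
    by (intro borel_measurable_scaleR dens_section_measurable F_shift_measurable)
  have ae: "AE y in lborel. dens s y *\<^sub>R H ((x, v) - y) = dens s y *\<^sub>R F ((x, v) - y)"
    using AE_lborel_reflect[OF FG, of "(x, v)"] by eventually_elim simp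
  have e: "(\<lambda>(y, w). dens s (y, w) *\<^sub>R H (x - y, v - w)) = (\<lambda>p. dens s p *\<^sub>R H ((x, v) - p))" by (auto simp: fun_eq_iff)
  have "integrable (nu s) (\<lambda>y. F ((x, v) - y))" by (rule admissible_integrable_bounded(1)[OF nu_admissible[OF s] F_shift_measurable F_b])
  then show "integrable lebesgue (\<lambda>(y, w). dens s (y, w) *\<^sub>R H (x - y, v - w))"
    unfolding e lebesgue_borel_AE(2)[OF m ae] nu_integral(1)[OF s F_shift_measurable] .
  show "conv H (dens s) (x, v) = (LINT y|nu s. F ((x, v) - y))"
    unfolding conv_def prod.case e lebesgue_borel_AE(3)[OF m ae] nu_integral(2)[OF s F_shift_measurable] ..
qed

lemma dens_integrals:
  assumes t: "0 \<le> t"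
  shows "integrable lborel (dens t)" "(LINT z|lborel. dens t z) = M"
    "integrable lborel (\<lambda>z. dens t z * (norm (snd z))\<^sup>2)" "(LINT z|lborel. dens t z * (norm (snd z))\<^sup>2) \<le> energy_bound"
proof -
  note N = nu_admissible[OF t]
  have c: "(\<lambda>_. 1 :: real) \<in> borel_measurable (borel :: phase measure)" by (rule borel_measurable_const)
  have one: "(\<lambda>z. dens t z *\<^sub>R (1 :: real)) = dens t" by (simp only: real_scaleR_def mult_1_right)
  show "integrable lborel (dens t)"
    using iffD1[OF nu_integral(1)[OF t c] admissible_integrable_const[OF N]] unfolding one .
  show "(LINT z|lborel. dens t z) = M"
    using trans[OF nu_integral(2)[OF t c, symmetric] admissible_integral_const[OF N, of 1]] unfolding real_scaleR_def mult_1_right mult_1_left .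
  show "integrable lborel (\<lambda>z. dens t z * (norm (snd z))\<^sup>2)"
    using iffD1[OF nu_integral(1)[OF t norm_sq_measurable(2)] conjunct1[OF nu_energy[OF t]]] unfolding real_scaleR_def .
  show "(LINT z|lborel. dens t z * (norm (snd z))\<^sup>2) \<le> energy_bound"
    using conjunct2[OF nu_energy[OF t]] unfolding nu_integral(2)[OF t norm_sq_measurable(2)] real_scaleR_def .
qed

text \<open>For nonnegative times the L1 norm is the constant \<open>M\<close>, which gives both its
  measurability in time and the bound.\<close>

lemma dens_in_Linf_L1: "in_Linf_L1 dens"
  unfolding in_Linf_L1_def
proof (intro conjI)
  have "(\<lambda>p. dens (fst p) (snd p)) \<in> borel_measurable lebesgue" by (rule borel_imp_lebesgue[OF dens_measurable])
  then show "(\<lambda>(t, z). dens t z) \<in> borel_measurable (lebesgue_on ({0..} \<times> UNIV))"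
    unfolding case_prod_beta' by (rule measurable_restrict_space1)
  have dl: "integrable lebesgue (dens t)" if "0 \<le> t" for t
    using dens_integrals(1)[OF that] lebesgue_borel_AE(2)[OF dens_section_measurable, of "dens t" t] by simp
  show "AE t in lebesgue_on {0..}. integrable lebesgue (dens t)"
    by (rule AE_I2) (use dl in \<open>simp add: space_restrict_space\<close>)
  have abs: "(LINT z|lebesgue. \<bar>dens t z\<bar>) = M" if "0 \<le> t" for t
  proof -
    have "AE z in lborel. \<bar>dens t z\<bar> = dens t z" using dens_nu(1)[OF that] by eventually_elim simp
    from lebesgue_borel_AE(3)[OF dens_section_measurable this] show ?thesis using dens_integrals(2)[OF that] by simp
  qed
  have m: "(\<lambda>t. LINT z|lebesgue. \<bar>dens t z\<bar>) \<in> borel_measurable (lebesgue_on {0..})"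
    by (subst measurable_cong[of _ _ "\<lambda>_. M"]) (use abs in \<open>auto simp: space_restrict_space\<close>)
  have "esssup (lebesgue_on {0..}) (\<lambda>t. ereal (norm (LINT z|lebesgue. \<bar>dens t z\<bar>))) \<le> ereal M"
  proof (rule esssup_I)
    show "(\<lambda>t. ereal (norm (LINT z|lebesgue. \<bar>dens t z\<bar>))) \<in> borel_measurable (lebesgue_on {0..})"
      using m by simp
    show "AE t in lebesgue_on {0..}. ereal (norm (LINT z|lebesgue. \<bar>dens t z\<bar>)) \<le> ereal M"
      by (rule AE_I2) (use abs M_nonneg in \<open>simp add: space_restrict_space\<close>)
  qed
  then have "esssup (lebesgue_on {0..}) (\<lambda>t. ereal (norm (LINT z|lebesgue. \<bar>dens t z\<bar>))) < \<infinity>" by (rule order_le_less_trans) simp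
  with m show "in_Linf (lebesgue_on {0..}) (\<lambda>t. LINT z|lebesgue. \<bar>dens t z\<bar>)" by (simp add: in_Linf_def)
qed

lemma dens_weak_solution:
  assumes FG: "AE z in lborel. H z = F z" and gg: "AE x in lborel. k x = g x"
    and f1: "f1 \<in> borel_measurable borel" "\<And>z. 0 \<le> f1 z" "mu0 = density lborel (\<lambda>z. ennreal (f1 z))"
    and f0: "AE z in lborel. f0 z = f1 z"
  shows "weak_solution H (acceleration k) f0 dens"
  unfolding weak_solution_def
proof (intro conjI allI impI)
  show "AE s in lebesgue_on {0..}. AE (x, v) in lebesgue. integrable lebesgue (\<lambda>(y, w). dens s (y, w) *\<^sub>R H (x - y, v - w))"
    by (rule AE_I2, rule AE_I2) (use conv_dens(1)[OF _ FG] in \<open>auto simp: space_restrict_space\<close>)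
  fix \<phi> :: "phase \<Rightarrow> real" and t :: real
  assume T: "test_fun UNIV \<phi>" and t: "0 \<le> t"
  have cont: "continuous_on UNIV \<phi>" using T C_k.simps(1) unfolding test_fun_def smooth_fun_def by blast
  have \<phi>m: "\<phi> \<in> borel_measurable borel" by (rule borel_measurable_continuous_onI[OF cont])
  have z0: "\<phi> z = 0" if "z \<notin> closure {z. \<phi> z \<noteq> 0}" for z
    using that closure_subset[of "{z. \<phi> z \<noteq> 0}"] by auto
  have K: "compact (closure {z. \<phi> z \<noteq> 0})" using T by (simp add: test_fun_def)
  obtain B where B: "0 \<le> B" "\<And>z. \<bar>\<phi> z\<bar> \<le> B" using compact_support_bounded[OF cont K z0] by blast
  have \<phi>i: "integrable mu \<phi>" if "admissible c mu" for c mu by (rule admissible_integrable_bounded(1)[OF that \<phi>m]) (use B(2) in simp)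
  obtain P \<rho> where P: "0 \<le> P" "0 \<le> \<rho>" "\<And>z. norm (grad_x \<phi> z) \<le> P" "\<And>z. norm (grad_v \<phi> z) \<le> P"
    "\<And>z. norm (snd z) * norm (grad_x \<phi> z) \<le> \<rho> * P" "\<And>z. norm (snd z) * norm (grad_v \<phi> z) \<le> \<rho> * P"
    "grad_x \<phi> \<in> borel_measurable borel" "grad_v \<phi> \<in> borel_measurable borel"
    using test_fun_gradients[OF T] by blast
  note dt = drift_terms[OF P(7,8,4,5,6,1)]
  have m1: "(\<lambda>z. dens t z * \<phi> z) \<in> borel_measurable borel" by (intro borel_measurable_times dens_section_measurable \<phi>m)
  note L1 = lebesgue_borel_AE(2,3)[OF m1, of "\<lambda>z. dens t z * \<phi> z"]
  show "integrable lebesgue (\<lambda>z. dens t z * \<phi> z)"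
    using L1(1) nu_integral(1)[OF t \<phi>m] \<phi>i[OF nu_admissible[OF t]] by simp
  have E1: "(LINT z|lebesgue. dens t z * \<phi> z) = (LINT z|nu t. \<phi> z)" using L1(2) nu_integral(2)[OF t \<phi>m] by simp
  have m0: "(\<lambda>z. f1 z * \<phi> z) \<in> borel_measurable borel" by (intro borel_measurable_times f1 \<phi>m)
  have ae0: "AE z in lborel. f0 z * \<phi> z = f1 z * \<phi> z" using f0 by eventually_elim simp
  note L0 = lebesgue_borel_AE(2,3)[OF m0 ae0]
  have d0: "integrable mu0 \<phi> \<longleftrightarrow> integrable lborel (\<lambda>z. f1 z *\<^sub>R \<phi> z)" "(LINT z|mu0. \<phi> z) = (LINT z|lborel. f1 z *\<^sub>R \<phi> z)"
  proof -
    have a: "\<phi> \<in> borel_measurable lborel" "f1 \<in> borel_measurable lborel" "AE z in lborel. 0 \<le> f1 z" using f1(1,2) \<phi>m by auto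
    show "integrable mu0 \<phi> \<longleftrightarrow> integrable lborel (\<lambda>z. f1 z *\<^sub>R \<phi> z)" unfolding f1(3) by (rule integrable_density[OF a])
    show "(LINT z|mu0. \<phi> z) = (LINT z|lborel. f1 z *\<^sub>R \<phi> z)" unfolding f1(3) by (rule integral_density[OF a])
  qed
  show "integrable lebesgue (\<lambda>z. f0 z * \<phi> z)" using L0(1) d0(1) \<phi>i[OF admissible_mu0] by simp
  have E0': "(LINT z|lebesgue. f0 z * \<phi> z) = (LINT z|mu0. \<phi> z)" using L0(2) d0(2) by simp
  note W = weak_limit[OF T t]
  have q1: "AE z in lborel. (dens s z *\<^sub>R snd z) \<bullet> grad_x \<phi> z = dens s z * (snd z \<bullet> grad_x \<phi> z)" for s by simp
  have q2: "AE z in lborel. (dens s z *\<^sub>R conv H (dens s) z) \<bullet> grad_v \<phi> z = dens s z * ((LINT y|nu s. F (z - y)) \<bullet> grad_v \<phi> z)" if "0 \<le> s" for s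
  proof (rule AE_I2)
    fix z :: phase
    show "(dens s z *\<^sub>R conv H (dens s) z) \<bullet> grad_v \<phi> z = dens s z * ((LINT y|nu s. F (z - y)) \<bullet> grad_v \<phi> z)"
      using conv_dens(2)[OF that FG, of "fst z" "snd z"] by simp
  qed
  have q3: "AE z in lborel. (dens s z *\<^sub>R acceleration k z) \<bullet> grad_v \<phi> z = dens s z * ((g (fst z) - snd z) \<bullet> grad_v \<phi> z)" for s
    using AE_fst_lborel[OF gg] by eventually_elim (simp add: acceleration_def case_prod_beta)
  have j1: "integrable (nu s) (\<lambda>z. snd z \<bullet> grad_x \<phi> z)" if "0 \<le> s" for s
    by (rule admissible_integrable_bounded(1)[OF nu_admissible[OF that] dt(1)]) (use dt(2) in simp)
  have j2: "integrable (nu s) (\<lambda>z. (LINT y|nu s. F (z - y)) \<bullet> grad_v \<phi> z)" if "0 \<le> s" for s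
    by (rule admissible_integrable_bounded(1)[OF nu_admissible[OF that] dt(5)[OF nu_admissible[OF that]]]) (use dt(6)[OF nu_admissible[OF that]] in simp)
  have j3: "integrable (nu s) (\<lambda>z. (g (fst z) - snd z) \<bullet> grad_v \<phi> z)" if "0 \<le> s" for s
    by (rule admissible_integrable_bounded(1)[OF nu_admissible[OF that] dt(3)]) (use dt(4) in simp)
  note t1 = time_integral_transfer[OF dt(1) j1 q1 W(1)]
  note t2 = time_integral_transfer[OF dt(5)[OF nu_admissible] j2 q2 W(2)]
  note t3 = time_integral_transfer[OF dt(3) j3 q3 W(3)]
  show "time_integrable t (\<lambda>s z. (dens s z *\<^sub>R snd z) \<bullet> grad_x \<phi> z)" by (rule t1(1))
  show "time_integrable t (\<lambda>s z. (dens s z *\<^sub>R conv H (dens s) z) \<bullet> grad_v \<phi> z)" by (rule t2(1))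
  show "time_integrable t (\<lambda>s z. (dens s z *\<^sub>R acceleration k z) \<bullet> grad_v \<phi> z)" by (rule t3(1))
  show "(LINT z|lebesgue. dens t z * \<phi> z) =
          (LINT z|lebesgue. f0 z * \<phi> z)
          + (LINT s:{0..t}|lebesgue. (LINT z|lebesgue. (dens s z *\<^sub>R snd z) \<bullet> grad_x \<phi> z))
          + (LINT s:{0..t}|lebesgue. (LINT z|lebesgue. (dens s z *\<^sub>R conv H (dens s) z) \<bullet> grad_v \<phi> z))
          + (LINT s:{0..t}|lebesgue. (LINT z|lebesgue. (dens s z *\<^sub>R acceleration k z) \<bullet> grad_v \<phi> z))"
  proof -
    have e1: "(LINT s:{0..t}|lebesgue. (LINT z|lebesgue. (dens s z *\<^sub>R snd z) \<bullet> grad_x \<phi> z)) =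
        (LINT s:{0..t}|lborel. LINT z|nu s. snd z \<bullet> grad_x \<phi> z)" by (rule t1(2))
    have e2: "(LINT s:{0..t}|lebesgue. (LINT z|lebesgue. (dens s z *\<^sub>R conv H (dens s) z) \<bullet> grad_v \<phi> z)) =
        (LINT s:{0..t}|lborel. LINT z|nu s. (LINT y|nu s. F (z - y)) \<bullet> grad_v \<phi> z)" by (rule t2(2))
    have e3: "(LINT s:{0..t}|lebesgue. (LINT z|lebesgue. (dens s z *\<^sub>R acceleration k z) \<bullet> grad_v \<phi> z)) =
        (LINT s:{0..t}|lborel. LINT z|nu s. (g (fst z) - snd z) \<bullet> grad_v \<phi> z)" by (rule t3(2))
    show ?thesis unfolding E1 E0' e1 e2 e3 by (rule W(4))
  qed
qed

end

text \<open>Isolates the data that the construction needs: Borel functions with bounds at every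
  point. The original force, acceleration and initial datum enter only through equality almost
  everywhere.\<close>

lemma weak_solution_exists:
  fixes F F' :: "phase \<Rightarrow> real^2" and g g' :: "real^2 \<Rightarrow> real^2" and f0 f1 :: "phase \<Rightarrow> real"
  assumes F': "F' \<in> borel_measurable borel" "\<And>z. norm (F' z) \<le> BF"
      "\<And>e. AE z in lborel. norm (F' (fst z, snd z + e) - F' z) \<le> L * norm e" "0 \<le> L"
    and FF': "AE z in lborel. F z = F' z"
    and g': "g' \<in> borel_measurable borel" "\<And>x. norm (g' x) \<le> Bg" and gg': "AE x in lborel. g x = g' x"
    and f1: "f1 \<in> borel_measurable borel" "\<And>z. 0 \<le> f1 z \<and> f1 z \<le> K" "0 \<le> K" and f01: "AE z in lborel. f0 z = f1 z"
    and int: "integrable lborel f1" and mom: "integrable lborel (\<lambda>z. f1 z * (norm z)\<^sup>2)"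
  shows "\<exists>f. in_Linf_L1 f \<and> weak_solution F (acceleration g) f0 f \<and>
           (\<exists>C. \<forall>t\<ge>0.
              (AE z in lebesgue. 0 \<le> f t z \<and> f t z \<le> K * exp (C * t)) \<and>
              integrable lebesgue (f t) \<and> mass (f t) = mass f0 \<and>
              integrable lebesgue (\<lambda>(x, v). 1/2 * (norm v)\<^sup>2 * f t (x, v)) \<and>
              kinetic_energy (f t) \<le> C)"
proof -
  define mu0 where "mu0 = density lborel (\<lambda>z. ennreal (f1 z))"
  have f1l: "f1 \<in> borel_measurable lborel" "AE z in lborel. 0 \<le> f1 z" using f1 by auto
  interpret mean_field F' g' BF Bg L K mu0
  proof (rule mean_field.intro)
    show "sets mu0 = sets borel" by (simp add: mu0_def)
    show "finite_measure mu0"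
    proof (rule finite_measureI)
      have "emeasure mu0 (space mu0) = (\<integral>\<^sup>+z. ennreal (f1 z) \<partial>lborel)"
        unfolding mu0_def using f1l(1) by (subst emeasure_density) (auto intro!: nn_integral_cong)
      also have "\<dots> = ennreal (LINT z|lborel. f1 z)" by (rule nn_integral_eq_integral[OF int f1l(2)])
      finally show "emeasure mu0 (space mu0) \<noteq> \<infinity>" by simp
    qed
    show "emeasure mu0 A \<le> ennreal K * emeasure lborel A" if A: "A \<in> sets borel" for A
    proof -
      have "emeasure mu0 A = (\<integral>\<^sup>+z. ennreal (f1 z) * indicator A z \<partial>lborel)"
        unfolding mu0_def using f1l(1) A by (subst emeasure_density) auto
      also have "\<dots> \<le> (\<integral>\<^sup>+z. ennreal K * indicator A z \<partial>lborel)"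
        using f1(2) by (intro nn_integral_mono mult_right_mono ennreal_leI) auto
      also have "\<dots> = ennreal K * emeasure lborel A" using A by (intro nn_integral_cmult_indicator) simp
      finally show ?thesis .
    qed
    show "integrable mu0 (\<lambda>z. (norm z)\<^sup>2)"
      unfolding mu0_def using mom by (subst integrable_density[OF _ f1l]) auto
  qed (fact F' g' f1(3))+
  show ?thesis
  proof (rule limit_path)
    fix r nu assume lim: "strict_mono r" "\<And>t. 0 \<le> t \<Longrightarrow> admissible (K * exp (4 * accel_lip * t)) (nu t)"
      "\<And>t A. 0 \<le> t \<Longrightarrow> A \<in> sets borel \<Longrightarrow> (\<lambda>j. measure (path (r j) t) A) \<longlonglongrightarrow> measure (nu t) A"
      "\<And>t. 0 \<le> t \<Longrightarrow> integrable (nu t) (\<lambda>z. (norm (snd z))\<^sup>2) \<and> (LINT z|nu t. (norm (snd z))\<^sup>2) \<le> energy_bound"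
    interpret mean_field_limit F' g' BF Bg L K mu0 r nu
      by (rule mean_field_limit.intro[OF mean_field_axioms mean_field_limit_axioms.intro[OF lim unif_dom_path_pair unif_dom_path]])
    \<comment> \<open>One constant has to serve as exponential rate of the density bound and as
      bound of the kinetic energy.\<close>
    define C where "C = max (4 * accel_lip) energy_bound"
    have energy_bound: "0 \<le> energy_bound"
    proof -
      have "0 \<le> (LINT z|mu0. (norm (snd z))\<^sup>2)" by (rule integral_nonneg_AE) simp
      then show ?thesis using M_nonneg by (simp add: energy_bound_def)
    qed
    have mass0: "mass f0 = M"
    proof -
      have "mass f0 = (LINT z|lborel. f1 z)" unfolding mass_def by (rule lebesgue_borel_AE(3)[OF f1(1) f01])
      also have "\<dots> = (LINT z|mu0. 1)" unfolding mu0_def using integral_density[OF _ f1l, of "\<lambda>_. 1 :: real"] by simp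
      also have "\<dots> = M" using admissible_integral_const[OF admissible_mu0, of 1] by simp
      finally show ?thesis .
    qed
    have "(AE z in lebesgue. 0 \<le> dens t z \<and> dens t z \<le> K * exp (C * t)) \<and>
              integrable lebesgue (dens t) \<and> mass (dens t) = mass f0 \<and>
              integrable lebesgue (\<lambda>(x, v). 1/2 * (norm v)\<^sup>2 * dens t (x, v)) \<and>
              kinetic_energy (dens t) \<le> C" if t: "0 \<le> t" for t
    proof (intro conjI)
      have "4 * accel_lip * t \<le> C * t" using t by (intro mult_right_mono) (auto simp: C_def)
      then have le: "K * exp (4 * accel_lip * t) \<le> K * exp (C * t)" using f1(3) by (intro mult_left_mono) auto
      show "AE z in lebesgue. 0 \<le> dens t z \<and> dens t z \<le> K * exp (C * t)"
        using dens_nu(1)[OF t] unfolding AE_completion_iff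
      proof eventually_elim
        case (elim z)
        then show ?case using le by linarith
      qed
      note LD = lebesgue_borel_AE(2,3)[OF dens_section_measurable, of "dens t" t]
      show "integrable lebesgue (dens t)" using LD(1) dens_integrals(1)[OF t] by simp
      show "mass (dens t) = mass f0" unfolding mass0 unfolding mass_def using LD(2) dens_integrals(2)[OF t] by simp
      have m: "(\<lambda>z. dens t z * (norm (snd z))\<^sup>2) \<in> borel_measurable borel"
        by (intro borel_measurable_times dens_section_measurable norm_sq_measurable)
      then have m2: "(\<lambda>z. 1/2 * (dens t z * (norm (snd z))\<^sup>2)) \<in> borel_measurable borel" by simp
      have e: "(\<lambda>(x, v). 1/2 * (norm v)\<^sup>2 * dens t (x, v)) = (\<lambda>z. 1/2 * (dens t z * (norm (snd z))\<^sup>2))"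
        by (auto simp: fun_eq_iff)
      note LE = lebesgue_borel_AE(2,3)[OF m2, of "\<lambda>z. 1/2 * (dens t z * (norm (snd z))\<^sup>2)"]
      show "integrable lebesgue (\<lambda>(x, v). 1/2 * (norm v)\<^sup>2 * dens t (x, v))"
        unfolding e using LE(1) dens_integrals(3)[OF t] by simp
      have "kinetic_energy (dens t) = (LINT z|lborel. 1/2 * (dens t z * (norm (snd z))\<^sup>2))"
        unfolding kinetic_energy_def e using LE(2) by simp
      also have "\<dots> = 1/2 * (LINT z|lborel. dens t z * (norm (snd z))\<^sup>2)" by simp
      also have "\<dots> \<le> C" using dens_integrals(4)[OF t] energy_bound unfolding C_def by linarith
      finally show "kinetic_energy (dens t) \<le> C" .
    qed
    moreover have "weak_solution F (acceleration g) f0 dens"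
      by (rule dens_weak_solution[OF FF' gg' f1(1) _ mu0_def f01]) (use f1(2) in simp)
    ultimately show ?thesis using dens_in_Linf_L1 by (intro exI[of _ dens] conjI exI[of _ C] allI impI) simp_all
  qed
qed

theorem theorem2p1:
  fixes V Vr :: "real \<Rightarrow> real^2 \<Rightarrow> real"
    and DvVr :: "real \<Rightarrow> real^2 \<Rightarrow> real^2"
    and H1 H2 :: "real \<Rightarrow> real"
    and R R' :: real
    and g :: "real^2 \<Rightarrow> real^2"
    and f0 :: "(real^2) \<times> (real^2) \<Rightarrow> real"
    and F G :: "(real^2) \<times> (real^2) \<Rightarrow> real^2"
  assumes "R > 0" and "R' > 0"
    and "cutoff R H1" and "cutoff R' H2"
    and "is_dr V Vr" and "is_grad_v Vr DvVr"
    and "in_Linf lebesgue (\<lambda>(x::real^2, v). Vr (norm x) v)"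
    and "in_Linf lebesgue (\<lambda>(x::real^2, v). DvVr (norm x) v)"
    and "in_Linf lebesgue g"
    and "F = force Vr H1 H2" and "G = acceleration g"
    and "AE z in lebesgue. 0 \<le> f0 z"
    and "integrable lebesgue f0" and "in_Linf lebesgue f0"
    and "integrable lebesgue (\<lambda>(x, v). (norm x)\<^sup>2 * f0 (x, v))"
    and "integrable lebesgue (\<lambda>(x, v). 1/2 * (norm v)\<^sup>2 * f0 (x, v))"
  shows "\<exists>f :: real \<Rightarrow> (real^2) \<times> (real^2) \<Rightarrow> real.
           in_Linf_L1 f \<and> weak_solution F G f0 f \<and>
           (\<exists>C. \<forall>t\<ge>0.
              (AE z in lebesgue. 0 \<le> f t z \<and> f t z \<le> Linf_norm lebesgue f0 * exp (C * t)) \<and>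
              integrable lebesgue (f t) \<and> mass (f t) = mass f0 \<and>
              integrable lebesgue (\<lambda>(x, v). 1/2 * (norm v)\<^sup>2 * f t (x, v)) \<and>
              kinetic_energy (f t) \<le> C)"
proof -
  obtain g' Bg where g': "g' \<in> borel_measurable borel" "AE x in lborel. g x = g' x" "\<forall>x. norm (g' x) \<le> Bg"
    by (rule Linf_borel_version[OF assms(9)])
  obtain f1 where f1: "f1 \<in> borel_measurable borel" "AE z in lborel. f0 z = f1 z"
    "\<forall>z. 0 \<le> f1 z \<and> f1 z \<le> Linf_norm lebesgue f0" "0 \<le> Linf_norm lebesgue f0"
    by (rule nonneg_Linf_borel_version[OF assms(14,12)])
  have int: "integrable lborel f1" using lebesgue_borel_AE(2)[OF f1(1,2)] assms(13) by simp
  have "integrable lebesgue (\<lambda>z. (norm (fst z))\<^sup>2 * f0 z)" "integrable lebesgue (\<lambda>z. 1/2 * (norm (snd z))\<^sup>2 * f0 z)"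
    using assms(15,16) by (simp_all only: case_prod_beta' prod.collapse)
  \<comment> \<open>The factor 2 undoes the 1/2 of the kinetic energy, so that the two moments add
    up to the second moment in phase space.\<close>
  then have a: "integrable lebesgue (\<lambda>z. (norm (fst z))\<^sup>2 * f0 z + 2 * (1/2 * (norm (snd z))\<^sup>2 * f0 z))"
    by (intro Bochner_Integration.integrable_add integrable_mult_right)
  have b: "AE z in lborel. (norm (fst z))\<^sup>2 * f0 z + 2 * (1/2 * (norm (snd z))\<^sup>2 * f0 z) = f1 z * (norm z)\<^sup>2"
    using f1(2) by eventually_elim (simp add: norm_phase_sq algebra_simps)
  have c: "(\<lambda>z::phase. f1 z * (norm z)\<^sup>2) \<in> borel_measurable borel"
    by (intro borel_measurable_times f1(1) borel_measurable_continuous_onI continuous_intros)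
  have mom: "integrable lborel (\<lambda>z. f1 z * (norm z)\<^sup>2)" by (rule lebesgue_borel_AE(2)[OF c b, THEN iffD1, OF a])
  show ?thesis
  proof (rule force_regular[OF assms(1,3,4,6,7,8)])
    fix F' BF L
    assume F': "F' \<in> borel_measurable borel" "AE z in lborel. force Vr H1 H2 z = F' z"
      "\<And>z. norm (F' z) \<le> BF" "0 \<le> BF" "0 \<le> L"
      "\<And>e. AE z in lborel. norm (F' (fst z, snd z + e) - F' z) \<le> L * norm e"
    show ?thesis
      unfolding assms(10,11)
      by (rule weak_solution_exists[OF F'(1,3,6,5,2) g'(1) g'(3)[rule_format] g'(2) f1(1) f1(3)[rule_format] f1(4,2) int mom])
  qed
qed

end
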